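(* Let $\alpha,\beta>-1$ and $p\in E(\alpha,\beta)$. If $\alpha<1/p-1/2$ and $\beta<1/p-1/2$, then there exists $f\in\mathcal{W}_{\alpha,\beta}^{p,1}=\mathfrak{W}_{\alpha,\beta}^{p,1}$ such that $f\notin\mathcal{L}_{\alpha,\beta}^{p,1}(-\pi,\pi)$. Furthermore, if $\alpha\le-1/p+1/2$ or $\beta\le-1/p+1/2$, then there exists $g\in\mathcal{L}_{\alpha,\beta}^{p,2}(-\pi,\pi)$ such that $g\notin\mathfrak{W}_{\alpha,\beta}^{p,2}$.
   Context: All $L^p$ spaces are with respect to Lebesgue measure. Let $\langle f_1,f_2\rangle=\int_{-\pi}^{\pi}f_1\overline{f_2}\,d\theta$. For $\alpha,\beta>-1$ set $\lambda_n^{\alpha,\beta}=\big(n+\frac{\alpha+\beta+1}{2}\big)^2$, $\Psi^{\alpha,\beta}(\theta)=|\sin\frac\theta2|^{\alpha+1/2}(\cos\frac\theta2)^{\beta+1/2}$, and $\phi_n^{\alpha,\beta}(\theta)=c_n^{\alpha,\beta}\Psi^{\alpha,\beta}(\theta)P_n^{\alpha,\beta}(\cos\theta)$ for $\theta\in(-\pi,\pi)$, $n\ge0$, where $P_n^{\alpha,\beta}$ are the classical Jacobi polynomials (Szegő's convention) and $c_n^{\alpha,\beta}>0$ is such that $\phi_n^{\alpha,\beta}$ has norm 1 in $L^2(0,\pi)$. Set $\Phi_{2n}^{\alpha,\beta}=\frac1{\sqrt2}\phi_n^{\alpha,\beta}$ and $\Phi_{2n+1}^{\alpha,\beta}(\theta)=\frac1{\sqrt2}\operatorname{sign}(\theta)\phi_n^{\alpha+1,\beta+1}(\theta)$;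 $\{\Phi_n^{\alpha,\beta}\}_{n\ge0}$ is an orthonormal basis of $L^2(-\pi,\pi)$. With $\langle n\rangle=\lfloor\frac{n+1}2\rfloor$, let $\mathbb{L}_{\alpha,\beta}$ be the self-adjoint operator in $L^2(-\pi,\pi)$ with $\mathbb{L}_{\alpha,\beta}\Phi_n^{\alpha,\beta}=\lambda_{\langle n\rangle}^{\alpha,\beta}\Phi_n^{\alpha,\beta}$, and for $\sigma>0$ let $\mathbb{L}_{\alpha,\beta}^{-\sigma}$ (if $\alpha+\beta\ne-1$) and $(\mathrm{Id}+\mathbb{L}_{\alpha,\beta})^{-\sigma}$ be defined spectrally, e.g. $\mathbb{L}_{\alpha,\beta}^{-\sigma}f=\sum_n(\lambda_{\langle n\rangle}^{\alpha,\beta})^{-\sigma}\langle f,\Phi_n^{\alpha,\beta}\rangle\Phi_n^{\alpha,\beta}$. Let $p(\alpha,\beta)=\infty$ if $\alpha,\beta\ge-1/2$ and $p(\alpha,\beta)=-1/\min(\alpha+1/2,\beta+1/2)$ otherwise; $p'(\alpha,\beta)$ is its conjugate exponent and $E(\alpha,\beta)=(p'(\alpha,\beta),p(\alpha,\beta))$. For $p\in E(\alpha,\beta)$ and $\sigma>0$ the operators $\mathbb{L}_{\alpha,\beta}^{-\sigma}$ (if $\alpha+\beta\ne-1$) and $(\mathrm{Id}+\mathbb{L}_{\alpha,\beta})^{-\sigma}$ extend uniquely to bounded injective operators on $L^p(-\pi,\pi)$, denoted by the same symbols. For $p\in E(\alpha,\beta)$, $s>0$, the potential space is $\mathcal{L}_{\alpha,\beta}^{p,s}(-\pi,\pi)=\mathbb{L}_{\alpha,\beta}^{-s/2}(L^p(-\pi,\pi))$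 if $\alpha+\beta\neq-1$, and $(\mathrm{Id}+\mathbb{L}_{\alpha,\beta})^{-s/2}(L^p(-\pi,\pi))$ if $\alpha+\beta=-1$. Symmetrized derivative: with $\check f(\theta)=f(-\theta)$, $$\mathbb{D}_{\alpha,\beta}f=\frac{df}{d\theta}-\Big(\frac{2\alpha+1}4\cot\frac\theta2-\frac{2\beta+1}4\tan\frac\theta2\Big)\check f.$$ Differentiation is understood in the weak sense, on the underlying space $(-\pi,0)\cup(0,\pi)$ (the point $\theta=0$ is excluded). For integers $m\ge1$, $$\mathcal{W}_{\alpha,\beta}^{p,m}=\{f\in L^p(-\pi,\pi):\mathbb{D}_{\alpha,\beta}^kf\in L^p(-\pi,\pi),\ k=1,\dots,m\},$$ $$\mathfrak{W}_{\alpha,\beta}^{p,m}=\{f\in L^p(-\pi,\pi):\mathbb{D}_{\alpha+k-1,\beta+k-1}\cdots\mathbb{D}_{\alpha+1,\beta+1}\mathbb{D}_{\alpha,\beta}f\in L^p(-\pi,\pi),\ k=1,\dots,m\}.$$ *)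

theory Defs
  imports "HOL-Analysis.Analysis"
begin

section \<open>Lebesgue spaces on the interval from -pi to pi\<close>

text \<open>
  Elements of L^p are represented by complex-valued functions on the reals; only their values on
  (-pi, pi), up to null sets, matter. All sets of functions below are closed under almost
  everywhere equality on that interval.
\<close>

abbreviation leb_pi :: "real measure" where
  "leb_pi \<equiv> lebesgue_on {-pi<..<pi}"

definition Lp :: "real \<Rightarrow> (real \<Rightarrow> complex) set" where
  "Lp p = {f \<in> borel_measurable leb_pi. integrable leb_pi (\<lambda>\<theta>. norm (f \<theta>) powr p)}"

definition Lp_norm :: "real \<Rightarrow> (real \<Rightarrow> complex) \<Rightarrow> real" where
  "Lp_norm p f = (LINT \<theta>|leb_pi. norm (f \<theta>) powr p) powr (1 / p)"

text \<open>The membership condition is needed because the Bochner integral of a non-integrable function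
  is 0.\<close>

definition Lp_tendsto :: "real \<Rightarrow> (nat \<Rightarrow> real \<Rightarrow> complex) \<Rightarrow> (real \<Rightarrow> complex) \<Rightarrow> bool" where
  "Lp_tendsto p F f \<longleftrightarrow>
     (\<forall>j. (\<lambda>\<theta>. F j \<theta> - f \<theta>) \<in> Lp p) \<and> (\<lambda>j. Lp_norm p (\<lambda>\<theta>. F j \<theta> - f \<theta>)) \<longlonglongrightarrow> 0"

definition inner_pi :: "(real \<Rightarrow> complex) \<Rightarrow> (real \<Rightarrow> complex) \<Rightarrow> complex" where
  "inner_pi f g = (LINT \<theta>|leb_pi. f \<theta> * cnj (g \<theta>))"

section \<open>Jacobi polynomials and the symmetrized Jacobi system\<close>

text \<open>Szego's explicit formula; the value at 1 is (n + a) gchoose n.\<close>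

definition jacobi_P :: "real \<Rightarrow> real \<Rightarrow> nat \<Rightarrow> real \<Rightarrow> real" where
  "jacobi_P \<alpha> \<beta> n x =
     (\<Sum>k\<le>n. ((real n + \<alpha>) gchoose (n - k)) * ((real n + \<beta>) gchoose k)
             * ((x - 1) / 2) ^ k * ((x + 1) / 2) ^ (n - k))"

definition jacobi_Psi :: "real \<Rightarrow> real \<Rightarrow> real \<Rightarrow> real" where
  "jacobi_Psi \<alpha> \<beta> \<theta> =
     \<bar>sin (\<theta> / 2)\<bar> powr (\<alpha> + 1 / 2) * cos (\<theta> / 2) powr (\<beta> + 1 / 2)"

definition jacobi_c :: "real \<Rightarrow> real \<Rightarrow> nat \<Rightarrow> real" where
  "jacobi_c \<alpha> \<beta> n =
     1 / sqrt (LINT \<theta>|lebesgue_on {0<..<pi}. (jacobi_Psi \<alpha> \<beta> \<theta> * jacobi_P \<alpha> \<beta> n (cos \<theta>))\<^sup>2)"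

definition jacobi_phi :: "real \<Rightarrow> real \<Rightarrow> nat \<Rightarrow> real \<Rightarrow> real" where
  "jacobi_phi \<alpha> \<beta> n \<theta> = jacobi_c \<alpha> \<beta> n * jacobi_Psi \<alpha> \<beta> \<theta> * jacobi_P \<alpha> \<beta> n (cos \<theta>)"

definition jacobi_Phi :: "real \<Rightarrow> real \<Rightarrow> nat \<Rightarrow> real \<Rightarrow> complex" where
  "jacobi_Phi \<alpha> \<beta> n \<theta> =
     complex_of_real
       (if even n then 1 / sqrt 2 * jacobi_phi \<alpha> \<beta> (n div 2) \<theta>
        else 1 / sqrt 2 * sgn \<theta> * jacobi_phi (\<alpha> + 1) (\<beta> + 1) (n div 2) \<theta>)"

definition jacobi_lambda :: "real \<Rightarrow> real \<Rightarrow> nat \<Rightarrow> real" where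
  "jacobi_lambda \<alpha> \<beta> n = (real n + (\<alpha> + \<beta> + 1) / 2)\<^sup>2"

text \<open>The eigenvalue belonging to the n-th function of the symmetrized system.\<close>

definition sym_eigenvalue :: "real \<Rightarrow> real \<Rightarrow> nat \<Rightarrow> real" where
  "sym_eigenvalue \<alpha> \<beta> n = jacobi_lambda \<alpha> \<beta> ((n + 1) div 2)"

section \<open>Negative powers and potential spaces\<close>

text \<open>
  Operators on classes of functions are rendered as relations between representatives.
  The relation \<open>spectral_op \<alpha> \<beta> \<mu> f g\<close> says that \<open>g\<close> is the sum in L^2 of the series with
  terms \<open>\<mu> n * \<langle>f, \<Phi> n\<rangle> * \<Phi> n\<close>.
\<close>

definition spectral_op ::
    "real \<Rightarrow> real \<Rightarrow> (nat \<Rightarrow> real) \<Rightarrow> (real \<Rightarrow> complex) \<Rightarrow> (real \<Rightarrow> complex) \<Rightarrow> bool" where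
  "spectral_op \<alpha> \<beta> \<mu> f g \<longleftrightarrow>
     f \<in> Lp 2 \<and> g \<in> Lp 2 \<and>
     Lp_tendsto 2
       (\<lambda>N \<theta>. \<Sum>n<N. of_real (\<mu> n) * inner_pi f (jacobi_Phi \<alpha> \<beta> n) * jacobi_Phi \<alpha> \<beta> n \<theta>) g"

definition L_neg_power ::
    "real \<Rightarrow> real \<Rightarrow> real \<Rightarrow> (real \<Rightarrow> complex) \<Rightarrow> (real \<Rightarrow> complex) \<Rightarrow> bool" where
  "L_neg_power \<alpha> \<beta> \<sigma> = spectral_op \<alpha> \<beta> (\<lambda>n. sym_eigenvalue \<alpha> \<beta> n powr (- \<sigma>))"

definition Id_L_neg_power ::
    "real \<Rightarrow> real \<Rightarrow> real \<Rightarrow> (real \<Rightarrow> complex) \<Rightarrow> (real \<Rightarrow> complex) \<Rightarrow> bool" where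
  "Id_L_neg_power \<alpha> \<beta> \<sigma> = spectral_op \<alpha> \<beta> (\<lambda>n. (1 + sym_eigenvalue \<alpha> \<beta> n) powr (- \<sigma>))"

text \<open>
  Extension by continuity to L^p of an operator \<open>T\<close> on L^2: the value at \<open>f\<close> is the
  L^p-limit of \<open>T (F j)\<close> for \<open>F j\<close> in the intersection of L^2 and L^p, dense in L^p, with
  \<open>F j\<close> tending to \<open>f\<close> in L^p. If \<open>T\<close> has a bounded extension to L^p, this is its graph.
\<close>

definition Lp_extension ::
    "real \<Rightarrow> ((real \<Rightarrow> complex) \<Rightarrow> (real \<Rightarrow> complex) \<Rightarrow> bool) \<Rightarrow>
     (real \<Rightarrow> complex) \<Rightarrow> (real \<Rightarrow> complex) \<Rightarrow> bool" where
  "Lp_extension p T f g \<longleftrightarrow>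
     f \<in> Lp p \<and> g \<in> Lp p \<and>
     (\<exists>F G. (\<forall>j. F j \<in> Lp 2 \<inter> Lp p \<and> G j \<in> Lp p \<and> T (F j) (G j)) \<and>
            Lp_tendsto p F f \<and> Lp_tendsto p G g)"

definition potential_space :: "real \<Rightarrow> real \<Rightarrow> real \<Rightarrow> real \<Rightarrow> (real \<Rightarrow> complex) set" where
  "potential_space \<alpha> \<beta> p s =
     (if \<alpha> + \<beta> \<noteq> -1
      then {g. \<exists>f \<in> Lp p. Lp_extension p (L_neg_power \<alpha> \<beta> (s / 2)) f g}
      else {g. \<exists>f \<in> Lp p. Lp_extension p (Id_L_neg_power \<alpha> \<beta> (s / 2)) f g})"

section \<open>Admissible exponents\<close>

definition crit_exponent :: "real \<Rightarrow> real \<Rightarrow> ereal" where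
  "crit_exponent \<alpha> \<beta> =
     (if \<alpha> \<ge> -1/2 \<and> \<beta> \<ge> -1/2 then \<infinity> else ereal (- 1 / min (\<alpha> + 1/2) (\<beta> + 1/2)))"

text \<open>Only applied to values greater than 1.\<close>

definition conj_exponent :: "ereal \<Rightarrow> ereal" where
  "conj_exponent q = (if q = \<infinity> then 1 else ereal (real_of_ereal q / (real_of_ereal q - 1)))"

definition exponents_E :: "real \<Rightarrow> real \<Rightarrow> real set" where
  "exponents_E \<alpha> \<beta> =
     {p. conj_exponent (crit_exponent \<alpha> \<beta>) < ereal p \<and> ereal p < crit_exponent \<alpha> \<beta>}"

section \<open>Symmetrized derivative and Sobolev spaces\<close>

definition punctured :: "real set" where
  "punctured = {-pi<..<0} \<union> {0<..<pi}"

definition test_function :: "(real \<Rightarrow> real) \<Rightarrow> bool" where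
  "test_function \<eta> \<longleftrightarrow>
     (\<forall>n x. (deriv ^^ n) \<eta> differentiable (at x)) \<and>
     compact (closure {x. \<eta> x \<noteq> 0}) \<and> closure {x. \<eta> x \<noteq> 0} \<subseteq> punctured"

definition locally_integrable :: "(real \<Rightarrow> complex) \<Rightarrow> bool" where
  "locally_integrable f \<longleftrightarrow> (\<forall>K. compact K \<and> K \<subseteq> punctured \<longrightarrow> integrable (lebesgue_on K) f)"

definition weak_deriv :: "(real \<Rightarrow> complex) \<Rightarrow> (real \<Rightarrow> complex) \<Rightarrow> bool" where
  "weak_deriv f g \<longleftrightarrow>
     locally_integrable f \<and> locally_integrable g \<and>
     (\<forall>\<eta>. test_function \<eta> \<longrightarrow>
        (LINT \<theta>|lebesgue_on punctured. f \<theta> * of_real (deriv \<eta> \<theta>)) =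
        - (LINT \<theta>|lebesgue_on punctured. g \<theta> * of_real (\<eta> \<theta>)))"

text \<open>\<open>sym_deriv \<alpha> \<beta> f h\<close> says that \<open>h\<close> is the symmetrized derivative of \<open>f\<close>: the weak
  derivative of \<open>f\<close> is \<open>h\<close> plus the zero-order term applied to the reflection of \<open>f\<close>.\<close>

definition sym_deriv ::
    "real \<Rightarrow> real \<Rightarrow> (real \<Rightarrow> complex) \<Rightarrow> (real \<Rightarrow> complex) \<Rightarrow> bool" where
  "sym_deriv \<alpha> \<beta> f h \<longleftrightarrow>
     weak_deriv f (\<lambda>\<theta>. h \<theta> +
       of_real ((2 * \<alpha> + 1) / 4 * cot (\<theta> / 2) - (2 * \<beta> + 1) / 4 * tan (\<theta> / 2)) * f (- \<theta>))"

text \<open>In both spaces \<open>h k\<close> is the k-th iterated derivative. As all derivatives up to order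
  \<open>m\<close> are required to lie in L^p, no distributions beyond functions occur.\<close>

definition sobolev_W :: "real \<Rightarrow> real \<Rightarrow> real \<Rightarrow> nat \<Rightarrow> (real \<Rightarrow> complex) set" where
  "sobolev_W \<alpha> \<beta> p m =
     {f \<in> Lp p. \<exists>h. h 0 = f \<and>
        (\<forall>k<m. sym_deriv \<alpha> \<beta> (h k) (h (Suc k)) \<and> h (Suc k) \<in> Lp p)}"

definition sobolev_frakW :: "real \<Rightarrow> real \<Rightarrow> real \<Rightarrow> nat \<Rightarrow> (real \<Rightarrow> complex) set" where
  "sobolev_frakW \<alpha> \<beta> p m =
     {f \<in> Lp p. \<exists>h. h 0 = f \<and>
        (\<forall>k<m. sym_deriv (\<alpha> + real k) (\<beta> + real k) (h k) (h (Suc k)) \<and> h (Suc k) \<in> Lp p)}"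

end

(*
  First part. The function f = sgn / Psi is annihilated by the symmetrized derivative. If f were
  the image of g in L^p under L^(-1/2), pairing with the odd eigenfunctions would give
  <g, sgn Psi' P_m> = 2 s_m l_m, where Psi' and P_m belong to the parameters a = alpha + 1 and
  b = beta + 1, s_m is the square root of the eigenvalue and l_m is the integral of P_m over [0, 1]
  in the variable y = cos^2(theta / 2). Expand y^N = sum r_m P_m; for a >= b all r_m and l_m are
  nonnegative (otherwise use (1 - y)^N). The moments sum r_m l_m s_m^2 and sum r_m l_m s_m^4 are
  integrals of powers of the Jacobi operator applied to y^N, of sizes 1 and N, so that
  sum r_m l_m s_m >= c / sqrt N. But sqrt N <g, sgn Psi' y^N> tends to 0 by dominated convergence.

  Second part. The first odd eigenfunction lies in every potential space, while its second
  derivative is, near 0 and pi, of the order of theta^(alpha - 1/2) and (pi - theta)^(beta - 1/2).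
*)
theory Submission
  imports Defs "HOL-Computational_Algebra.Polynomial"
begin

text \<open>A single factor s_m has no closed form: s_m^2 is the eigenvalue of a differential
  operator, so only even moments are integrals that can be computed. Hence the detour through two
  even moments. The second one does not fade with N because the plain integral of the operator
  applied to q contains the boundary term a q(1): the operator is symmetric for the Jacobi weight,
  not for dy. The measure dy itself comes from Psi' = |sin(theta/2)| cos(theta/2) Psi: f times sgn
  Psi' is sin cos on (0, pi), the density of dy up to sign. The same factor makes the dominated
  convergence work: sqrt N |sin| cos y^N is at most 1 and tends to 0 pointwise, while |g| Psi is
  integrable since p lies in E. Pairings use odd eigenfunctions because a, b > 0 makes them bounded
  for all \<alpha>, \<beta> > -1, so the pairings are continuous on L^p. The signs of r_m and l_m
  matter because an inequality between powers of s_m is summed against r_m l_m; the sign of l_m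
  depends on which parameter is larger, hence the choice between y and 1 - y.\<close>

section \<open>Jacobi polynomials in the variable \<open>y = (1 + x) / 2\<close>\<close>

text \<open>Minus the Jacobi differential operator: with the weight w = (1-y)^a y^b it is
  -((1-y)^(a+1) y^(b+1) q')' / w. The sign makes the eigenvalues \<open>jeig\<close> nonnegative for
  positive a and b. The endpoint y = 1 is theta = 0, and y = 0 is theta = pi.\<close>

definition jop :: "real \<Rightarrow> real \<Rightarrow> real poly \<Rightarrow> real poly" where
  "jop a b q = [:0,-1,1:] * pderiv (pderiv q) + [:-(b+1), a+b+2:] * pderiv q"

definition jacobi_coef :: "real \<Rightarrow> real \<Rightarrow> nat \<Rightarrow> nat \<Rightarrow> real" where
  "jacobi_coef a b n k = ((real n + a) gchoose (n - k)) * ((real n + b) gchoose k)"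

definition jacobi_poly :: "real \<Rightarrow> real \<Rightarrow> nat \<Rightarrow> real poly" where
  "jacobi_poly a b n = (\<Sum>k\<le>n. smult (jacobi_coef a b n k) ([:-1,1:] ^ k * [:0,1:] ^ (n - k)))"

definition jeig :: "real \<Rightarrow> real \<Rightarrow> nat \<Rightarrow> real" where
  "jeig a b n = real n * (real n + a + b + 1)"

lemma poly_jacobi_poly: "poly (jacobi_poly a b n) y = jacobi_P a b n (2 * y - 1)"
  unfolding jacobi_poly_def jacobi_P_def jacobi_coef_def poly_sum
  by (rule sum.cong) (simp_all add: mult_ac diff_divide_distrib add_divide_distrib)

lemma jop_add: "jop a b (p + q) = jop a b p + jop a b q"
  by (simp add: jop_def pderiv_add distrib_left del: mult_pCons_left)

lemma jop_smult: "jop a b (smult c p) = smult c (jop a b p)"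
  by (simp only: jop_def pderiv_smult smult_add_right mult_smult_right)

lemma jop_0 [simp]: "jop a b 0 = 0"
  by (simp add: jop_def)

lemma jop_diff: "jop a b (p - q) = jop a b p - jop a b q"
  using jop_add[of a b "p - q" q] by simp

lemma smult_sum_right: "smult c (sum f A) = (\<Sum>x\<in>A. smult c (f x))"
  by (induction A rule: infinite_finite_induct) (simp_all add: smult_add_right)

lemma jop_sum: "jop a b (sum f A) = (\<Sum>x\<in>A. jop a b (f x))"
  by (induction A rule: infinite_finite_induct) (simp_all add: jop_add)

lemma coeff_linear_mult:
  fixes q :: "real poly"
  shows "coeff ([:u, v:] * q) j = u * coeff q j + v * (if j = 0 then 0 else coeff q (j - 1))"
  by (cases j) (simp_all)

text \<open>On monomials the operator is bidiagonal, y^j going to a combination of y^j and y^(j-1),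
  so eigenvalues can be read off leading coefficients. Factoring y^2 - y brings every multiplication
  into the form of \<open>coeff_linear_mult\<close>.\<close>

lemma coeff_jop:
  "coeff (jop a b q) j = jeig a b j * coeff q j - real (j + 1) * (real j + 1 + b) * coeff q (j + 1)"
proof -
  have e: "[:0,-1,1:] = [:0,1:] * [:-1,1::real:]" by simp
  show ?thesis
    unfolding jop_def e mult.assoc coeff_add coeff_linear_mult
    by (cases j; cases "j - 1") (auto simp: coeff_pderiv jeig_def algebra_simps)
qed

text \<open>Euler's identity, used for y and for y - 1. Multiplying by l keeps the exponents k - 1
  and k - 2, with their truncated subtraction, out of the calculation.\<close>

lemma pderiv_power_Euler:
  fixes l :: "real poly"
  assumes "pderiv l = 1"
  shows "l * pderiv (l ^ k) = smult (real k) (l ^ k)"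
    and "l * pderiv (pderiv (l ^ k)) = smult (real k - 1) (pderiv (l ^ k))"
proof -
  show 1: "l * pderiv (l ^ k) = smult (real k) (l ^ k)" for k
    using assms by (cases k) (simp_all add: pderiv_power_Suc del: power_Suc of_nat_Suc, simp)
  have "pderiv (l * pderiv (l ^ k)) = smult (real k) (pderiv (l ^ k))"
    by (simp add: 1 pderiv_smult)
  then have "l * pderiv (pderiv (l ^ k)) + pderiv (l ^ k) = smult (real k) (pderiv (l ^ k))"
    by (simp add: pderiv_mult assms)
  then show "l * pderiv (pderiv (l ^ k)) = smult (real k - 1) (pderiv (l ^ k))"
    by (simp add: smult_diff_left eq_diff_eq)
qed

text \<open>Tridiagonal in the basis of Szego's formula: y^2 - y is the product of the two base
  polynomials and the first-order coefficient is (a+1) y + (b+1) (y-1), so by Euler's identities at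
  most one factor moves from one power to the other. The truncated exponents \<open>k - 1\<close>
  and \<open>m - 1\<close> come with coefficients that vanish at 0.\<close>

lemma jop_basis:
  "jop a b ([:-1,1:] ^ k * [:0,1:] ^ m) =
     smult (real k * (real k + a)) ([:-1,1:] ^ (k - 1) * [:0,1:] ^ (m + 1))
   + smult (2 * real k * real m + (a + 1) * real m + (b + 1) * real k) ([:-1,1:] ^ k * [:0,1:] ^ m)
   + smult (real m * (real m + b)) ([:-1,1:] ^ (k + 1) * [:0,1:] ^ (m - 1))"
proof -
  define z y :: "real poly" where "z = [:-1,1:]" and "y = [:0,1:]"
  have dz: "pderiv z = 1" and dy: "pderiv y = 1"
    by (simp_all add: z_def y_def pderiv_pCons)
  define U V where "U = z ^ k" and "V = y ^ m"
  define U1 V1 where "U1 = pderiv U" and "V1 = pderiv V"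
  define U2 V2 where "U2 = pderiv U1" and "V2 = pderiv V1"
  note defs = U_def V_def U1_def V1_def U2_def V2_def
  have zU: "z * U1 = smult (real k) U" "z * U2 = smult (real k - 1) U1"
    using pderiv_power_Euler[OF dz, of k] by (simp_all add: defs)
  have yV: "y * V1 = smult (real m) V" "y * V2 = smult (real m - 1) V1"
    using pderiv_power_Euler[OF dy, of m] by (simp_all add: defs)
  have U1: "U1 = smult (real k) (z ^ (k - 1))" and V1: "V1 = smult (real m) (y ^ (m - 1))"
    by (simp_all add: defs pderiv_power dz dy)
  have yz: "[:0,-1,1:] = y * z" "[:-(b+1), a+b+2:] = smult (a + 1) y + smult (b + 1) z"
    by (simp_all add: y_def z_def)
  have UV: "jop a b (U * V) = (y * z) * (U2 * V + 2 * U1 * V1 + U * V2)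
      + (smult (a + 1) y + smult (b + 1) z) * (U1 * V + U * V1)"
    unfolding jop_def yz
    by (simp add: pderiv_mult pderiv_add U1_def[symmetric] V1_def[symmetric]
        U2_def[symmetric] V2_def[symmetric] algebra_simps)
  \<comment> \<open>The four Euler relations, evaluated at a point, are the hypotheses from which
    \<open>algebra\<close> derives the identity of values; polynomials with equal values are
    equal.\<close>
  also have "poly \<dots> x = poly (smult (real k + a) (U1 * y * V)
      + smult (2 * real k * real m + (a + 1) * real m + (b + 1) * real k) (U * V)
      + smult (real m + b) (z * U * V1)) x" for x
  proof -
    have e: "poly z x * poly U1 x = real k * poly U x"
            "poly z x * poly U2 x = (real k - 1) * poly U1 x"
            "poly y x * poly V1 x = real m * poly V x"
            "poly y x * poly V2 x = (real m - 1) * poly V1 x"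
      using zU yV by (metis poly_mult poly_smult)+
    show ?thesis
      using e by (simp only: poly_add poly_mult poly_smult poly_numeral) algebra
  qed
  ultimately have "jop a b (U * V) = smult (real k + a) (U1 * y * V)
      + smult (2 * real k * real m + (a + 1) * real m + (b + 1) * real k) (U * V)
      + smult (real m + b) (z * U * V1)"
    by (metis poly_eq_poly_eq_iff ext)
  then show ?thesis
    by (simp add: U1 V1 U_def V_def y_def[symmetric] z_def[symmetric] algebra_simps)
qed

text \<open>Detailed balance: in the tridiagonal form of \<open>jop_basis\<close>, the entry leading
  from k up to k + 1 and the entry leading from k + 1 down to k carry the same weight.\<close>

lemma jacobi_coef_Suc:
  assumes "k < n"
  shows "jacobi_coef a b n (Suc k) * (real (Suc k) * (real (Suc k) + a))
       = jacobi_coef a b n k * (real (n - k) * (real (n - k) + b))"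
proof -
  obtain m where m: "n = Suc (k + m)" using assms less_imp_Suc_add by blast
  have 1: "((real n + b) gchoose Suc k) * real (Suc k) = ((real n + b) gchoose k) * (real n + b - real k)"
    using gbinomial_mult_1[of "real n + b" k] by (simp add: algebra_simps)
  have 2: "((real n + a) gchoose Suc m) * real (Suc m) = ((real n + a) gchoose m) * (real n + a - real m)"
    using gbinomial_mult_1[of "real n + a" m] by (simp add: algebra_simps)
  have "jacobi_coef a b n (Suc k) * (real (Suc k) * (real (Suc k) + a))
     = (((real n + a) gchoose m) * (real n + a - real m)) * (((real n + b) gchoose Suc k) * real (Suc k))"
    by (simp add: jacobi_coef_def m)
  also have "\<dots> = (((real n + a) gchoose Suc m) * real (Suc m)) * (((real n + b) gchoose k) * (real n + b - real k))"
    by (simp only: 1 2)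
  also have "\<dots> = jacobi_coef a b n k * (real (n - k) * (real (n - k) + b))"
    by (simp add: jacobi_coef_def m Suc_diff_le)
  finally show ?thesis .
qed

text \<open>By detailed balance an index shift makes both off-diagonal sums diagonal. There remains
  A k + D k + B k, which does not depend on k: for n = k + m it completes to (k+m)
  (k+m+a+b+1).\<close>

theorem jop_jacobi_poly: "jop a b (jacobi_poly a b n) = smult (jeig a b n) (jacobi_poly a b n)"
proof -
  define c where "c = jacobi_coef a b n"
  define u where "u = (\<lambda>k. [:-1,1::real:] ^ k * [:0,1:] ^ (n - k))"
  define A where "A = (\<lambda>k. real k * (real k + a))"
  define B where "B = (\<lambda>k. real (n - k) * (real (n - k) + b))"
  define D where "D = (\<lambda>k. 2 * real k * real (n - k) + (a + 1) * real (n - k) + (b + 1) * real k)"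
  have cc: "c (Suc k) * A (Suc k) = c k * B k" if "k < n" for k
    using jacobi_coef_Suc[OF that] by (simp add: c_def A_def B_def)
  have J: "jop a b (u k) = smult (A k) (u (k - 1)) + smult (D k) (u k) + smult (B k) (u (Suc k))"
    if "k \<le> n" for k
  proof -
    have "smult (A k) ([:-1,1:] ^ (k - 1) * [:0,1:] ^ (n - k + 1)) = smult (A k) (u (k - 1))"
      using that by (cases k) (auto simp: u_def A_def Suc_diff_Suc Suc_diff_le)
    moreover have "smult (B k) ([:-1,1:] ^ (k + 1) * [:0,1:] ^ (n - k - 1)) = smult (B k) (u (Suc k))"
      by (simp add: u_def)
    ultimately show ?thesis
      unfolding u_def jop_basis A_def B_def D_def by metis
  qed
  have S1: "(\<Sum>k\<le>n. smult (c k * A k) (u (k - 1))) = (\<Sum>k\<le>n. smult (c k * B k) (u k))"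
  proof (cases n)
    case 0 then show ?thesis by (simp add: A_def B_def)
  next
    case (Suc m)
    \<comment> \<open>The term k = 0 drops out because A 0 = 0; at the other end the term k = n may
      be added because B n = 0.\<close>
    have "(\<Sum>k\<le>n. smult (c k * A k) (u (k - 1))) = (\<Sum>k\<le>m. smult (c (Suc k) * A (Suc k)) (u k))"
      unfolding Suc sum.atMost_Suc_shift by (simp add: A_def)
    also have "\<dots> = (\<Sum>k\<le>m. smult (c k * B k) (u k))"
      by (rule sum.cong) (auto simp: cc Suc)
    also have "\<dots> = (\<Sum>k\<le>n. smult (c k * B k) (u k))"
      unfolding Suc sum.atMost_Suc by (simp add: B_def Suc)
    finally show ?thesis .
  qed
  have S2: "(\<Sum>k\<le>n. smult (c k * B k) (u (Suc k))) = (\<Sum>k\<le>n. smult (c k * A k) (u k))"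
  proof (cases n)
    case 0 then show ?thesis by (simp add: A_def B_def)
  next
    case (Suc m)
    have "(\<Sum>k\<le>n. smult (c k * B k) (u (Suc k))) = (\<Sum>k\<le>m. smult (c k * B k) (u (Suc k)))"
      unfolding Suc sum.atMost_Suc by (simp add: B_def Suc)
    also have "\<dots> = (\<Sum>k\<le>m. smult (c (Suc k) * A (Suc k)) (u (Suc k)))"
      by (rule sum.cong) (auto simp: cc Suc)
    also have "\<dots> = (\<Sum>k\<le>n. smult (c k * A k) (u k))"
      unfolding Suc sum.atMost_Suc_shift by (simp add: A_def)
    finally show ?thesis .
  qed
  have "jop a b (jacobi_poly a b n) = (\<Sum>k\<le>n. smult (c k) (jop a b (u k)))"
    by (simp add: jacobi_poly_def jop_sum jop_smult c_def u_def)
  also have "\<dots> = (\<Sum>k\<le>n. smult (c k * A k) (u (k - 1)) + smult (c k * D k) (u k) + smult (c k * B k) (u (Suc k)))"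
    by (rule sum.cong) (auto simp: J smult_add_right)
  also have "\<dots> = (\<Sum>k\<le>n. smult (c k * B k) (u k)) + (\<Sum>k\<le>n. smult (c k * D k) (u k)) + (\<Sum>k\<le>n. smult (c k * A k) (u k))"
    by (simp only: sum.distrib S1 S2)
  also have "\<dots> = (\<Sum>k\<le>n. smult (jeig a b n) (smult (c k) (u k)))"
    unfolding sum.distrib[symmetric]
  proof (rule sum.cong[OF refl])
    fix k assume "k \<in> {..n}"
    then obtain m where m: "n = k + m" using le_Suc_ex by auto
    have "B k + D k + A k = jeig a b n"
      by (simp add: A_def B_def D_def jeig_def m algebra_simps)
    then have "c k * B k + c k * D k + c k * A k = jeig a b n * c k"
      by (metis distrib_right mult.commute)
    then show "smult (c k * B k) (u k) + smult (c k * D k) (u k) + smult (c k * A k) (u k)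
        = smult (jeig a b n) (smult (c k) (u k))"
      by (metis smult_add_left smult_smult)
  qed
  also have "\<dots> = smult (jeig a b n) (jacobi_poly a b n)"
    by (simp add: jacobi_poly_def c_def u_def smult_sum_right)
  finally show ?thesis .
qed

section \<open>Leading coefficients, and the expansion of monomials in Jacobi polynomials\<close>

lemma gbinomial_pos:
  fixes x :: real
  assumes "real k < x + 1"
  shows "0 < x gchoose k"
  unfolding gbinomial_prod_rev
  using assms by (intro divide_pos_pos prod_pos) auto

lemma degree_jacobi_poly_le: "degree (jacobi_poly a b n) \<le> n"
  unfolding jacobi_poly_def
proof (intro degree_sum_le)
  fix k assume "k \<in> {..n}"
  have "degree ([:-1,1:] ^ k * [:0,1::real:] ^ (n - k)) \<le> k + (n - k)"
    by (intro order_trans[OF degree_mult_le] add_mono order_trans[OF degree_power_le]) auto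
  then show "degree (smult (jacobi_coef a b n k) ([:-1,1:] ^ k * [:0,1:] ^ (n - k))) \<le> n"
    using \<open>k \<in> {..n}\<close> by (intro order_trans[OF degree_smult_le]) auto
qed simp

text \<open>Every product (y-1)^k y^(n-k) is monic of degree n, so the leading coefficient is the
  sum of the coefficients, all of them positive for a, b > 0.\<close>

lemma lead_coeff_jacobi_poly_pos:
  assumes "a > 0" "b > 0"
  shows "0 < coeff (jacobi_poly a b n) n"
proof -
  have "coeff ([:-1,1:] ^ k * [:0,1::real:] ^ (n - k)) n = 1" if "k \<le> n" for k
  proof -
    have d: "degree ([:-1,1:] ^ k * [:0,1::real:] ^ (n - k)) = n"
      using that by (subst degree_mult_eq) (auto simp: degree_power_eq)
    have "lead_coeff ([:-1,1:] ^ k * [:0,1::real:] ^ (n - k)) = 1"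
      by (simp add: lead_coeff_mult lead_coeff_power)
    then show ?thesis by (simp only: d)
  qed
  then have "coeff (jacobi_poly a b n) n = (\<Sum>k\<le>n. jacobi_coef a b n k)"
    unfolding jacobi_poly_def by (simp add: coeff_sum)
  also have "\<dots> > 0"
    unfolding jacobi_coef_def using assms by (intro sum_pos mult_pos_pos gbinomial_pos) auto
  finally show ?thesis .
qed

lemma jeig_strict_mono:
  assumes "a > 0" "b > 0" "m < n"
  shows "jeig a b m < jeig a b n"
  unfolding jeig_def using assms by (intro mult_strict_mono) auto

text \<open>Comparison of leading coefficients: a nonzero q of degree d < n would give equal
  eigenvalues at d and n. The condition on \<open>coeff q n\<close> excludes d = n, the degree of
  the Jacobi polynomial with this eigenvalue.\<close>

lemma jop_eigenvector_unique:
  assumes "a > 0" "b > 0" "degree q \<le> n" "coeff q n = 0" "jop a b q = smult (jeig a b n) q"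
  shows "q = 0"
proof (rule ccontr)
  assume "q \<noteq> 0"
  define d where "d = degree q"
  have cd: "coeff q d \<noteq> 0" using \<open>q \<noteq> 0\<close> by (simp add: d_def)
  then have "d < n" using assms(3,4) by (auto simp: d_def order_less_le)
  have "coeff (jop a b q) d = jeig a b n * coeff q d" by (simp add: assms(5))
  then have "jeig a b d * coeff q d = jeig a b n * coeff q d"
    by (simp add: coeff_jop d_def coeff_eq_0)
  then show False using cd jeig_strict_mono[OF assms(1,2) \<open>d < n\<close>] by simp
qed

lemma jop_monom:
  "jop a b (monom 1 (Suc N)) =
     smult (jeig a b (Suc N)) (monom 1 (Suc N)) - smult (real (Suc N) * (real (Suc N) + b)) (monom 1 N)"
  by (rule poly_eqI) (auto simp: coeff_jop algebra_simps)

text \<open>The Jacobi operator acts on both sides of the expansion of \<open>y ^ N\<close>, so the coefficients for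
  \<open>N + 1\<close> are positive multiples of those for \<open>N\<close>, and the remainder is an eigenvector.\<close>

lemma monom_jacobi_expansion:
  assumes "a > 0" "b > 0"
  shows "\<exists>r. (\<forall>m. 0 \<le> r m) \<and> monom 1 N = (\<Sum>m\<le>N. smult (r m) (jacobi_poly a b m))"
proof (induction N)
  case 0
  have "jacobi_poly a b 0 = 1" by (simp add: jacobi_poly_def jacobi_coef_def)
  then show ?case by (intro exI[of _ "\<lambda>_. 1"]) simp
next
  case (Suc N)
  then obtain r where r: "\<And>m. 0 \<le> r m" "monom 1 N = (\<Sum>m\<le>N. smult (r m) (jacobi_poly a b m))"
    by blast
  define B where "B = real (Suc N) * (real (Suc N) + b)"
  have "B \<ge> 0" using assms by (simp add: B_def)
  define E where "E = jeig a b"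
  have E: "E m < E (Suc N)" if "m \<le> N" for m
    unfolding E_def using jeig_strict_mono[OF assms] that by simp
  define k where "k = coeff (jacobi_poly a b (Suc N)) (Suc N)"
  have k: "k > 0" unfolding k_def by (rule lead_coeff_jacobi_poly_pos[OF assms])
  \<comment> \<open>\<open>E (Suc N)\<close> minus the operator sends y^(N+1) to \<open>B\<close>
    times y^N, so the component m must satisfy \<open>(E (Suc N) - E m) * t m = B * r m\<close>. The
    top coefficient is dictated by the leading term.\<close>
  define t where "t = (\<lambda>m. if m \<le> N then B / (E (Suc N) - E m) * r m else 1 / k)"
  have t0: "t m \<ge> 0" for m
    unfolding t_def using \<open>B \<ge> 0\<close> r(1)[of m] E[of m] k by (auto intro!: mult_nonneg_nonneg divide_nonneg_nonneg)
  define S where "S = (\<Sum>m\<le>N. smult (t m) (jacobi_poly a b m))"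
  have dS: "degree S \<le> N"
    unfolding S_def by (intro degree_sum_le order_trans[OF degree_smult_le] order_trans[OF degree_jacobi_poly_le]) auto
  define R where "R = monom 1 (Suc N) - S - smult (1 / k) (jacobi_poly a b (Suc N))"
  have "smult (E (Suc N)) S - jop a b S = (\<Sum>m\<le>N. smult (t m * (E (Suc N) - E m)) (jacobi_poly a b m))"
    unfolding S_def jop_sum smult_sum_right sum_subtractf[symmetric] jop_smult jop_jacobi_poly E_def[symmetric]
  proof (rule sum.cong[OF refl])
    fix m
    show "smult (E (Suc N)) (smult (t m) (jacobi_poly a b m)) - smult (t m) (smult (E m) (jacobi_poly a b m))
      = smult (t m * (E (Suc N) - E m)) (jacobi_poly a b m)"
      by (simp only: right_diff_distrib smult_diff_left smult_smult mult.commute)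
  qed
  also have "\<dots> = (\<Sum>m\<le>N. smult B (smult (r m) (jacobi_poly a b m)))"
  proof (rule sum.cong[OF refl])
    fix m assume "m \<in> {..N}"
    then have "t m * (E (Suc N) - E m) = B * r m" using E[of m] by (simp add: t_def)
    then show "smult (t m * (E (Suc N) - E m)) (jacobi_poly a b m) = smult B (smult (r m) (jacobi_poly a b m))"
      by simp
  qed
  also have "\<dots> = smult B (monom 1 N)" by (simp add: r(2) smult_sum_right)
  finally have JS: "jop a b S = smult (E (Suc N)) S - smult B (monom 1 N)"
    by (metis add_diff_cancel_left' diff_add_cancel)
  have "jop a b R = smult (E (Suc N)) R"
    unfolding R_def jop_diff jop_smult jop_jacobi_poly jop_monom JS B_def[symmetric] E_def
    by (simp add: smult_diff_right mult.commute[of "1 / k"])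
  moreover have "coeff S (Suc N) = 0" using dS by (simp add: coeff_eq_0)
  then have "coeff R (Suc N) = 0" using k by (simp add: R_def k_def[symmetric])
  moreover have "degree R \<le> Suc N"
    unfolding R_def using dS
    by (intro degree_diff_le order_trans[OF degree_smult_le] order_trans[OF degree_jacobi_poly_le] degree_monom_le) auto
  ultimately have "R = 0" using jop_eigenvector_unique[OF assms] unfolding E_def by blast
  then have "monom 1 (Suc N) = S + smult (1 / k) (jacobi_poly a b (Suc N))" by (simp add: R_def diff_eq_eq)
  also have "\<dots> = (\<Sum>m\<le>Suc N. smult (t m) (jacobi_poly a b m))"
    by (simp add: S_def t_def)
  finally show ?case using t0 by blast
qed

section \<open>Integration over [0, 1] without weight\<close>

definition int01 :: "real poly \<Rightarrow> real" where
  "int01 q = integral {0..1} (poly q)"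

lemma poly_integrable: "poly q integrable_on {0..1::real}"
  by (rule integrable_continuous_interval) (intro continuous_intros)

lemma int01_add: "int01 (p + q) = int01 p + int01 q"
  unfolding int01_def poly_add by (rule integral_add[OF poly_integrable poly_integrable])

lemma int01_smult: "int01 (smult c p) = c * int01 p"
  unfolding int01_def poly_smult by (rule integral_mult_right)

lemma int01_sum: "int01 (sum f A) = (\<Sum>x\<in>A. int01 (f x))"
proof -
  have "int01 0 = 0" using int01_smult[of 0 0] by simp
  then show ?thesis
    by (induction A rule: infinite_finite_induct) (simp_all add: int01_add)
qed

lemma int01_pderiv: "int01 (pderiv q) = poly q 1 - poly q 0"
  unfolding int01_def
  by (intro integral_unique fundamental_theorem_of_calculus)
     (auto simp flip: has_real_derivative_iff_has_vector_derivative intro: has_field_derivative_at_within[OF poly_DERIV])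

lemma int01_monom: "int01 (monom 1 N) = 1 / real (N + 1)"
proof -
  have "pderiv (monom (1 / real (N + 1)) (N + 1)) = monom 1 N" by (simp add: pderiv_monom)
  then show ?thesis using int01_pderiv[of "monom (1 / real (N + 1)) (N + 1)"] by (simp add: poly_monom)
qed

text \<open>Integration by parts against dy instead of the Jacobi weight leaves boundary values:
  \<open>jop a b q\<close> is the derivative of (y^2 - y) q' + ((a+b) y - b) q, minus (a+b) q, and
  y^2 - y vanishes at both ends.\<close>

lemma int01_jop: "int01 (jop a b q) = a * poly q 1 + b * poly q 0 - (a + b) * int01 q"
proof -
  define r where "r = [:0,-1,1:] * pderiv q + [:-b, a+b:] * q"
  have "poly (jop a b q) x = poly (pderiv r + smult (-(a+b)) q) x" for x
    unfolding jop_def r_def pderiv_add pderiv_mult poly_add poly_mult poly_smult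
    by (simp add: pderiv_pCons algebra_simps)
  then have "jop a b q = pderiv r + smult (-(a+b)) q"
    by (metis poly_eq_poly_eq_iff ext)
  then have "int01 (jop a b q) = poly r 1 - poly r 0 - (a+b) * int01 q"
    by (simp only: int01_add int01_smult int01_pderiv mult_minus_left diff_conv_add_uminus)
  moreover have "poly r 1 = a * poly q 1" "poly r 0 = - b * poly q 0"
    unfolding r_def poly_add poly_mult by simp_all
  ultimately show ?thesis by simp
qed

lemma poly_jacobi_poly_1: "poly (jacobi_poly a b n) 1 = (real n + a) gchoose n"
proof -
  have "poly (jacobi_poly a b n) 1 = (\<Sum>k\<le>n. if k = 0 then jacobi_coef a b n k else 0)"
    unfolding jacobi_poly_def poly_sum by (rule sum.cong) (auto simp: power_0_left)
  then show ?thesis by (simp add: jacobi_coef_def)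
qed

lemma poly_jacobi_poly_0: "poly (jacobi_poly a b n) 0 = (-1) ^ n * ((real n + b) gchoose n)"
proof -
  have "poly (jacobi_poly a b n) 0 = (\<Sum>k\<le>n. if k = n then (-1) ^ n * jacobi_coef a b n k else 0)"
    unfolding jacobi_poly_def poly_sum by (rule sum.cong) (auto simp: power_0_left)
  then show ?thesis by (simp add: jacobi_coef_def)
qed

text \<open>For an eigenpolynomial the boundary formula becomes a linear equation for the
  integral.\<close>

lemma int01_jacobi_poly_eq:
  "(jeig a b n + (a + b)) * int01 (jacobi_poly a b n) =
     a * ((real n + a) gchoose n) + b * ((-1) ^ n * ((real n + b) gchoose n))"
  using int01_jop[of a b "jacobi_poly a b n"]
  unfolding jop_jacobi_poly int01_smult poly_jacobi_poly_1 poly_jacobi_poly_0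
  by (simp add: algebra_simps)

lemma jeig_plus_pos:
  assumes "0 < a" "0 < b"
  shows "0 < jeig a b n + (a + b)"
  unfolding jeig_def using assms by (intro add_nonneg_pos mult_nonneg_nonneg) auto

text \<open>For b \<le> a the end y = 1 dominates: its boundary term is at least as large as the
  modulus of the one at y = 0, whatever the sign (-1)^n.\<close>

lemma int01_jacobi_poly_nonneg:
  assumes "b \<le> a" "0 < b"
  shows "0 \<le> int01 (jacobi_poly a b n)"
proof -
  define u v where "u = (real n + a) gchoose n" and "v = (real n + b) gchoose n"
  have v: "0 < v" unfolding v_def using assms by (intro gbinomial_pos) auto
  have "v \<le> u"
    unfolding u_def v_def gbinomial_prod_rev using assms
    by (intro divide_right_mono prod_mono) auto
  then have "b * v \<le> a * u" using assms v by (intro mult_mono) auto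
  moreover have "- v \<le> (-1) ^ n * v" using v by (cases "even n") auto
  then have "- (b * v) \<le> b * ((-1) ^ n * v)"
    using assms(2) mult_left_mono[of "- v" "(-1) ^ n * v" b] by simp
  ultimately have "0 \<le> a * u + b * ((-1) ^ n * v)" by linarith
  then show ?thesis
    using int01_jacobi_poly_eq[of a b n] jeig_plus_pos[of a b n] assms
    by (metis u_def v_def assms(2) less_le_trans zero_le_mult_iff not_less)
qed

text \<open>Interpolation: with weights \<open>r m * int01 (P m) \<ge> 0\<close> the moments of \<open>s m\<close> of orders two and
  four are explicit, of sizes 1 and \<open>N\<close>, and \<open>s\<^sup>2 \<le> T s + s\<^sup>4 / T\<^sup>2\<close> with \<open>T\<^sup>2\<close> a large multiple
  of \<open>N\<close> bounds the first moment from below.\<close>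

lemma first_moment_lower_bound_aux:
  fixes s :: "nat \<Rightarrow> real"
  assumes ab: "b \<le> a" "0 < b" and "0 \<le> \<kappa>"
    and s: "\<And>m. 0 \<le> s m" "\<And>m. (s m)\<^sup>2 = jeig a b m + \<kappa>"
  shows "\<exists>c>0. \<exists>N0. \<forall>N\<ge>N0. \<exists>r. monom 1 N = (\<Sum>m\<le>N. smult (r m) (jacobi_poly a b m)) \<and>
           c / sqrt (real N) \<le> (\<Sum>m\<le>N. r m * s m * int01 (jacobi_poly a b m))"
proof -
  have a: "0 < a" using ab by simp
  \<comment> \<open>The coefficient of the plain integral in \<open>int_Jk\<close>: -(a+b) from the
    boundary formula, \<kappa> from the shift of the operator.\<close>
  define d where "d = \<kappa> - (a + b)"
  define Jk where "Jk q = jop a b q + smult \<kappa> q" for q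
  have Jk_sum: "Jk (sum f A) = (\<Sum>x\<in>A. Jk (f x))" for f and A :: "nat set"
    by (simp add: Jk_def jop_sum smult_sum_right sum.distrib)
  have Jk_smult: "Jk (smult c q) = smult c (Jk q)" for c q
    by (simp add: Jk_def jop_smult smult_add_right mult.commute)
  have Jk_P: "Jk (jacobi_poly a b m) = smult ((s m)\<^sup>2) (jacobi_poly a b m)" for m
    by (simp add: Jk_def jop_jacobi_poly s(2) smult_add_left)
  have int_Jk: "int01 (Jk q) = a * poly q 1 + b * poly q 0 + d * int01 q" for q
    by (simp add: Jk_def int01_add int01_smult int01_jop d_def algebra_simps)
  \<comment> \<open>Collects the fourth moment: its bounded terms are multiplied by N \<ge> 1, so
    that the whole is at most \<open>K * real N\<close>.\<close>
  define K where "K = a * (a + 1) + a * \<kappa> + \<bar>d\<bar> * (a + 2 * b + \<kappa>)"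
  have K: "0 < K" unfolding K_def using ab a \<open>0 \<le> \<kappa>\<close> by (intro add_pos_nonneg mult_nonneg_nonneg mult_pos_pos) auto
  \<comment> \<open>The bound 2 makes the lower monomial y^M vanish at 0. The other bound gives d /
    (N+1) \<ge> -a/2, which keeps the second moment above a/2.\<close>
  define N0 where "N0 = max 2 (nat \<lceil>2 * \<bar>d\<bar> / a\<rceil>)"
  \<comment> \<open>With T^2 = 4 K N / a the fourth-moment term is at most a/4, half of the lower
    bound for the second moment. The a/4 that is left, divided by T, is c / sqrt N.\<close>
  define c where "c = (a / 4) / sqrt (4 * K / a)"
  have c: "0 < c" using a K by (simp add: c_def)
  have "\<exists>r. monom 1 N = (\<Sum>m\<le>N. smult (r m) (jacobi_poly a b m)) \<and>
           c / sqrt (real N) \<le> (\<Sum>m\<le>N. r m * s m * int01 (jacobi_poly a b m))" if "N0 \<le> N" for N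
  proof -
    have "2 \<le> N" using that by (simp add: N0_def)
    then obtain M where M: "N = Suc M" "1 \<le> M" by (cases N) auto
    obtain r where r: "\<And>m. 0 \<le> r m" "monom 1 N = (\<Sum>m\<le>N. smult (r m) (jacobi_poly a b m))"
      using monom_jacobi_expansion[OF a ab(2)] by blast
    define w where "w m = r m * int01 (jacobi_poly a b m)" for m
    have w: "0 \<le> w m" for m
      unfolding w_def using r(1) int01_jacobi_poly_nonneg[OF ab] by simp
    define E where "E = jeig a b N + \<kappa>"
    have E0: "0 \<le> E" unfolding E_def jeig_def using ab a \<open>0 \<le> \<kappa>\<close> by simp
    have NN: "real N \<ge> 1" using M by simp
    have le_mult: "x \<le> x * real N" if "0 \<le> x" for x :: real
      using mult_left_mono[OF NN that] by simp
    have Q2: "Jk (monom 1 N) = (\<Sum>m\<le>N. smult (r m * (s m)\<^sup>2) (jacobi_poly a b m))"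
      by (simp add: r(2) Jk_sum Jk_smult Jk_P)
    have "int01 (Jk (monom 1 N)) = (\<Sum>m\<le>N. w m * (s m)\<^sup>2)"
      unfolding Q2 by (simp add: int01_sum int01_smult w_def mult_ac)
    then have M2: "(\<Sum>m\<le>N. w m * (s m)\<^sup>2) = a + d / real (N + 1)"
      by (simp add: int_Jk int01_monom poly_monom M(1))
    have "Jk (Jk (monom 1 N)) = (\<Sum>m\<le>N. smult (r m * (s m) ^ 4) (jacobi_poly a b m))"
      unfolding Q2 by (simp add: Jk_sum Jk_smult Jk_P power2_eq_square power4_eq_xxxx mult_ac)
    then have "int01 (Jk (Jk (monom 1 N))) = (\<Sum>m\<le>N. w m * (s m) ^ 4)"
      by (simp add: int01_sum int01_smult w_def mult_ac)
    moreover have Jm: "Jk (monom 1 N) = smult E (monom 1 N) + smult (- (real N * (real N + b))) (monom 1 M)"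
      unfolding Jk_def M(1) jop_monom E_def by (simp add: smult_add_left)
    have "int01 (Jk (Jk (monom 1 N))) = a * (E - real N * (real N + b)) + d * (E / real (N + 1) - (real N + b))"
    proof -
      have 1: "poly (Jk (monom 1 N)) 1 = E - real N * (real N + b)"
        unfolding Jm by (simp add: poly_monom)
      have 2: "poly (Jk (monom 1 N)) 0 = 0"
        unfolding Jm using M by (simp add: poly_monom)
      have "real N * (real N + b) * (1 / real (M + 1)) = real N + b"
        using M by (simp del: of_nat_Suc)
      then have 3: "int01 (Jk (monom 1 N)) = E / real (N + 1) - (real N + b)"
        unfolding Jm int01_add int01_smult int01_monom by simp
      show ?thesis unfolding int_Jk[of "Jk (monom 1 N)"] 1 2 3 by simp
    qed
    ultimately have M4: "(\<Sum>m\<le>N. w m * (s m) ^ 4) =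
        a * (E - real N * (real N + b)) + d * (E / real (N + 1) - (real N + b))" by simp
    \<comment> \<open>The terms N^2 + b N cancel, which brings the fourth moment down from order N^2
      to order N; a similar cancellation makes the expression in \<open>e2\<close> bounded.\<close>
    have e1: "E - real N * (real N + b) = real N * (a + 1) + \<kappa>"
      by (simp add: E_def jeig_def algebra_simps)
    have e2: "E / real (N + 1) - (real N + b) = (a + b) * (real N / real (N + 1)) + \<kappa> / real (N + 1) - b"
    proof -
      have E: "E = real N * real (N + 1) + (a + b) * real N + \<kappa>"
        by (simp add: E_def jeig_def algebra_simps)
      show ?thesis unfolding E add_divide_distrib by simp
    qed
    have f1: "0 \<le> real N / real (N + 1)" "real N / real (N + 1) \<le> 1" by simp_all
    have f2: "0 \<le> \<kappa> / real (N + 1)" "\<kappa> / real (N + 1) \<le> \<kappa>"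
      using \<open>0 \<le> \<kappa>\<close> by (simp_all add: divide_le_eq mult_left_mono algebra_simps)
    have f3: "0 \<le> (a + b) * (real N / real (N + 1))" "(a + b) * (real N / real (N + 1)) \<le> a + b"
      using mult_left_mono[OF f1(2), of "a + b"] f1(1) a ab by (auto intro: mult_nonneg_nonneg)
    have "\<bar>E / real (N + 1) - (real N + b)\<bar> \<le> a + 2 * b + \<kappa>"
      unfolding e2 using f2 f3 a ab \<open>0 \<le> \<kappa>\<close> by linarith
    then have "\<bar>d\<bar> * \<bar>E / real (N + 1) - (real N + b)\<bar> \<le> \<bar>d\<bar> * (a + 2 * b + \<kappa>)"
      by (rule mult_left_mono) simp
    then have "d * (E / real (N + 1) - (real N + b)) \<le> \<bar>d\<bar> * (a + 2 * b + \<kappa>)"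
      by (rule order_trans[OF order_trans[OF abs_ge_self eq_refl[OF abs_mult]]])
    moreover have "\<bar>d\<bar> * (a + 2 * b + \<kappa>) \<le> \<bar>d\<bar> * (a + 2 * b + \<kappa>) * real N"
      using a ab \<open>0 \<le> \<kappa>\<close> by (intro le_mult) simp
    moreover have "a * \<kappa> \<le> a * \<kappa> * real N"
      using a \<open>0 \<le> \<kappa>\<close> by (intro le_mult) simp
    moreover have "K * real N = a * (real N * (a + 1)) + a * \<kappa> * real N + \<bar>d\<bar> * (a + 2 * b + \<kappa>) * real N"
      by (simp only: K_def ring_distribs ac_simps)
    moreover have "a * (real N * (a + 1) + \<kappa>) = a * (real N * (a + 1)) + a * \<kappa>"
      by (rule distrib_left)
    ultimately have M4le: "(\<Sum>m\<le>N. w m * (s m) ^ 4) \<le> K * real N"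
      unfolding M4 e1 by linarith
    have "2 * \<bar>d\<bar> / a \<le> real N" using that unfolding N0_def by linarith
    then have D: "2 * \<bar>d\<bar> \<le> a * real N" using a by (simp add: divide_le_eq mult.commute)
    have e3: "- (a / 2) * real (N + 1) = - ((a * real N) + a) / 2" by (simp add: field_simps)
    have e4: "- (a / 2) * real (N + 1) \<le> d" unfolding e3 using D a by (simp add: abs_le_iff)
    have "- (a / 2) \<le> d / real (N + 1)" by (rule iffD2[OF pos_le_divide_eq e4]) simp
    then have M2ge: "a / 2 \<le> (\<Sum>m\<le>N. w m * (s m)\<^sup>2)"
      using add_left_mono[of "- (a / 2)" "d / real (N + 1)" a] unfolding M2 by linarith
    define T where "T = sqrt (4 * K / a) * sqrt (real N)"
    have T: "0 < T" unfolding T_def using K a NN by (intro mult_pos_pos) auto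
    have T2: "T\<^sup>2 = 4 * K / a * real N" unfolding T_def using K a by (simp add: power_mult_distrib)
    have ineq: "x\<^sup>2 \<le> T * x + x ^ 4 / T\<^sup>2" if "0 \<le> x" for x
    proof (cases "x \<le> T")
      case True
      then have "x\<^sup>2 \<le> T * x" using that by (simp add: power2_eq_square mult_right_mono)
      moreover have "0 \<le> x ^ 4 / T\<^sup>2" by simp
      ultimately show ?thesis by linarith
    next
      case False
      then have "x\<^sup>2 * T\<^sup>2 \<le> x\<^sup>2 * x\<^sup>2" using T by (intro mult_left_mono power_mono) auto
      then have "x\<^sup>2 \<le> x ^ 4 / T\<^sup>2" using T by (simp add: field_simps power4_eq_xxxx power2_eq_square)
      moreover have "0 \<le> T * x" using that T by simp
      ultimately show ?thesis by linarith
    qed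
    have "a / 2 \<le> (\<Sum>m\<le>N. w m * (T * s m + s m ^ 4 / T\<^sup>2))"
      by (rule order_trans[OF M2ge]) (intro sum_mono mult_left_mono ineq s w)
    also have "\<dots> = T * (\<Sum>m\<le>N. w m * s m) + (\<Sum>m\<le>N. w m * (s m) ^ 4) / T\<^sup>2"
      by (simp add: distrib_left sum.distrib sum_distrib_left sum_divide_distrib mult_ac)
    also have "\<dots> \<le> T * (\<Sum>m\<le>N. w m * s m) + K * real N / T\<^sup>2"
      using M4le by (intro add_left_mono divide_right_mono) auto
    also have "K * real N / T\<^sup>2 = a / 4" unfolding T2 using K a NN by (simp add: field_simps)
    finally have "a / 4 \<le> T * (\<Sum>m\<le>N. w m * s m)" by simp
    then have "(a / 4) / T \<le> (\<Sum>m\<le>N. w m * s m)" using T by (simp add: field_simps)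
    moreover have "(a / 4) / T = c / sqrt (real N)" by (simp add: T_def c_def)
    moreover have "(\<Sum>m\<le>N. w m * s m) = (\<Sum>m\<le>N. r m * s m * int01 (jacobi_poly a b m))"
      by (simp add: w_def mult_ac)
    ultimately show ?thesis using r(2) by (intro exI[of _ r]) simp
  qed
  then show ?thesis using c by blast
qed

section \<open>Exchange of the two parameters by the reflection y -> 1 - y\<close>

lemma jacobi_P_swap: "jacobi_P b a n (- x) = (-1) ^ n * jacobi_P a b n x"
proof -
  have "jacobi_P b a n (- x) = (\<Sum>k\<le>n. ((real n + b) gchoose (n - k)) * ((real n + a) gchoose k)
             * ((- x - 1) / 2) ^ k * ((- x + 1) / 2) ^ (n - k))"
    by (simp add: jacobi_P_def)
  also have "\<dots> = (\<Sum>k\<le>n. ((real n + b) gchoose k) * ((real n + a) gchoose (n - k))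
             * ((- x - 1) / 2) ^ (n - k) * ((- x + 1) / 2) ^ k)"
    by (rule sum.reindex_bij_witness[of _ "\<lambda>k. n - k" "\<lambda>k. n - k"]) auto
  also have "\<dots> = (\<Sum>k\<le>n. (-1) ^ n * (((real n + a) gchoose (n - k)) * ((real n + b) gchoose k)
             * ((x - 1) / 2) ^ k * ((x + 1) / 2) ^ (n - k)))"
  proof (rule sum.cong[OF refl])
    fix k assume "k \<in> {..n}"
    then have n: "(-1::real) ^ n = (-1) ^ k * (-1) ^ (n - k)" by (simp flip: power_add)
    have "(- x - 1) / 2 = (-1) * ((x + 1) / 2)" "(- x + 1) / 2 = (-1) * ((x - 1) / 2)" by (simp_all add: field_simps)
    then show "((real n + b) gchoose k) * ((real n + a) gchoose (n - k))
             * ((- x - 1) / 2) ^ (n - k) * ((- x + 1) / 2) ^ k =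
         (-1) ^ n * (((real n + a) gchoose (n - k)) * ((real n + b) gchoose k)
             * ((x - 1) / 2) ^ k * ((x + 1) / 2) ^ (n - k))"
      unfolding n by (simp only: power_mult_distrib mult_ac)
  qed
  also have "\<dots> = (-1) ^ n * jacobi_P a b n x"
    by (simp add: jacobi_P_def sum_distrib_left)
  finally show ?thesis .
qed

text \<open>The closed form is symmetric in a and b up to the factor (-1)^n, and the factor in front
  of the integral is symmetric and positive.\<close>

lemma int01_jacobi_poly_swap:
  assumes "0 < a" "0 < b"
  shows "int01 (jacobi_poly b a n) = (-1) ^ n * int01 (jacobi_poly a b n)"
proof -
  define t :: real where "t = (-1) ^ n"
  have t: "t * t = 1" by (simp add: t_def flip: power_add)
  define u v where "u = (real n + a) gchoose n" and "v = (real n + b) gchoose n"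
  have "(jeig a b n + (a + b)) * int01 (jacobi_poly b a n) = b * v + a * (t * u)"
    using int01_jacobi_poly_eq[of b a n]
    unfolding t_def[symmetric] u_def[symmetric] v_def[symmetric]
    by (simp add: jeig_def ac_simps)
  also have "\<dots> = t * (a * u + b * (t * v))"
    using t by algebra
  also have "\<dots> = t * ((jeig a b n + (a + b)) * int01 (jacobi_poly a b n))"
    by (simp only: int01_jacobi_poly_eq t_def u_def v_def)
  finally have "(jeig a b n + (a + b)) * int01 (jacobi_poly b a n)
      = (jeig a b n + (a + b)) * (t * int01 (jacobi_poly a b n))" by (simp only: mult_ac)
  then show ?thesis
    using jeig_plus_pos[OF assms, of n] unfolding t_def by simp
qed

text \<open>For a < b the previous bound is applied to the exchanged parameters. Reflection puts
  signs (-1)^m both into the expansion and into the integrals, and they cancel in the sum. The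
  expansion is stated for values, ready for y = cos^2(theta/2).\<close>

lemma first_moment_lower_bound:
  fixes s :: "nat \<Rightarrow> real"
  assumes ab: "0 < a" "0 < b" and "0 \<le> \<kappa>"
    and s: "\<And>m. 0 \<le> s m" "\<And>m. (s m)\<^sup>2 = jeig a b m + \<kappa>"
  shows "\<exists>h \<in> {\<lambda>y. y, \<lambda>y. 1 - y}. \<exists>c>0. \<exists>N0. \<forall>N\<ge>N0. \<exists>r.
           (\<forall>y. h y ^ N = (\<Sum>m\<le>N. r m * jacobi_P a b m (2 * y - 1))) \<and>
           c / sqrt (real N) \<le> (\<Sum>m\<le>N. r m * s m * int01 (jacobi_poly a b m))"
proof (cases "b \<le> a")
  case True
  obtain c N0 where c: "0 < c" and N0: "\<And>N. N0 \<le> N \<Longrightarrow> \<exists>r. monom 1 N = (\<Sum>m\<le>N. smult (r m) (jacobi_poly a b m)) \<and>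
           c / sqrt (real N) \<le> (\<Sum>m\<le>N. r m * s m * int01 (jacobi_poly a b m))"
    using first_moment_lower_bound_aux[OF True ab(2) assms(3) s] by blast
  have "\<exists>r. (\<forall>y. y ^ N = (\<Sum>m\<le>N. r m * jacobi_P a b m (2 * y - 1))) \<and>
           c / sqrt (real N) \<le> (\<Sum>m\<le>N. r m * s m * int01 (jacobi_poly a b m))" if N: "N0 \<le> N" for N
  proof -
    obtain r where r: "monom 1 N = (\<Sum>m\<le>N. smult (r m) (jacobi_poly a b m))"
      and le: "c / sqrt (real N) \<le> (\<Sum>m\<le>N. r m * s m * int01 (jacobi_poly a b m))"
      using N0[OF N] by blast
    have "y ^ N = (\<Sum>m\<le>N. r m * jacobi_P a b m (2 * y - 1))" for y
      using arg_cong[OF r, of "\<lambda>q. poly q y"] by (simp add: poly_monom poly_sum poly_jacobi_poly)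
    then show ?thesis using le by blast
  qed
  then have "\<exists>c>0. \<exists>N0. \<forall>N\<ge>N0. \<exists>r.
      (\<forall>y. y ^ N = (\<Sum>m\<le>N. r m * jacobi_P a b m (2 * y - 1))) \<and>
      c / sqrt (real N) \<le> (\<Sum>m\<le>N. r m * s m * int01 (jacobi_poly a b m))"
    using c by (intro exI[of _ c] conjI exI[of _ N0]) simp_all
  then show ?thesis
    by (intro bexI[of _ "\<lambda>y. y"]) (assumption, simp)
next
  case False
  have s': "(s m)\<^sup>2 = jeig b a m + \<kappa>" for m by (simp add: s(2) jeig_def algebra_simps)
  obtain c N0 where c: "0 < c" and N0: "\<And>N. N0 \<le> N \<Longrightarrow> \<exists>r. monom 1 N = (\<Sum>m\<le>N. smult (r m) (jacobi_poly b a m)) \<and>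
           c / sqrt (real N) \<le> (\<Sum>m\<le>N. r m * s m * int01 (jacobi_poly b a m))"
    using first_moment_lower_bound_aux[OF _ ab(1) assms(3) s(1) s'] False by force
  have "\<exists>r. (\<forall>y. (1 - y) ^ N = (\<Sum>m\<le>N. r m * jacobi_P a b m (2 * y - 1))) \<and>
           c / sqrt (real N) \<le> (\<Sum>m\<le>N. r m * s m * int01 (jacobi_poly a b m))" if N: "N0 \<le> N" for N
  proof -
    obtain r where r: "monom 1 N = (\<Sum>m\<le>N. smult (r m) (jacobi_poly b a m))"
      and le: "c / sqrt (real N) \<le> (\<Sum>m\<le>N. r m * s m * int01 (jacobi_poly b a m))"
      using N0[OF N] by blast
    have "(1 - y) ^ N = (\<Sum>m\<le>N. (r m * (-1) ^ m) * jacobi_P a b m (2 * y - 1))" for y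
      using arg_cong[OF r, of "\<lambda>q. poly q (1 - y)"] jacobi_P_swap[of b a _ "2 * y - 1"]
      by (simp add: poly_monom poly_sum poly_jacobi_poly mult.assoc)
    moreover have "(\<Sum>m\<le>N. r m * s m * int01 (jacobi_poly b a m))
        = (\<Sum>m\<le>N. (r m * (-1) ^ m) * s m * int01 (jacobi_poly a b m))"
      by (simp only: int01_jacobi_poly_swap[OF ab] mult_ac)
    ultimately show ?thesis using le by (intro exI[of _ "\<lambda>m. r m * (-1) ^ m"]) simp
  qed
  then have "\<exists>c>0. \<exists>N0. \<forall>N\<ge>N0. \<exists>r.
      (\<forall>y. (1 - y) ^ N = (\<Sum>m\<le>N. r m * jacobi_P a b m (2 * y - 1))) \<and>
      c / sqrt (real N) \<le> (\<Sum>m\<le>N. r m * s m * int01 (jacobi_poly a b m))"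
    using c by (intro exI[of _ c] conjI exI[of _ N0]) simp_all
  then show ?thesis
    by (intro bexI[of _ "\<lambda>y. 1 - y"]) (assumption, simp)
qed

section \<open>Test functions and weak derivatives\<close>

lemma power_mult_exp_bounded:
  assumes "0 < e"
  obtains K :: real where "0 \<le> K" "\<And>t. 0 \<le> t \<Longrightarrow> t ^ n * exp (- (e * t)) \<le> K"
proof
  show "0 \<le> fact n / e ^ n" using assms by simp
  fix t :: real assume t: "0 \<le> t"
  have "(e * t) ^ n / fact n = (\<Sum>k\<in>{n}. (e * t) ^ k /\<^sub>R fact k)" by (simp add: field_simps)
  also have "\<dots> \<le> (\<Sum>k. (e * t) ^ k /\<^sub>R fact k)"
    using t assms by (intro sum_le_suminf summable_exp_generic) auto
  also have "\<dots> = exp (e * t)" by (simp add: exp_def)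
  finally have "e ^ n * t ^ n \<le> fact n * exp (e * t)" by (simp add: field_simps power_mult_distrib)
  then show "t ^ n * exp (- (e * t)) \<le> fact n / e ^ n"
    using assms by (simp add: exp_minus field_simps)
qed

text \<open>The scale e is free: as e decreases to 0, the bump with i = j = 0 increases to the
  indicator of the open interval, so that integrals over intervals become limits of integrals
  against test functions.\<close>

definition bump :: "real \<Rightarrow> real \<Rightarrow> real \<Rightarrow> nat \<Rightarrow> nat \<Rightarrow> real \<Rightarrow> real" where
  "bump c d e i j x = (if c < x \<and> x < d
     then (1 / (x - c)) ^ i * (1 / (d - x)) ^ j * (exp (- (e * (1 / (x - c)))) * exp (- (e * (1 / (d - x)))))
     else 0)"

text \<open>For gluing with the zero function: the bound forces f c = 0 and makes the difference
  quotients at c of order |h|.\<close>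

lemma DERIV_0_of_quadratic_bound:
  fixes f :: "real \<Rightarrow> real"
  assumes "\<And>x. \<bar>f x\<bar> \<le> K * (x - c)\<^sup>2"
  shows "(f has_real_derivative 0) (at c)"
proof -
  have f0: "f c = 0" using assms[of c] by simp
  have "(\<lambda>h. (f (c + h) - f c) / h) \<midarrow>0\<rightarrow> 0"
  proof (rule Lim_null_comparison)
    show "\<forall>\<^sub>F h in at 0. norm ((f (c + h) - f c) / h) \<le> K * \<bar>h\<bar>"
    proof (rule eventually_at_topological[THEN iffD2], intro exI[of _ UNIV] conjI ballI impI)
      fix h :: real assume "h \<noteq> 0"
      have "\<bar>f (c + h)\<bar> \<le> K * \<bar>h\<bar> * \<bar>h\<bar>" using assms[of "c + h"] by (simp add: power2_eq_square)
      then show "norm ((f (c + h) - f c) / h) \<le> K * \<bar>h\<bar>"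
        using \<open>h \<noteq> 0\<close> by (simp add: f0 field_simps)
    qed auto
    show "((\<lambda>h. K * \<bar>h\<bar>) \<longlongrightarrow> 0) (at 0)" by (auto intro!: tendsto_eq_intros)
  qed
  then show ?thesis by (simp add: DERIV_def)
qed

text \<open>The factor (x-c)^2 is paid for by two further powers of 1/(x-c), which the exponential
  absorbs along with the i powers already present. The factor belonging to d is merely
  bounded.\<close>

lemma bump_bound_left:
  assumes "0 < e"
  obtains K where "\<And>x. \<bar>bump c d e i j x\<bar> \<le> K * (x - c)\<^sup>2"
proof -
  obtain K1 where K1: "0 \<le> K1" "\<And>t. 0 \<le> t \<Longrightarrow> t ^ (i + 2) * exp (- (e * t)) \<le> K1"
    using power_mult_exp_bounded[OF assms] by blast
  obtain K2 where K2: "0 \<le> K2" "\<And>t. 0 \<le> t \<Longrightarrow> t ^ j * exp (- (e * t)) \<le> K2"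
    using power_mult_exp_bounded[OF assms] by blast
  have "\<bar>bump c d e i j x\<bar> \<le> (K1 * K2) * (x - c)\<^sup>2" for x
  proof (cases "c < x \<and> x < d")
    case True
    define U V where "U = 1 / (x - c)" and "V = 1 / (d - x)"
    have U: "0 < U" "0 < V" using True by (simp_all add: U_def V_def)
    have UU: "U\<^sup>2 * (x - c)\<^sup>2 = 1" using True by (simp add: U_def power_divide)
    have "\<bar>bump c d e i j x\<bar> = U ^ i * V ^ j * (exp (- (e * U)) * exp (- (e * V)))"
      using True U by (simp add: bump_def U_def[symmetric] V_def[symmetric] abs_mult)
    also have "\<dots> = (U ^ i * V ^ j * (exp (- (e * U)) * exp (- (e * V)))) * (U\<^sup>2 * (x - c)\<^sup>2)"
      by (simp only: UU mult_1_right)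
    also have "\<dots> = ((U ^ (i + 2) * exp (- (e * U))) * (V ^ j * exp (- (e * V)))) * (x - c)\<^sup>2"
      by (simp only: power_add mult_ac)
    also have "\<dots> \<le> (K1 * K2) * (x - c)\<^sup>2"
      using U K1 K2 by (intro mult_right_mono mult_mono) auto
    finally show ?thesis .
  next
    case False
    then have "bump c d e i j x = 0" by (auto simp: bump_def)
    then show ?thesis using K1(1) K2(1) by simp
  qed
  then show ?thesis by (rule that)
qed

lemma bump_reflect: "bump c d e i j x = bump (- d) (- c) e j i (- x)"
  by (auto simp: bump_def algebra_simps)

lemma bump_bound_right:
  assumes "0 < e"
  obtains K where "\<And>x. \<bar>bump c d e i j x\<bar> \<le> K * (x - d)\<^sup>2"
proof -
  obtain K where K: "\<And>x. \<bar>bump (- d) (- c) e j i x\<bar> \<le> K * (x - (- d))\<^sup>2"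
    using bump_bound_left[OF assms] by blast
  have "\<bar>bump c d e i j x\<bar> \<le> K * (x - d)\<^sup>2" for x
    using K[of "- x"] by (simp add: bump_reflect[of c] power2_commute)
  then show ?thesis by (rule that)
qed

text \<open>U = 1/(x-c) and V = 1/(d-x) satisfy U' = -U^2 and V' = V^2, so the product rule gives
  bumps with raised powers. The formula holds at every x: all bumps vanish off the open interval,
  and at c and d the quadratic bounds give derivative 0.\<close>

lemma DERIV_bump:
  assumes "0 < e" "c < d"
  shows "(bump c d e i j has_real_derivative
    (- real i * bump c d e (i + 1) j x + real j * bump c d e i (j + 1) x
     + e * bump c d e (i + 2) j x - e * bump c d e i (j + 2) x)) (at x)"
proof (cases "c < x \<and> x < d")
  case True
  define U V where "U = (\<lambda>y. 1 / (y - c))" and "V = (\<lambda>y. 1 / (d - y))"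
  have dU: "(U has_real_derivative - (U x)\<^sup>2) (at x)" and dV: "(V has_real_derivative (V x)\<^sup>2) (at x)"
    unfolding U_def V_def using True
    by (auto intro!: derivative_eq_intros simp: power2_eq_square field_simps)
  have pow: "real n * z ^ (n - 1) * z\<^sup>2 = real n * z ^ (n + 1)" for n and z :: real
    by (cases n) (simp_all add: power2_eq_square)
  have dUi: "((\<lambda>y. U y ^ i) has_real_derivative - (real i * U x ^ (i + 1))) (at x)"
    by (rule DERIV_cong[OF DERIV_power[OF dU, of i]]) (use pow[of i "U x"] in \<open>simp add: mult_ac\<close>)
  have dVj: "((\<lambda>y. V y ^ j) has_real_derivative real j * V x ^ (j + 1)) (at x)"
    by (rule DERIV_cong[OF DERIV_power[OF dV, of j]]) (use pow[of j "V x"] in \<open>simp add: mult_ac\<close>)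
  have dEU: "((\<lambda>y. exp (- (e * U y))) has_real_derivative exp (- (e * U x)) * (e * (U x)\<^sup>2)) (at x)"
    by (rule derivative_eq_intros dU refl)+ simp
  have dEV: "((\<lambda>y. exp (- (e * V y))) has_real_derivative exp (- (e * V x)) * (- (e * (V x)\<^sup>2))) (at x)"
    by (rule derivative_eq_intros dV refl)+ simp
  have "((\<lambda>y. (U y ^ i * V y ^ j) * (exp (- (e * U y)) * exp (- (e * V y)))) has_real_derivative
     (- real i * bump c d e (i + 1) j x + real j * bump c d e i (j + 1) x
     + e * bump c d e (i + 2) j x - e * bump c d e i (j + 2) x)) (at x)"
    by (rule DERIV_cong[OF DERIV_mult'[OF DERIV_mult'[OF dUi dVj] DERIV_mult'[OF dEU dEV]]])
       (use True in \<open>simp add: bump_def U_def[symmetric, THEN fun_cong] V_def[symmetric, THEN fun_cong]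
          power2_eq_square algebra_simps\<close>)
  moreover have "\<forall>\<^sub>F y in nhds x. bump c d e i j y = (U y ^ i * V y ^ j) * (exp (- (e * U y)) * exp (- (e * V y)))"
    using True by (intro eventually_nhds[THEN iffD2] exI[of _ "{c<..<d}"]) (auto simp: bump_def U_def V_def)
  ultimately show ?thesis by (subst DERIV_cong_ev[OF refl _ refl]) auto
next
  case False
  have "(bump c d e i j has_real_derivative 0) (at x)"
  proof -
    consider "x = c" | "x = d" | "x < c \<or> d < x" using False by linarith
    then show ?thesis
    proof cases
      case 1 then show ?thesis using DERIV_0_of_quadratic_bound bump_bound_left[OF assms(1)] by metis
    next
      case 2 then show ?thesis using DERIV_0_of_quadratic_bound bump_bound_right[OF assms(1)] by metis
    next
      case 3
      then have "\<forall>\<^sub>F y in nhds x. bump c d e i j y = 0"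
        by (intro eventually_nhds[THEN iffD2] exI[of _ "{..<c} \<union> {d<..}"]) (auto simp: bump_def)
      then show ?thesis by (subst DERIV_cong_ev[OF refl _ refl]) auto
    qed
  qed
  moreover have "bump c d e k l x = 0" for k l using False by (simp add: bump_def)
  ultimately show ?thesis by simp
qed

text \<open>The powers in \<open>bump\<close> are there to make this linear span closed under differentiation.\<close>

inductive bump_span :: "real \<Rightarrow> real \<Rightarrow> real \<Rightarrow> (real \<Rightarrow> real) \<Rightarrow> bool" for c d e where
  base: "bump_span c d e (bump c d e i j)"
| scale: "bump_span c d e f \<Longrightarrow> bump_span c d e (\<lambda>x. k * f x)"
| add: "bump_span c d e f \<Longrightarrow> bump_span c d e g \<Longrightarrow> bump_span c d e (\<lambda>x. f x + g x)"

lemma bump_span_DERIV: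
  assumes "bump_span c d e f" "0 < e" "c < d"
  shows "\<exists>f'. bump_span c d e f' \<and> (\<forall>x. (f has_real_derivative f' x) (at x))"
  using assms(1)
proof induction
  case (base i j)
  let ?f = "\<lambda>x. (((- real i) * bump c d e (i + 1) j x + real j * bump c d e i (j + 1) x)
     + e * bump c d e (i + 2) j x) + (- e) * bump c d e i (j + 2) x"
  have "bump_span c d e ?f" by (intro bump_span.intros)
  moreover have "\<forall>x. (bump c d e i j has_real_derivative ?f x) (at x)"
    using DERIV_bump[OF assms(2,3), of i j] by simp
  ultimately show ?case by blast
next
  case (scale f k)
  then obtain f' where "bump_span c d e f'" "\<And>x. (f has_real_derivative f' x) (at x)" by blast
  then show ?case by (intro exI[of _ "\<lambda>x. k * f' x"]) (auto intro: bump_span.intros DERIV_cmult)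
next
  case (add f g)
  then obtain f' g' where "bump_span c d e f'" "\<And>x. (f has_real_derivative f' x) (at x)"
    "bump_span c d e g'" "\<And>x. (g has_real_derivative g' x) (at x)" by blast
  then show ?case by (intro exI[of _ "\<lambda>x. f' x + g' x"]) (auto intro: bump_span.intros DERIV_add)
qed

lemma bump_span_higher_deriv:
  assumes "bump_span c d e f" "0 < e" "c < d"
  shows "bump_span c d e ((deriv ^^ n) f)"
proof (induction n)
  case (Suc n)
  obtain f' where f': "bump_span c d e f'" "\<And>x. ((deriv ^^ n) f has_real_derivative f' x) (at x)"
    using bump_span_DERIV[OF Suc assms(2,3)] by blast
  have "deriv ((deriv ^^ n) f) = f'" using f'(2) by (intro ext DERIV_imp_deriv)
  then show ?case using f'(1) by simp
qed (use assms in simp)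

lemma test_function_bump:
  assumes "0 < e" "c < d" "{c..d} \<subseteq> punctured"
  shows "test_function (bump c d e 0 0)"
proof -
  have "(deriv ^^ n) (bump c d e 0 0) differentiable (at x)" for n x
    using bump_span_DERIV[OF bump_span_higher_deriv[OF bump_span.base assms(1,2)] assms(1,2)]
    by (metis real_differentiable_def)
  moreover have sub: "closure {x. bump c d e 0 0 x \<noteq> 0} \<subseteq> {c..d}"
    by (rule closure_minimal) (auto simp: bump_def split: if_splits)
  moreover have "compact (closure {x. bump c d e 0 0 x \<noteq> 0})"
    using sub by (meson bounded_subset closed_closure compact_Icc compact_eq_bounded_closed)
  ultimately show ?thesis using assms(3) by (auto simp: test_function_def)
qed

lemma test_function_DERIV:
  assumes "test_function \<eta>"
  shows "(\<eta> has_real_derivative deriv \<eta> x) (at x)" "continuous_on UNIV \<eta>" "continuous_on UNIV (deriv \<eta>)"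
proof -
  have d: "\<eta> differentiable (at x)" "deriv \<eta> differentiable (at x)" for x
    using assms[unfolded test_function_def, THEN conjunct1, rule_format, of 0 x]
      assms[unfolded test_function_def, THEN conjunct1, rule_format, of 1 x] by simp_all
  show "(\<eta> has_real_derivative deriv \<eta> x) (at x)"
    using d(1) by (simp add: DERIV_deriv_iff_real_differentiable)
  show "continuous_on UNIV \<eta>" "continuous_on UNIV (deriv \<eta>)"
    using d unfolding real_differentiable_def
    by (auto intro!: continuous_at_imp_continuous_on dest!: spec intro: DERIV_isCont)
qed

section \<open>Uniqueness of weak derivatives\<close>

lemma sigma_finite_lebesgue: "sigma_finite_measure (lebesgue :: real measure)"
proof
  show "\<exists>A::real set set. countable A \<and> A \<subseteq> sets lebesgue \<and> \<Union> A = space lebesgue \<and> (\<forall>a\<in>A. emeasure lebesgue a \<noteq> \<infinity>)"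
  proof (intro exI[of _ "range (\<lambda>n::nat. {- real n..real n})"] conjI)
    have "x \<in> \<Union> (range (\<lambda>n::nat. {- real n..real n}))" for x :: real
    proof -
      obtain n :: nat where "\<bar>x\<bar> \<le> real n" using real_arch_simple by blast
      then have "x \<in> {- real n..real n}" by auto
      then show ?thesis by blast
    qed
    then show "\<Union> (range (\<lambda>n::nat. {- real n..real n})) = space lebesgue" by auto
  qed auto
qed

text \<open>The Borel sets over which W integrates to 0 include the intervals and are closed under
  countable disjoint unions and, as the total integral is 0, under complements. Lebesgue sets differ
  from Borel sets by null sets, and \<open>density_zero\<close> concludes.\<close>

lemma AE_zero_of_interval_integrals:
  fixes W :: "real \<Rightarrow> complex"
  assumes W: "integrable lebesgue W"
    and 0: "integral\<^sup>L lebesgue W = 0"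
    and ivl: "\<And>a b. a \<le> b \<Longrightarrow> set_lebesgue_integral lebesgue {a..b} W = 0"
  shows "AE x in lebesgue. W x = 0"
proof (rule sigma_finite_measure.density_zero[OF sigma_finite_lebesgue W])
  fix A :: "real set" assume "A \<in> sets lebesgue"
  then obtain S N N' where A: "A = S \<union> N" "N \<subseteq> N'" "N' \<in> null_sets lborel" "S \<in> sets lborel"
    by (rule sets_completionE)
  have B: "set_lebesgue_integral lebesgue B W = 0" if "B \<in> sets borel" for B
    using that
  proof (induction B rule: borel_set_induct)
    case empty then show ?case by (simp add: set_lebesgue_integral_def)
  next
    case (interval a b) then show ?case by (rule ivl)
  next
    case (compl B)
    have BL: "B \<in> sets lebesgue" using compl(1) by simp
    have "set_lebesgue_integral lebesgue (- B) W = (LINT x|lebesgue. W x - indicator B x *\<^sub>R W x)"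
      unfolding set_lebesgue_integral_def
      by (rule Bochner_Integration.integral_cong) (auto simp: indicator_def)
    also have "\<dots> = integral\<^sup>L lebesgue W - set_lebesgue_integral lebesgue B W"
      unfolding set_lebesgue_integral_def
      by (rule Bochner_Integration.integral_diff[OF W integrable_mult_indicator[OF BL W]])
    finally show ?case using compl 0 by simp
  next
    case (union f)
    have m: "f i \<in> sets lebesgue" for i using union(2)[of i] by simp
    have "set_integrable lebesgue (\<Union>i. f i) W"
      unfolding set_integrable_def using m W by (intro integrable_mult_indicator) auto
    then have "set_lebesgue_integral lebesgue (\<Union>i. f i) W = (\<Sum>i. set_lebesgue_integral lebesgue (f i) W)"
      using m union(1) by (intro lebesgue_integral_countable_add) (auto simp: disjoint_family_on_def)
    then show ?case using union(3) by simp
  qed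
  have SL: "S \<in> sets lebesgue" using A(4) by simp
  have "N' \<in> null_sets lebesgue" using A(3) by (rule null_sets_completionI)
  then have "AE x in lebesgue. x \<notin> N'" by (rule AE_not_in)
  then have "AE x in lebesgue. indicator A x *\<^sub>R W x = indicator S x *\<^sub>R W x"
    by eventually_elim (use A in \<open>auto simp: indicator_def\<close>)
  then have "set_lebesgue_integral lebesgue A W = set_lebesgue_integral lebesgue S W"
    unfolding set_lebesgue_integral_def
    using W \<open>A \<in> sets lebesgue\<close> SL
    by (intro integral_cong_AE borel_measurable_integrable integrable_mult_indicator) auto
  then show "set_lebesgue_integral lebesgue A W = 0" using B A(4) by simp
qed

lemma sets_punctured [simp]: "punctured \<in> sets lebesgue" "punctured \<in> sets borel"
  by (auto simp: punctured_def)

lemma open_punctured: "open punctured"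
  by (auto simp: punctured_def)

lemma LINT_lebesgue_on:
  fixes f :: "real \<Rightarrow> 'b::{banach, second_countable_topology}"
  assumes "S \<in> sets lebesgue"
  shows "integral\<^sup>L (lebesgue_on S) f = (LINT x|lebesgue. indicator S x *\<^sub>R f x)"
    and "integrable (lebesgue_on S) f \<longleftrightarrow> integrable lebesgue (\<lambda>x. indicator S x *\<^sub>R f x)"
  using assms by (simp_all add: integral_restrict_space integrable_restrict_space)

text \<open>The complement of the closed support is open and \<eta> vanishes on it, so its
  derivative vanishes there too; on the compact support continuity gives the bounds.\<close>

lemma test_function_bounded:
  assumes "test_function \<eta>"
  obtains K B where "compact K" "K \<subseteq> punctured" "\<And>x. x \<notin> K \<Longrightarrow> \<eta> x = 0 \<and> deriv \<eta> x = 0"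
    "\<And>x. \<bar>\<eta> x\<bar> \<le> B" "\<And>x. \<bar>deriv \<eta> x\<bar> \<le> B"
proof -
  define K where "K = closure {x. \<eta> x \<noteq> 0}"
  have K: "compact K" "K \<subseteq> punctured" using assms by (auto simp: K_def test_function_def)
  have out: "\<eta> x = 0 \<and> deriv \<eta> x = 0" if "x \<notin> K" for x
  proof -
    have "open (- K)" by (simp add: K_def open_Compl)
    moreover have "\<eta> y = 0" if "y \<in> - K" for y
      using that closure_subset[of "{x. \<eta> x \<noteq> 0}"] by (auto simp: K_def)
    ultimately have "\<forall>\<^sub>F y in nhds x. \<eta> y = 0"
      using \<open>x \<notin> K\<close> by (intro eventually_nhds[THEN iffD2] exI[of _ "- K"]) auto
    then have "(\<eta> has_real_derivative 0) (at x)"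
      by (subst DERIV_cong_ev[OF refl _ refl]) auto
    moreover have "\<eta> x = 0" using \<open>\<And>y. y \<in> - K \<Longrightarrow> \<eta> y = 0\<close> that by simp
    ultimately show ?thesis by (simp add: DERIV_imp_deriv)
  qed
  have bnd: "\<exists>B. \<forall>x\<in>K. \<bar>f x\<bar> \<le> B" if "continuous_on UNIV f" for f :: "real \<Rightarrow> real"
    using compact_imp_bounded[OF compact_continuous_image[OF continuous_on_subset[OF that subset_UNIV] K(1)]]
    by (auto simp: bounded_iff)
  obtain B1 where B1: "\<And>x. x \<in> K \<Longrightarrow> \<bar>\<eta> x\<bar> \<le> B1"
    using bnd[OF test_function_DERIV(2)[OF assms]] by blast
  obtain B2 where B2: "\<And>x. x \<in> K \<Longrightarrow> \<bar>deriv \<eta> x\<bar> \<le> B2"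
    using bnd[OF test_function_DERIV(3)[OF assms]] by blast
  show ?thesis
  proof (rule that[OF K out])
    show "\<bar>\<eta> x\<bar> \<le> max 0 (max B1 B2)" "\<bar>deriv \<eta> x\<bar> \<le> max 0 (max B1 B2)" for x
      using B1[of x] B2[of x] out[of x] by (cases "x \<in> K"; auto)+
  qed
qed

lemma integrable_locally_mult:
  assumes v: "locally_integrable v" and K: "compact K" "K \<subseteq> punctured"
    and out: "\<And>x. x \<notin> K \<Longrightarrow> f x = 0" and f: "continuous_on UNIV f" and B: "\<And>x. \<bar>f x\<bar> \<le> (B::real)"
  shows "integrable (lebesgue_on punctured) (\<lambda>x. v x * of_real (f x))"
proof -
  have Ks: "K \<in> sets lebesgue" using K(1) by (simp add: compact_imp_closed)
  have "integrable (lebesgue_on K) v" using v K by (simp add: locally_integrable_def)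
  then have i: "integrable lebesgue (\<lambda>x. indicator K x *\<^sub>R v x)" by (simp add: LINT_lebesgue_on(2)[OF Ks])
  have fm: "f \<in> borel_measurable lebesgue"
    using f by (simp add: borel_measurable_continuous_onI measurable_completion)
  have "integrable lebesgue (\<lambda>x. (indicator K x *\<^sub>R v x) * of_real (f x))"
  proof (rule Bochner_Integration.integrable_bound)
    show "integrable lebesgue (\<lambda>x. of_real B * (indicator K x *\<^sub>R v x))" using i by (rule integrable_mult_right)
    show "(\<lambda>x. (indicator K x *\<^sub>R v x) * of_real (f x)) \<in> borel_measurable lebesgue"
      using borel_measurable_integrable[OF i] fm by measurable
    show "AE x in lebesgue. norm ((indicator K x *\<^sub>R v x) * of_real (f x)) \<le> norm (of_real B * (indicator K x *\<^sub>R v x))"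
      using B by (auto simp: norm_mult mult.commute intro!: AE_I2 mult_mono order_trans[OF B abs_ge_self])
  qed
  also have "(\<lambda>x. (indicator K x *\<^sub>R v x) * of_real (f x)) = (\<lambda>x. indicator punctured x *\<^sub>R (v x * of_real (f x)))"
    using out K(2) by (auto simp: indicator_def fun_eq_iff)
  finally show ?thesis by (simp add: LINT_lebesgue_on(2))
qed

lemma integrable_locally_test_function:
  assumes v: "locally_integrable v" and "test_function \<eta>"
  shows "integrable (lebesgue_on punctured) (\<lambda>x. v x * of_real (\<eta> x))"
    and "integrable (lebesgue_on punctured) (\<lambda>x. v x * of_real (deriv \<eta> x))"
proof -
  obtain K B where "compact K" "K \<subseteq> punctured" "\<And>x. x \<notin> K \<Longrightarrow> \<eta> x = 0 \<and> deriv \<eta> x = 0"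
    "\<And>x. \<bar>\<eta> x\<bar> \<le> B" "\<And>x. \<bar>deriv \<eta> x\<bar> \<le> B"
    using test_function_bounded[OF assms(2)] by blast
  then show "integrable (lebesgue_on punctured) (\<lambda>x. v x * of_real (\<eta> x))"
    "integrable (lebesgue_on punctured) (\<lambda>x. v x * of_real (deriv \<eta> x))"
    using test_function_DERIV(2,3)[OF assms(2)] by (blast intro: integrable_locally_mult[OF v])+
qed

lemma bump_tendsto_1:
  assumes "c < x" "x < d"
  shows "(\<lambda>n. bump c d (1 / real (Suc n)) 0 0 x) \<longlonglongrightarrow> 1"
proof -
  have "(\<lambda>n. exp (- (1 / real (Suc n) * t))) \<longlonglongrightarrow> exp (- (0 * t))" for t :: real
    by (intro tendsto_intros) (rule LIMSEQ_Suc[OF lim_1_over_n])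
  then have "(\<lambda>n. exp (- (1 / real (Suc n) * (1 / (x - c)))) * exp (- (1 / real (Suc n) * (1 / (d - x))))) \<longlonglongrightarrow> exp (- (0 * (1 / (x - c)))) * exp (- (0 * (1 / (d - x))))"
    by (intro tendsto_mult)
  then show ?thesis using assms by (simp add: bump_def)
qed

lemma bump_le_1:
  assumes "0 < e"
  shows "0 \<le> bump c d e 0 0 x" "bump c d e 0 0 x \<le> 1"
  using assms by (auto simp: bump_def intro!: mult_le_one)

text \<open>Fundamental lemma of the calculus of variations. Inside the punctured set, bumps of
  scale 1/(n+1) converge boundedly to the indicator of an interval, so w has vanishing interval
  integrals by dominated convergence. Countably many intervals exhaust the punctured set.\<close>

lemma AE_zero_of_test_integrals:
  assumes w: "locally_integrable w"
    and test: "\<And>\<eta>. test_function \<eta> \<Longrightarrow> (LINT x|lebesgue_on punctured. w x * of_real (\<eta> x)) = 0"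
  shows "AE x in lebesgue. x \<in> punctured \<longrightarrow> w x = 0"
proof -
  have loc: "integrable lebesgue (\<lambda>x. indicator {c..d} x *\<^sub>R w x)" if "{c..d} \<subseteq> punctured" for c d
    using w that LINT_lebesgue_on(2)[of "{c..d}" w] by (simp add: locally_integrable_def)
  have ivl: "(LINT x|lebesgue. indicator {c..d} x *\<^sub>R w x) = 0" if cd: "c < d" "{c..d} \<subseteq> punctured" for c d
  proof -
    let ?F = "\<lambda>n x. indicator {c..d} x *\<^sub>R (w x * of_real (bump c d (1 / real (Suc n)) 0 0 x))"
    have T: "test_function (bump c d (1 / real (Suc n)) 0 0)" for n
      using cd by (intro test_function_bump) auto
    have eq: "?F n = (\<lambda>x. indicator punctured x *\<^sub>R (w x * of_real (bump c d (1 / real (Suc n)) 0 0 x)))" for n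
      using cd(2) by (auto simp: fun_eq_iff indicator_def bump_def)
    have F0: "(LINT x|lebesgue. ?F n x) = 0" for n
      unfolding eq using test[OF T[of n]] by (simp add: LINT_lebesgue_on(1))
    have Fi: "integrable lebesgue (?F n)" for n
      unfolding eq using integrable_locally_test_function(1)[OF w T[of n]] by (simp add: LINT_lebesgue_on(2))
    have "(\<lambda>n. LINT x|lebesgue. ?F n x) \<longlonglongrightarrow> (LINT x|lebesgue. indicator {c..d} x *\<^sub>R w x)"
    proof (rule integral_dominated_convergence)
      show "(\<lambda>x. indicator {c..d} x *\<^sub>R w x) \<in> borel_measurable lebesgue"
        using loc[OF cd(2)] by (rule borel_measurable_integrable)
      show "?F n \<in> borel_measurable lebesgue" for n using Fi by (rule borel_measurable_integrable)
      show "integrable lebesgue (\<lambda>x. norm (indicator {c..d} x *\<^sub>R w x))"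
        using loc[OF cd(2)] by (rule integrable_norm)
      show "AE x in lebesgue. norm (?F n x) \<le> norm (indicator {c..d} x *\<^sub>R w x)" for n
        using bump_le_1[of "1 / real (Suc n)" c d]
        by (intro AE_I2) (auto simp: norm_mult indicator_def mult_left_le simp del: of_nat_Suc)
      have "{c, d} \<in> null_sets lebesgue" using negligible_finite[of "{c,d}"] negligible_iff_null_sets by blast
      then have "AE x in lebesgue. x \<notin> {c, d}" by (rule AE_not_in)
      then show "AE x in lebesgue. (\<lambda>n. ?F n x) \<longlonglongrightarrow> indicator {c..d} x *\<^sub>R w x"
      proof eventually_elim
        case (elim x)
        show ?case
        proof (cases "c < x \<and> x < d")
          case True
          then have "(\<lambda>n. w x * of_real (bump c d (1 / real (Suc n)) 0 0 x)) \<longlonglongrightarrow> w x * of_real 1"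
            using bump_tendsto_1 by (intro tendsto_intros) auto
          then show ?thesis using True by (simp add: indicator_def)
        next
          case False
          then have "x \<notin> {c..d}" using elim by auto
          then show ?thesis by simp
        qed
      qed
    qed
    then show ?thesis unfolding F0 by (simp add: LIMSEQ_const_iff)
  qed
  have sub: "AE x in lebesgue. x \<in> {c..d} \<longrightarrow> w x = 0" if cd: "{c..d} \<subseteq> punctured" for c d
  proof (cases "c < d")
    case True
    have "AE x in lebesgue. indicator {c..d} x *\<^sub>R w x = 0"
    proof (rule AE_zero_of_interval_integrals[OF loc[OF cd] ivl[OF True cd]])
      fix a b :: real assume "a \<le> b"
      \<comment> \<open>Cutting down to {a..b} leaves an interval of the same kind, or a null set
        with at most one point.\<close>
      have eq: "indicator {a..b} x *\<^sub>R (indicator {c..d} x *\<^sub>R w x) = indicator {max a c..min b d} x *\<^sub>R w x" for x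
        by (auto simp: indicator_def)
      have "(LINT x|lebesgue. indicator {max a c..min b d} x *\<^sub>R w x) = 0"
      proof (cases "max a c < min b d")
        case True
        then show ?thesis using cd by (intro ivl) auto
      next
        case False
        then have "{max a c..min b d} \<subseteq> {max a c}" by auto
        then have "negligible {max a c..min b d}" by (meson finite.intros negligible_finite negligible_subset)
        then have "{max a c..min b d} \<in> null_sets lebesgue" using negligible_iff_null_sets by blast
        then have "AE x in lebesgue. x \<notin> {max a c..min b d}" by (rule AE_not_in)
        then have "AE x in lebesgue. indicator {max a c..min b d} x *\<^sub>R w x = 0"
          by eventually_elim simp
        then show ?thesis by (rule integral_eq_zero_AE)
      qed
      then show "set_lebesgue_integral lebesgue {a..b} (\<lambda>x. indicator {c..d} x *\<^sub>R w x) = 0"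
        unfolding set_lebesgue_integral_def eq .
    qed
    then show ?thesis by eventually_elim (auto simp: indicator_def)
  next
    case False
    then have "{c..d} \<subseteq> {c}" by auto
    then have "negligible {c..d}" by (meson finite.intros negligible_finite negligible_subset)
    then have "{c..d} \<in> null_sets lebesgue" using negligible_iff_null_sets by blast
    then have "AE x in lebesgue. x \<notin> {c..d}" by (rule AE_not_in)
    then show ?thesis by eventually_elim blast
  qed
  have pos: "{1 / real (Suc n)..pi - 1 / real (Suc n)} \<subseteq> punctured" for n
  proof
    fix x assume "x \<in> {1 / real (Suc n)..pi - 1 / real (Suc n)}"
    moreover have "0 < 1 / real (Suc n)" by simp
    ultimately show "x \<in> punctured" unfolding punctured_def by (simp only: Un_iff greaterThanLessThan_iff atLeastAtMost_iff) linarith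
  qed
  have neg: "{1 / real (Suc n) - pi..- (1 / real (Suc n))} \<subseteq> punctured" for n
  proof
    fix x assume "x \<in> {1 / real (Suc n) - pi..- (1 / real (Suc n))}"
    moreover have "0 < 1 / real (Suc n)" by simp
    ultimately show "x \<in> punctured" unfolding punctured_def by (simp only: Un_iff greaterThanLessThan_iff atLeastAtMost_iff) linarith
  qed
  have "AE x in lebesgue. \<forall>n. (x \<in> {1 / real (Suc n)..pi - 1 / real (Suc n)} \<longrightarrow> w x = 0) \<and>
      (x \<in> {1 / real (Suc n) - pi..- (1 / real (Suc n))} \<longrightarrow> w x = 0)"
    unfolding AE_all_countable using sub[OF pos] sub[OF neg] by (auto intro: AE_conjI)
  then show ?thesis
  proof eventually_elim
    case (elim x)
    show ?case
    proof
      assume x: "x \<in> punctured"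
      then have "0 < min \<bar>x\<bar> (pi - \<bar>x\<bar>)" by (auto simp: punctured_def)
      then obtain n where n: "1 / real (Suc n) < min \<bar>x\<bar> (pi - \<bar>x\<bar>)"
        using nat_approx_posE by blast
      show "w x = 0"
        using elim[rule_format, of n] n x by (cases "0 < x") (auto simp: punctured_def)
    qed
  qed
qed

text \<open>Agreement almost everywhere is assumed rather than equality because, in an iterated
  derivative, the first derivative is itself known only up to a null set.\<close>

lemma weak_deriv_unique_AE:
  assumes "weak_deriv f g" "weak_deriv f' g'" and AE: "AE x in lebesgue. x \<in> punctured \<longrightarrow> f x = f' x"
  shows "AE x in lebesgue. x \<in> punctured \<longrightarrow> g x = g' x"
proof -
  have li: "locally_integrable f" "locally_integrable g" "locally_integrable f'" "locally_integrable g'"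
    using assms by (auto simp: weak_deriv_def)
  have "locally_integrable (\<lambda>x. g x - g' x)"
    using li unfolding locally_integrable_def by auto
  moreover have "(LINT x|lebesgue_on punctured. (g x - g' x) * of_real (\<eta> x)) = 0" if "test_function \<eta>" for \<eta>
  proof -
    note i = integrable_locally_test_function[OF _ that]
    have "AE x in lebesgue_on punctured. f x * of_real (deriv \<eta> x) = f' x * of_real (deriv \<eta> x)"
      using AE by (subst AE_restrict_space_iff) (auto elim: eventually_mono)
    then have "(LINT x|lebesgue_on punctured. f x * of_real (deriv \<eta> x)) = (LINT x|lebesgue_on punctured. f' x * of_real (deriv \<eta> x))"
      using i(2)[OF li(1)] i(2)[OF li(3)] by (intro integral_cong_AE) auto
    then have "(LINT x|lebesgue_on punctured. g x * of_real (\<eta> x)) = (LINT x|lebesgue_on punctured. g' x * of_real (\<eta> x))"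
      using assms(1,2) that by (simp add: weak_deriv_def)
    then show ?thesis
      unfolding left_diff_distrib using Bochner_Integration.integral_diff[OF i(1)[OF li(2)] i(1)[OF li(4)]] by simp
  qed
  ultimately have "AE x in lebesgue. x \<in> punctured \<longrightarrow> g x - g' x = 0"
    by (rule AE_zero_of_test_integrals)
  then show ?thesis by eventually_elim simp
qed

lemma locally_integrable_continuous:
  assumes "continuous_on punctured u"
  shows "locally_integrable u"
  unfolding locally_integrable_def
proof (intro allI impI)
  fix K assume K: "compact K \<and> K \<subseteq> punctured"
  then have "integrable lborel (\<lambda>x. indicator K x *\<^sub>R u x)"
    using assms by (intro borel_integrable_compact) (auto intro: continuous_on_subset)
  then have "integrable lebesgue (\<lambda>x. indicator K x *\<^sub>R u x)"
    by (subst integrable_completion) auto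
  then show "integrable (lebesgue_on K) u"
    using K by (subst LINT_lebesgue_on(2)) (auto simp: compact_imp_closed)
qed

text \<open>The product of u and \<eta>, extended by 0, is continuously differentiable on the whole
  line, since \<eta> vanishes off a compact subset of the punctured set. The fundamental theorem on
  [-pi, pi] then has zero boundary values.\<close>

lemma weak_deriv_classical:
  assumes u: "\<And>x. x \<in> punctured \<Longrightarrow> (u has_vector_derivative u' x) (at x)"
    and u': "continuous_on punctured u'"
  shows "weak_deriv u u'"
proof -
  have "continuous_on punctured u"
    using u by (intro continuous_at_imp_continuous_on) (blast intro: has_vector_derivative_continuous)
  then have li: "locally_integrable u" "locally_integrable u'"
    using u' by (auto intro: locally_integrable_continuous)
  have "(LINT x|lebesgue_on punctured. u x * of_real (deriv \<eta> x)) = - (LINT x|lebesgue_on punctured. u' x * of_real (\<eta> x))"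
    if \<eta>: "test_function \<eta>" for \<eta>
  proof -
    obtain K B where K: "compact K" "K \<subseteq> punctured" "\<And>x. x \<notin> K \<Longrightarrow> \<eta> x = 0 \<and> deriv \<eta> x = 0"
      using test_function_bounded[OF \<eta>] by metis
    define F where "F x = (if x \<in> punctured then u x * of_real (\<eta> x) else 0)" for x
    define f where "f x = (if x \<in> punctured then u x * of_real (deriv \<eta> x) + u' x * of_real (\<eta> x) else 0)" for x
    have oK: "open (- K)" using K(1) by (simp add: compact_imp_closed open_Compl)
    have dF: "(F has_vector_derivative f x) (at x)" for x
    proof (cases "x \<in> punctured")
      case True
      have "((\<lambda>x. of_real (\<eta> x) :: complex) has_vector_derivative of_real (deriv \<eta> x)) (at x)"
        using test_function_DERIV(1)[OF \<eta>, of x]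
        by (auto simp: has_real_derivative_iff_has_vector_derivative intro: has_vector_derivative_of_real)
      from has_vector_derivative_mult[OF u[OF True] this]
      have "((\<lambda>x. u x * of_real (\<eta> x)) has_vector_derivative f x) (at x)"
        using True by (simp add: f_def)
      then show ?thesis
        by (rule has_vector_derivative_transform_within_open[OF _ open_punctured True]) (simp add: F_def)
    next
      case False
      have "((\<lambda>x. 0) has_vector_derivative f x) (at x)" using False by (simp add: f_def)
      then show ?thesis
        by (rule has_vector_derivative_transform_within_open[OF _ oK]) (use False K in \<open>auto simp: F_def\<close>)
    qed
    have "continuous_on (punctured \<union> - K) f"
    proof (rule continuous_on_open_Un[OF open_punctured oK])
      have "continuous_on punctured (\<lambda>x. u x * of_real (deriv \<eta> x) + u' x * of_real (\<eta> x))"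
        using test_function_DERIV(2,3)[OF \<eta>]
        by (intro continuous_intros \<open>continuous_on punctured u\<close> u') (auto intro: continuous_on_subset)
      then show "continuous_on punctured f"
        by (rule continuous_on_eq) (simp add: f_def)
      show "continuous_on (- K) f"
        by (rule continuous_on_eq[of _ "\<lambda>_. 0"]) (use K in \<open>auto simp: f_def\<close>)
    qed
    moreover have "punctured \<union> - K = UNIV" using K(2) by auto
    ultimately have fc: "continuous_on {-pi..pi} f" by (auto intro: continuous_on_subset)
    have "(LINT x|lborel. indicator {-pi..pi} x *\<^sub>R f x) = F pi - F (-pi)"
      by (rule integral_FTC_Icc[OF _ _ fc]) (auto intro: has_vector_derivative_at_within dF)
    also have "\<dots> = 0" by (simp add: F_def punctured_def)
    finally have 0: "(LINT x|lborel. indicator {-pi..pi} x *\<^sub>R f x) = 0" .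
    have "integrable lborel (\<lambda>x. indicator {-pi..pi} x *\<^sub>R f x)"
      by (rule borel_integrable_compact[OF _ fc]) simp
    then have "(LINT x|lebesgue. indicator {-pi..pi} x *\<^sub>R f x) = 0"
      by (subst integral_completion) (auto simp: 0)
    also have "(\<lambda>x. indicator {-pi..pi} x *\<^sub>R f x) = (\<lambda>x. indicator punctured x *\<^sub>R (u x * of_real (deriv \<eta> x) + u' x * of_real (\<eta> x)))"
      by (auto simp: fun_eq_iff f_def indicator_def punctured_def)
    finally have "(LINT x|lebesgue_on punctured. u x * of_real (deriv \<eta> x) + u' x * of_real (\<eta> x)) = 0"
      by (simp add: LINT_lebesgue_on(1))
    then show ?thesis
      using Bochner_Integration.integral_add[OF integrable_locally_test_function(2)[OF li(1) \<eta>] integrable_locally_test_function(1)[OF li(2) \<eta>]]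
      by (simp add: eq_neg_iff_add_eq_0)
  qed
  then show ?thesis using li by (simp add: weak_deriv_def)
qed

section \<open>Integrals on the interval from \<open>-pi\<close> to \<open>pi\<close>\<close>

lemma measurable_lebesgue_on:
  fixes f :: "real \<Rightarrow> 'a::topological_space"
  assumes "f \<in> borel_measurable borel"
  shows "f \<in> borel_measurable (lebesgue_on S)"
  using assms by (simp add: measurable_completion measurable_restrict_space1)

lemma AE_lebesgue_neq: "AE x :: real in lebesgue. x \<noteq> c"
proof -
  have "{c} \<in> null_sets lebesgue" using negligible_sing[of c] negligible_iff_null_sets by blast
  then show ?thesis using AE_not_in[of "{c}" lebesgue] by simp
qed

lemma AE_leb_pi:
  assumes "\<And>x. -pi < x \<Longrightarrow> x < pi \<Longrightarrow> x \<noteq> 0 \<Longrightarrow> P x"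
  shows "AE x in leb_pi. P x"
  using AE_lebesgue_neq[of 0]
  by (subst AE_restrict_space_iff) (auto elim!: eventually_mono intro: assms)

lemma leb_pi_reflect:
  fixes f :: "real \<Rightarrow> 'a::euclidean_space"
  shows "integrable leb_pi (\<lambda>x. f (- x)) \<longleftrightarrow> integrable leb_pi f"
    and "(LINT x|leb_pi. f (- x)) = (LINT x|leb_pi. f x)"
proof -
  have e: "(\<lambda>x. indicator {-pi<..<pi} x *\<^sub>R f (- x)) = (\<lambda>x. indicator {-pi<..<pi} (0 + (-1) * x) *\<^sub>R f (0 + (-1) * x))"
    by (auto simp: fun_eq_iff indicator_def)
  show "integrable leb_pi (\<lambda>x. f (- x)) \<longleftrightarrow> integrable leb_pi f"
    unfolding LINT_lebesgue_on(2)[of "{-pi<..<pi}", simplified] e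
    by (subst lebesgue_integrable_real_affine_iff) auto
  show "(LINT x|leb_pi. f (- x)) = (LINT x|leb_pi. f x)"
    unfolding LINT_lebesgue_on(1)[of "{-pi<..<pi}", simplified] e
    using lebesgue_integral_real_affine[of "-1" "\<lambda>x. indicator {-pi<..<pi} x *\<^sub>R f x" 0] by simp
qed

lemma leb_pi_odd:
  fixes f :: "real \<Rightarrow> 'a::euclidean_space"
  assumes "\<And>x. f (- x) = - f x"
  shows "(LINT x|leb_pi. f x) = 0"
proof -
  have "(LINT x|leb_pi. f x) = - (LINT x|leb_pi. f x)"
    using leb_pi_reflect(2)[of f] by (simp add: assms)
  then have "(LINT x|leb_pi. f x) + (LINT x|leb_pi. f x) = 0"
    by (metis add.right_inverse)
  then have "2 *\<^sub>R (LINT x|leb_pi. f x) = 0" by (simp add: scaleR_2)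
  then show ?thesis by simp
qed

text \<open>The restriction to (0, pi) and its reflection cover the interval up to the null set {0}.
  Measurability on the whole interval comes from an exact formula that restores the value at
  0.\<close>

lemma leb_pi_even:
  fixes f :: "real \<Rightarrow> 'a::euclidean_space"
  assumes even: "\<And>x. f (- x) = f x" and i: "integrable (lebesgue_on {0<..<pi}) f"
  shows "integrable leb_pi f" "(LINT x|leb_pi. f x) = 2 *\<^sub>R (LINT x|lebesgue_on {0<..<pi}. f x)"
proof -
  let ?g = "\<lambda>x. indicator {0<..<pi} x *\<^sub>R f x"
  have g: "integrable lebesgue ?g" using i by (simp add: LINT_lebesgue_on(2))
  have g': "integrable lebesgue (\<lambda>x. ?g (- x))"
    using lebesgue_integrable_real_affine_iff[of "-1" ?g 0] g by simp
  have h: "(LINT x|lebesgue. ?g (- x)) = (LINT x|lebesgue. ?g x)"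
    using lebesgue_integral_real_affine[of "-1" ?g 0] by simp
  have AE: "AE x in lebesgue. ?g x + ?g (- x) = indicator {-pi<..<pi} x *\<^sub>R f x"
    using AE_lebesgue_neq[of 0] by eventually_elim (auto simp: indicator_def even)
  have "(\<lambda>x. indicator {-pi<..<pi} x *\<^sub>R f x) = (\<lambda>x. (?g x + ?g (- x)) + indicator {0} x *\<^sub>R f 0)"
    by (auto simp: fun_eq_iff indicator_def even)
  moreover have "(\<lambda>x. indicator {0} x *\<^sub>R f 0) \<in> borel_measurable lebesgue"
    by (intro borel_measurable_scaleR borel_measurable_indicator) auto
  then have "(\<lambda>x. (?g x + ?g (- x)) + indicator {0} x *\<^sub>R f 0) \<in> borel_measurable lebesgue"
    by (rule borel_measurable_add[OF borel_measurable_add[OF borel_measurable_integrable[OF g] borel_measurable_integrable[OF g']]])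
  ultimately have m: "(\<lambda>x. indicator {-pi<..<pi} x *\<^sub>R f x) \<in> borel_measurable lebesgue" by simp
  have sum: "integrable lebesgue (\<lambda>x. ?g x + ?g (- x))" using g g' by (rule Bochner_Integration.integrable_add)
  have "integrable lebesgue (\<lambda>x. indicator {-pi<..<pi} x *\<^sub>R f x)"
    using integrable_cong_AE[OF borel_measurable_integrable[OF sum] m AE] sum by simp
  then show "integrable leb_pi f" by (simp add: LINT_lebesgue_on(2))
  have "(LINT x|lebesgue. indicator {-pi<..<pi} x *\<^sub>R f x) = (LINT x|lebesgue. ?g x + ?g (- x))"
    using integral_cong_AE[OF borel_measurable_integrable[OF sum] m AE] by simp
  also have "\<dots> = 2 *\<^sub>R (LINT x|lebesgue. ?g x)"
    using Bochner_Integration.integral_add[OF g g'] h by (simp add: scaleR_2)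
  finally show "(LINT x|leb_pi. f x) = 2 *\<^sub>R (LINT x|lebesgue_on {0<..<pi}. f x)"
    by (simp add: LINT_lebesgue_on(1))
qed

section \<open>L^p convergence and pairings with bounded functions\<close>

lemma finite_measure_leb_pi: "finite_measure leb_pi"
  by (rule finite_measureI) (simp add: emeasure_restrict_space)

lemma integrable_leb_pi_bounded:
  fixes f :: "real \<Rightarrow> 'a::{banach, second_countable_topology}"
  assumes "f \<in> borel_measurable leb_pi" "\<And>x. -pi < x \<Longrightarrow> x < pi \<Longrightarrow> norm (f x) \<le> B"
  shows "integrable leb_pi f"
  by (rule finite_measure.integrable_const_bound[OF finite_measure_leb_pi, of _ B])
     (use assms in \<open>auto intro!: AE_I2\<close>)

lemma integrable_lebesgue_on_bound:
  fixes f :: "real \<Rightarrow> 'a::{banach, second_countable_topology}" and g :: "real \<Rightarrow> real"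
  assumes "integrable (lebesgue_on S) g" "f \<in> borel_measurable (lebesgue_on S)"
    "\<And>x. x \<in> S \<Longrightarrow> norm (f x) \<le> g x"
  shows "integrable (lebesgue_on S) f"
  by (rule Bochner_Integration.integrable_bound[OF assms(1,2)])
     (use assms(3) in \<open>fastforce intro!: AE_I2\<close>)

text \<open>Takes the role of Hoelder's inequality on a set of finite measure: above \<delta>, write
  x = x^(1-p) x^p with 1 - p \<le> 0. The value \<delta> = 1 gives integrability, a small \<delta>
  gives convergence.\<close>

lemma le_scaled_powr: "0 < \<delta> \<Longrightarrow> 1 \<le> p \<Longrightarrow> 0 \<le> x \<Longrightarrow> x \<le> \<delta> + \<delta> powr (1 - p) * x powr p" for x p \<delta> :: real
proof (cases "x \<le> \<delta>")
  case False
  assume d: "0 < \<delta>" "1 \<le> p" "0 \<le> x"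
  have "x = x powr (1 - p) * x powr p" using False d by (simp flip: powr_add)
  also have "\<dots> \<le> \<delta> powr (1 - p) * x powr p"
    using False d by (intro mult_right_mono) (auto simp: powr_mono2')
  finally show ?thesis using d by simp
qed (simp add: add_increasing2)

lemma Lp_integrable:
  assumes "1 \<le> p" "f \<in> Lp p"
  shows "integrable leb_pi f"
proof (rule integrable_lebesgue_on_bound)
  show "integrable leb_pi (\<lambda>x. 1 + 1 powr (1 - p) * norm (f x) powr p)"
    using assms by (auto simp: Lp_def intro!: Bochner_Integration.integrable_add
        finite_measure.integrable_const[OF finite_measure_leb_pi])
  show "f \<in> borel_measurable leb_pi" using assms by (simp add: Lp_def)
  show "norm (f x) \<le> 1 + 1 powr (1 - p) * norm (f x) powr p" for x
    using le_scaled_powr[of 1 p "norm (f x)"] assms by simp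
qed

text \<open>Integrating \<open>le_scaled_powr\<close> bounds the L^1 distance by V \<delta> +
  \<delta>^(1-p) I_j, with V the total measure: a small \<delta> controls the first term, after
  which a large j controls the second.\<close>

lemma Lp_tendsto_imp_L1:
  assumes p: "1 \<le> p" and F: "Lp_tendsto p F f"
  shows "(\<lambda>j. LINT x|leb_pi. norm (F j x - f x)) \<longlonglongrightarrow> 0"
proof -
  define I where "I j = (LINT x|leb_pi. norm (F j x - f x) powr p)" for j
  have I0: "0 \<le> I j" for j unfolding I_def by (rule Bochner_Integration.integral_nonneg) simp
  have mem: "(\<lambda>x. F j x - f x) \<in> Lp p" for j using F by (simp add: Lp_tendsto_def)
  have "(\<lambda>j. I j powr (1 / p)) \<longlonglongrightarrow> 0" using F by (simp add: Lp_tendsto_def Lp_norm_def I_def)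
  then have "(\<lambda>j. (I j powr (1 / p)) powr p) \<longlonglongrightarrow> 0"
    by (rule tendsto_zero_powrI[OF _ tendsto_const]) (use p in auto)
  then have I: "I \<longlonglongrightarrow> 0" using I0 p by (simp add: powr_powr)
  define V where "V = measure leb_pi (space leb_pi)"
  have V: "0 \<le> V" by (simp add: V_def)
  have bnd: "(LINT x|leb_pi. norm (F j x - f x)) \<le> V * \<delta> + \<delta> powr (1 - p) * I j" if "0 < \<delta>" for \<delta> j
  proof -
    have ip: "integrable leb_pi (\<lambda>x. norm (F j x - f x) powr p)" using mem[of j] by (simp add: Lp_def)
    have "(LINT x|leb_pi. norm (F j x - f x)) \<le> (LINT x|leb_pi. \<delta> + \<delta> powr (1 - p) * norm (F j x - f x) powr p)"
      using Lp_integrable[OF p mem[of j]] ip that p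
      by (intro integral_mono Bochner_Integration.integrable_add le_scaled_powr integrable_norm integrable_mult_right
           finite_measure.integrable_const[OF finite_measure_leb_pi]) auto
    also have "\<dots> = V * \<delta> + \<delta> powr (1 - p) * I j"
      using ip by (subst Bochner_Integration.integral_add)
        (auto simp: I_def V_def finite_measure.integrable_const[OF finite_measure_leb_pi])
    finally show ?thesis .
  qed
  show ?thesis
  proof (rule LIMSEQ_I)
    fix r :: real assume r: "0 < r"
    define \<delta> where "\<delta> = r / (2 * (V + 1))"
    have d: "0 < \<delta>" using r V by (simp add: \<delta>_def)
    have Vd: "V * \<delta> \<le> r / 2" using r V by (simp add: \<delta>_def field_simps)
    have "(\<lambda>j. \<delta> powr (1 - p) * I j) \<longlonglongrightarrow> \<delta> powr (1 - p) * 0" by (intro tendsto_mult tendsto_const I)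
    then obtain N where N: "\<And>j. N \<le> j \<Longrightarrow> \<delta> powr (1 - p) * I j < r / 2"
      using order_tendstoD(2)[of _ 0 sequentially "r / 2"] r by (auto simp: eventually_sequentially)
    have "norm ((LINT x|leb_pi. norm (F j x - f x)) - 0) < r" if "N \<le> j" for j
    proof -
      have "0 \<le> (LINT x|leb_pi. norm (F j x - f x))" by (rule Bochner_Integration.integral_nonneg) simp
      then show ?thesis using bnd[OF d, of j] Vd N[OF that] by simp
    qed
    then show "\<exists>N. \<forall>j\<ge>N. norm ((LINT x|leb_pi. norm (F j x - f x)) - 0) < r" by blast
  qed
qed

lemma integrable_mult_bounded:
  fixes f \<phi> :: "real \<Rightarrow> complex"
  assumes "integrable leb_pi f" "\<phi> \<in> borel_measurable leb_pi" "\<And>x. -pi < x \<Longrightarrow> x < pi \<Longrightarrow> norm (\<phi> x) \<le> B"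
  shows "integrable leb_pi (\<lambda>x. f x * cnj (\<phi> x))"
proof (rule integrable_lebesgue_on_bound)
  show "integrable leb_pi (\<lambda>x. B * norm (f x))" using assms(1) by simp
  have "(\<lambda>x. cnj (\<phi> x)) \<in> borel_measurable leb_pi"
    using measurable_compose[OF assms(2) borel_measurable_continuous_onI[of cnj]] by (simp add: continuous_intros)
  then show "(\<lambda>x. f x * cnj (\<phi> x)) \<in> borel_measurable leb_pi"
    using borel_measurable_integrable[OF assms(1)] by measurable
  show "norm (f x * cnj (\<phi> x)) \<le> B * norm (f x)" if "x \<in> {-pi<..<pi}" for x
    using mult_right_mono[OF assms(3), of x "norm (f x)"] that by (simp add: norm_mult mult.commute)
qed

text \<open>Against a bounded \<phi> convergence in L^1 suffices, so one statement serves both the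
  partial sums in L^2 and the approximating sequences in L^p.\<close>

lemma inner_pi_tendsto:
  assumes p: "1 \<le> p" and F: "Lp_tendsto p F f" and f: "integrable leb_pi f"
    and \<phi>: "\<phi> \<in> borel_measurable leb_pi" "\<And>x. -pi < x \<Longrightarrow> x < pi \<Longrightarrow> norm (\<phi> x) \<le> B"
  shows "(\<lambda>j. inner_pi (F j) \<phi>) \<longlonglongrightarrow> inner_pi f \<phi>"
proof -
  have d: "integrable leb_pi (\<lambda>x. F j x - f x)" for j
    using Lp_integrable[OF p] F by (simp add: Lp_tendsto_def)
  have Fi: "integrable leb_pi (F j)" for j
    using Bochner_Integration.integrable_add[OF d[of j] f] by simp
  have m: "integrable leb_pi (\<lambda>x. h x * cnj (\<phi> x))" if "integrable leb_pi h" for h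
    using integrable_mult_bounded[OF that \<phi>] by blast
  have B0: "0 \<le> B" using \<phi>(2)[of 0] norm_ge_zero[of "\<phi> 0"] by (meson order_trans pi_gt_zero neg_less_0_iff_less)
  have le: "norm (inner_pi (F j) \<phi> - inner_pi f \<phi>) \<le> B * (LINT x|leb_pi. norm (F j x - f x))" for j
  proof -
    have "inner_pi (F j) \<phi> - inner_pi f \<phi> = (LINT x|leb_pi. (F j x - f x) * cnj (\<phi> x))"
      unfolding inner_pi_def using Bochner_Integration.integral_diff[OF m[OF Fi[of j]] m[OF f]]
      by (simp add: left_diff_distrib)
    also have "norm \<dots> \<le> (LINT x|leb_pi. norm ((F j x - f x) * cnj (\<phi> x)))"
      by (rule integral_norm_bound)
    also have "\<dots> \<le> (LINT x|leb_pi. B * norm (F j x - f x))"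
    proof (rule integral_mono)
      show "integrable leb_pi (\<lambda>x. norm ((F j x - f x) * cnj (\<phi> x)))" using m[OF d[of j]] by (rule integrable_norm)
      show "integrable leb_pi (\<lambda>x. B * norm (F j x - f x))" using d[of j] by simp
      show "norm ((F j x - f x) * cnj (\<phi> x)) \<le> B * norm (F j x - f x)" if "x \<in> space leb_pi" for x
        using mult_right_mono[OF \<phi>(2), of x "norm (F j x - f x)"] that by (simp add: norm_mult mult.commute)
    qed
    finally show ?thesis by simp
  qed
  have lim: "(\<lambda>j. B * (LINT x|leb_pi. norm (F j x - f x))) \<longlonglongrightarrow> 0"
    using tendsto_mult[OF tendsto_const Lp_tendsto_imp_L1[OF p F], of B] by simp
  have "(\<lambda>j. inner_pi (F j) \<phi> - inner_pi f \<phi>) \<longlonglongrightarrow> 0"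
    by (rule Lim_null_comparison[OF always_eventually lim]) (rule allI, rule le)
  then show ?thesis by (rule LIM_zero_cancel)
qed

section \<open>The symmetrized Jacobi system\<close>

lemma jacobi_Psi_even [simp]: "jacobi_Psi \<alpha> \<beta> (- \<theta>) = jacobi_Psi \<alpha> \<beta> \<theta>"
  by (simp add: jacobi_Psi_def)

lemma cos_half_pos: "-pi < \<theta> \<Longrightarrow> \<theta> < pi \<Longrightarrow> 0 < cos (\<theta> / 2)"
  by (rule cos_gt_zero_pi) auto

lemma sin_half_pos: "0 < \<theta> \<Longrightarrow> \<theta> < pi \<Longrightarrow> 0 < sin (\<theta> / 2)"
  by (rule sin_gt_zero) auto

lemma sin_half_neg: "-pi < \<theta> \<Longrightarrow> \<theta> < 0 \<Longrightarrow> sin (\<theta> / 2) < 0"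
  using sin_half_pos[of "- \<theta>"] by simp

lemma jacobi_Psi_pos: "-pi < \<theta> \<Longrightarrow> \<theta> < pi \<Longrightarrow> \<theta> \<noteq> 0 \<Longrightarrow> 0 < jacobi_Psi \<alpha> \<beta> \<theta>"
  using cos_half_pos[of \<theta>] sin_half_pos[of \<theta>] sin_half_neg[of \<theta>]
  by (cases "0 < \<theta>") (auto simp: jacobi_Psi_def)

lemma jacobi_Psi_nonneg: "0 \<le> jacobi_Psi \<alpha> \<beta> \<theta>"
  by (simp add: jacobi_Psi_def)

text \<open>For 0 < theta < pi the extra factor is the modulus of the derivative of y =
  cos^2(theta/2); it turns pairings with 1 / Psi into integrals dy.\<close>

lemma jacobi_Psi_shift:
  assumes "-pi < \<theta>" "\<theta> < pi"
  shows "jacobi_Psi (\<alpha> + 1) (\<beta> + 1) \<theta> = \<bar>sin (\<theta> / 2)\<bar> * cos (\<theta> / 2) * jacobi_Psi \<alpha> \<beta> \<theta>"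
proof -
  have "x powr (r + 1 + 1 / 2) = x * x powr (r + 1 / 2)" if "0 \<le> x" for x r :: real
    using that by (simp add: powr_mult_base add_ac)
  then show ?thesis using cos_half_pos[OF assms] by (simp add: jacobi_Psi_def)
qed

lemma jacobi_Psi_le_1:
  assumes "-pi < \<theta>" "\<theta> < pi" "-1/2 \<le> a" "-1/2 \<le> b"
  shows "jacobi_Psi a b \<theta> \<le> 1"
  using assms cos_half_pos[OF assms(1,2)] unfolding jacobi_Psi_def
  by (intro mult_le_one powr_le1) auto

lemma jacobi_Psi_measurable [measurable]: "jacobi_Psi a b \<in> borel_measurable borel"
  unfolding jacobi_Psi_def by measurable

lemma continuous_on_jacobi_P [continuous_intros]:
  "continuous_on S f \<Longrightarrow> continuous_on S (\<lambda>x. jacobi_P a b n (f x))"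
  unfolding jacobi_P_def by (intro continuous_intros) auto

lemma jacobi_P_cos_measurable [measurable]: "(\<lambda>\<theta>. jacobi_P a b n (cos \<theta>)) \<in> borel_measurable borel"
  by (intro borel_measurable_continuous_onI continuous_intros)

lemma jacobi_P_cos_bounded: "\<exists>B. \<forall>\<theta>. \<bar>jacobi_P a b n (cos \<theta>)\<bar> \<le> B"
proof -
  have "compact (jacobi_P a b n ` {-1..1})"
    by (intro compact_continuous_image continuous_intros) auto
  then obtain B where "\<And>x. x \<in> {-1..1} \<Longrightarrow> \<bar>jacobi_P a b n x\<bar> \<le> B"
    using compact_imp_bounded by (fastforce simp: bounded_iff)
  then show ?thesis by (intro exI[of _ B]) auto
qed

lemma jacobi_P_cos: "jacobi_P a b n (cos \<theta>) = poly (jacobi_poly a b n) ((cos (\<theta> / 2))\<^sup>2)"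
  using cos_double_cos[of "\<theta> / 2"] by (simp add: poly_jacobi_poly)

section \<open>Integrability of powers of the weight\<close>

lemma has_integral_Ioo_of_antiderivative:
  fixes G g :: "real \<Rightarrow> real"
  assumes "continuous_on {0..pi} G" "\<And>x. 0 < x \<Longrightarrow> x < pi \<Longrightarrow> (G has_real_derivative g x) (at x)"
  shows "(g has_integral (G pi - G 0)) {0<..<pi}"
proof -
  have "(g has_integral (G pi - G 0)) {0..pi}"
    using assms by (intro fundamental_theorem_of_calculus_interior)
      (auto simp flip: has_real_derivative_iff_has_vector_derivative)
  then show ?thesis by (simp add: has_integral_Icc_iff_Ioo)
qed

text \<open>sin^u cos and cos^v sin have antiderivatives that are continuous up to the ends for u, v
  > -1. By sin^2 + cos^2 = 1 one of sin and cos is at least 1/2, and there its power is bounded by a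
  multiple of its first power; so a combination of the two is a majorant.\<close>

lemma integrable_sin_cos_powr:
  assumes "-1 < u" "-1 < v"
  shows "integrable leb_pi (\<lambda>\<theta>. \<bar>sin (\<theta> / 2)\<bar> powr u * cos (\<theta> / 2) powr v)"
proof (rule leb_pi_even(1))
  have *: "integrable (lebesgue_on {0<..<pi}) (\<lambda>\<theta>. sin (\<theta> / 2) powr u * cos (\<theta> / 2))"
    if "-1 < u" for u :: real
  proof -
    have "((\<lambda>\<theta>. sin (\<theta> / 2) powr u * cos (\<theta> / 2)) has_integral
      (2 / (u + 1) * sin (pi / 2) powr (u + 1) - 2 / (u + 1) * sin (0 / 2) powr (u + 1))) {0<..<pi}"
    proof (rule has_integral_Ioo_of_antiderivative)
      show "continuous_on {0..pi} (\<lambda>\<theta>. 2 / (u + 1) * sin (\<theta> / 2) powr (u + 1))"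
        using that by (intro continuous_intros continuous_on_powr') (auto intro: sin_ge_zero)
      show "((\<lambda>\<theta>. 2 / (u + 1) * sin (\<theta> / 2) powr (u + 1)) has_real_derivative sin (x / 2) powr u * cos (x / 2)) (at x)"
        if "0 < x" "x < pi" for x
      proof -
        have "((\<lambda>\<theta>. sin (\<theta> / 2) powr (u + 1)) has_real_derivative (u + 1) * (sin (x / 2) powr u * (cos (x / 2) / 2))) (at x)"
          using sin_half_pos[OF that] by (auto intro!: derivative_eq_intros)
        from DERIV_cmult[OF this, of "2 / (u + 1)"] show ?thesis using \<open>-1 < u\<close> by simp
      qed
    qed
    then have "(\<lambda>\<theta>. sin (\<theta> / 2) powr u * cos (\<theta> / 2)) absolutely_integrable_on {0<..<pi}"
      using cos_half_pos by (intro nonnegative_absolutely_integrable_1) (auto simp: less_imp_le)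
    then show ?thesis by (rule absolutely_integrable_imp_integrable) simp
  qed
  have **: "integrable (lebesgue_on {0<..<pi}) (\<lambda>\<theta>. cos (\<theta> / 2) powr v * sin (\<theta> / 2))"
    if "-1 < v" for v :: real
  proof -
    have "((\<lambda>\<theta>. cos (\<theta> / 2) powr v * sin (\<theta> / 2)) has_integral
      (- 2 / (v + 1) * cos (pi / 2) powr (v + 1) - (- 2 / (v + 1)) * cos (0 / 2) powr (v + 1))) {0<..<pi}"
    proof (rule has_integral_Ioo_of_antiderivative)
      show "continuous_on {0..pi} (\<lambda>\<theta>. - 2 / (v + 1) * cos (\<theta> / 2) powr (v + 1))"
        using that by (intro continuous_intros continuous_on_powr') (auto intro: cos_ge_zero)
      show "((\<lambda>\<theta>. - 2 / (v + 1) * cos (\<theta> / 2) powr (v + 1)) has_real_derivative cos (x / 2) powr v * sin (x / 2)) (at x)"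
        if "0 < x" "x < pi" for x
      proof -
        have "((\<lambda>\<theta>. cos (\<theta> / 2) powr (v + 1)) has_real_derivative (v + 1) * (cos (x / 2) powr v * (- (sin (x / 2) / 2)))) (at x)"
          using cos_half_pos[of x] that by (auto intro!: derivative_eq_intros)
        from DERIV_cmult[OF this, of "- 2 / (v + 1)"] show ?thesis using \<open>-1 < v\<close> by simp
      qed
    qed
    then have "(\<lambda>\<theta>. cos (\<theta> / 2) powr v * sin (\<theta> / 2)) absolutely_integrable_on {0<..<pi}"
      using sin_half_pos by (intro nonnegative_absolutely_integrable_1) (auto simp: less_imp_le)
    then show ?thesis by (rule absolutely_integrable_imp_integrable) simp
  qed
  \<comment> \<open>The constant covers both signs of w - 1: the power t^(w-1) is at most 1 if w
    \<ge> 1, and at most its value at 1/2 otherwise.\<close>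
  have powr_bound: "t powr w \<le> (1 + (1 / 2) powr (w - 1)) * t" if "1 / 2 \<le> t" "t \<le> 1" for t w :: real
  proof -
    have "t powr (w - 1) \<le> 1 + (1 / 2) powr (w - 1)"
    proof (cases "1 \<le> w")
      case True
      then have "t powr (w - 1) \<le> 1" using that by (intro powr_le1) auto
      then show ?thesis by (simp add: add_increasing2)
    next
      case False
      then have "t powr (w - 1) \<le> (1 / 2) powr (w - 1)" using that by (intro powr_mono2') auto
      then show ?thesis by simp
    qed
    then have "t powr (w - 1) * t \<le> (1 + (1 / 2) powr (w - 1)) * t" using that by (intro mult_right_mono) auto
    moreover have "t powr (w - 1) * t = t powr w" using that by (simp add: powr_diff)
    ultimately show ?thesis by simp
  qed
  show "integrable (lebesgue_on {0<..<pi}) (\<lambda>\<theta>. \<bar>sin (\<theta> / 2)\<bar> powr u * cos (\<theta> / 2) powr v)"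
  proof (rule integrable_lebesgue_on_bound)
    show "integrable (lebesgue_on {0<..<pi})
      (\<lambda>\<theta>. (1 + (1 / 2) powr (v - 1)) * (sin (\<theta> / 2) powr u * cos (\<theta> / 2))
         + (1 + (1 / 2) powr (u - 1)) * (cos (\<theta> / 2) powr v * sin (\<theta> / 2)))"
      using *[OF assms(1)] **[OF assms(2)] by simp
    show "(\<lambda>\<theta>. \<bar>sin (\<theta> / 2)\<bar> powr u * cos (\<theta> / 2) powr v) \<in> borel_measurable (lebesgue_on {0<..<pi})"
      by (rule measurable_lebesgue_on) measurable
    fix x :: real assume x: "x \<in> {0<..<pi}"
    define s c where "s = sin (x / 2)" and "c = cos (x / 2)"
    have sc: "0 < s" "0 < c" "s \<le> 1" "c \<le> 1" "s\<^sup>2 + c\<^sup>2 = 1"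
      using sin_half_pos[of x] cos_half_pos[of x] x by (auto simp: s_def c_def)
    have "s powr u * c powr v \<le> (1 + (1 / 2) powr (v - 1)) * (s powr u * c)
         + (1 + (1 / 2) powr (u - 1)) * (c powr v * s)"
    proof (cases "1 / 2 \<le> c")
      case True
      have "s powr u * c powr v \<le> s powr u * ((1 + (1 / 2) powr (v - 1)) * c)"
        using powr_bound[OF True sc(4)] by (intro mult_left_mono) auto
      moreover have "0 \<le> (1 + (1 / 2) powr (u - 1)) * (c powr v * s)" using sc by (intro mult_nonneg_nonneg) auto
      ultimately show ?thesis by (simp add: mult_ac)
    next
      case False
      have "1 / 2 \<le> s"
      proof (rule ccontr)
        assume "\<not> 1 / 2 \<le> s"
        then have "s\<^sup>2 < (1/2)\<^sup>2" "c\<^sup>2 < (1/2)\<^sup>2" using False sc by (auto intro!: power_strict_mono)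
        then show False using sc(5) by (simp add: power2_eq_square)
      qed
      then have "c powr v * s powr u \<le> c powr v * ((1 + (1 / 2) powr (u - 1)) * s)"
        using powr_bound[OF _ sc(3)] by (intro mult_left_mono) auto
      moreover have "0 \<le> (1 + (1 / 2) powr (v - 1)) * (s powr u * c)" using sc by (intro mult_nonneg_nonneg) auto
      ultimately show ?thesis by (simp add: mult_ac)
    qed
    then show "norm (\<bar>sin (x / 2)\<bar> powr u * cos (x / 2) powr v) \<le> (1 + (1 / 2) powr (v - 1)) * (sin (x / 2) powr u * cos (x / 2))
         + (1 + (1 / 2) powr (u - 1)) * (cos (x / 2) powr v * sin (x / 2))"
      using sc by (simp add: s_def c_def)
  qed
qed simp

lemma integrable_jacobi_Psi_powr:
  assumes "-1 < (\<alpha> + 1/2) * q" "-1 < (\<beta> + 1/2) * q"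
  shows "integrable leb_pi (\<lambda>\<theta>. jacobi_Psi \<alpha> \<beta> \<theta> powr q)"
proof -
  have "jacobi_Psi \<alpha> \<beta> \<theta> powr q = \<bar>sin (\<theta> / 2)\<bar> powr ((\<alpha> + 1/2) * q) * cos (\<theta> / 2) powr ((\<beta> + 1/2) * q)" for \<theta>
    by (simp add: jacobi_Psi_def powr_mult powr_powr)
  then show ?thesis using integrable_sin_cos_powr[OF assms] by simp
qed

text \<open>The odd-index eigenfunction without \<open>sgn\<close> and without normalisation; as a
  function of theta it is even. It is used with the raised parameters \<alpha> + 1 and \<beta> +
  1.\<close>

definition odd_jacobi :: "real \<Rightarrow> real \<Rightarrow> nat \<Rightarrow> real \<Rightarrow> real" where
  "odd_jacobi a b n \<theta> = jacobi_Psi a b \<theta> * jacobi_P a b n (cos \<theta>)"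

lemma odd_jacobi_measurable [measurable]: "odd_jacobi a b n \<in> borel_measurable borel"
  unfolding odd_jacobi_def by measurable

lemma odd_jacobi_bounded:
  assumes "-1/2 \<le> a" "-1/2 \<le> b"
  obtains B where "0 \<le> B" "\<And>\<theta>. -pi < \<theta> \<Longrightarrow> \<theta> < pi \<Longrightarrow> \<bar>odd_jacobi a b n \<theta>\<bar> \<le> B"
proof -
  obtain B where B: "\<And>\<theta>. \<bar>jacobi_P a b n (cos \<theta>)\<bar> \<le> B" using jacobi_P_cos_bounded by blast
  have "\<bar>odd_jacobi a b n \<theta>\<bar> \<le> 1 * B" if "-pi < \<theta>" "\<theta> < pi" for \<theta>
    unfolding odd_jacobi_def abs_mult
    using B[of \<theta>] jacobi_Psi_le_1[OF that assms] jacobi_Psi_nonneg[of a b \<theta>] by (intro mult_mono) auto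
  moreover have "0 \<le> B" using B[of 0] by (meson abs_ge_zero order_trans)
  ultimately show ?thesis using that by simp
qed

lemma odd_jacobi_integrable:
  assumes "-1/2 \<le> a" "-1/2 \<le> b"
  shows "integrable (lebesgue_on {0<..<pi}) (\<lambda>\<theta>. odd_jacobi a b n \<theta> * odd_jacobi a b m \<theta>)"
proof -
  obtain B where B: "0 \<le> B" "\<And>\<theta>. -pi < \<theta> \<Longrightarrow> \<theta> < pi \<Longrightarrow> \<bar>odd_jacobi a b n \<theta>\<bar> \<le> B"
    using odd_jacobi_bounded[OF assms] by blast
  obtain C where C: "0 \<le> C" "\<And>\<theta>. -pi < \<theta> \<Longrightarrow> \<theta> < pi \<Longrightarrow> \<bar>odd_jacobi a b m \<theta>\<bar> \<le> C"
    using odd_jacobi_bounded[OF assms] by blast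
  show ?thesis
  proof (rule integrable_lebesgue_on_bound)
    show "integrable (lebesgue_on {0<..<pi}) (\<lambda>_. B * C)"
      by (rule finite_measure.integrable_const) (rule finite_measureI, simp add: emeasure_restrict_space)
    show "(\<lambda>\<theta>. odd_jacobi a b n \<theta> * odd_jacobi a b m \<theta>) \<in> borel_measurable (lebesgue_on {0<..<pi})"
      by (rule measurable_lebesgue_on) measurable
    show "norm (odd_jacobi a b n x * odd_jacobi a b m x) \<le> B * C" if "x \<in> {0<..<pi}" for x
      using B C that by (auto simp: abs_mult intro!: mult_mono)
  qed
qed

text \<open>The Wronskian of two Jacobi polynomials, times the weight, is an antiderivative.\<close>

lemma odd_jacobi_orthogonal:
  assumes "0 < a" "0 < b" "n \<noteq> m"
  shows "(LINT \<theta>|lebesgue_on {0<..<pi}. odd_jacobi a b n \<theta> * odd_jacobi a b m \<theta>) = 0"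
proof -
  define p q where "p = jacobi_poly a b n" and "q = jacobi_poly a b m"
  define V where "V = pderiv p * q - p * pderiv q"
  \<comment> \<open>In the variable y this is (1-y)^(a+1) y^(b+1) times the Wronskian; the positive
    exponents make it vanish at 0 and at pi.\<close>
  define G where "G \<theta> = (sin (\<theta> / 2) powr (2 * a + 2) * cos (\<theta> / 2) powr (2 * b + 2)) * poly V ((cos (\<theta> / 2))\<^sup>2)" for \<theta>
  have "((\<lambda>\<theta>. (jeig a b n - jeig a b m) * (odd_jacobi a b n \<theta> * odd_jacobi a b m \<theta>)) has_integral (G pi - G 0)) {0<..<pi}"
  proof (rule has_integral_Ioo_of_antiderivative)
    show "continuous_on {0..pi} G"
      unfolding G_def using assms
      by (intro continuous_intros continuous_on_powr') (auto intro: sin_ge_zero cos_ge_zero)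
    fix x assume x: "0 < x" "x < pi"
    define s c y where "s = sin (x / 2)" and "c = cos (x / 2)" and "y = c\<^sup>2"
    have sc: "0 < s" "0 < c" using sin_half_pos[OF x] cos_half_pos[of x] x by (simp_all add: s_def c_def)
    have s2: "s\<^sup>2 = 1 - y" by (simp add: y_def s_def c_def sin_squared_eq)
    have e: "(s powr (2 * a + 2)) = s powr (2 * a + 1) * s" "(c powr (2 * b + 2)) = c powr (2 * b + 1) * c"
      using sc powr_add[of s "2 * a + 1" 1] powr_add[of c "2 * b + 1" 1] by (simp_all add: add_ac)
    have dS: "((\<lambda>\<theta>. sin (\<theta> / 2) powr (2 * a + 2)) has_real_derivative (a + 1) * s powr (2 * a + 1) * c) (at x)"
      using sc by (auto intro!: derivative_eq_intros simp: s_def c_def algebra_simps)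
    have dC: "((\<lambda>\<theta>. cos (\<theta> / 2) powr (2 * b + 2)) has_real_derivative - ((b + 1) * c powr (2 * b + 1) * s)) (at x)"
      using sc by (auto intro!: derivative_eq_intros simp: s_def c_def algebra_simps)
    have dV: "((\<lambda>\<theta>. poly V ((cos (\<theta> / 2))\<^sup>2)) has_real_derivative poly (pderiv V) y * (- (s * c))) (at x)"
      unfolding y_def c_def
      by (rule DERIV_chain2[OF poly_DERIV]) (auto intro!: derivative_eq_intros simp: s_def)
    have jp: "poly (jop a b p) y = jeig a b n * poly p y" "poly (jop a b q) y = jeig a b m * poly q y"
      by (simp_all add: p_def q_def jop_jacobi_poly)
    \<comment> \<open>Lagrange's identity for the self-adjoint form of \<open>jop\<close>, divided
      by the weight.\<close>
    have W: "(a + 1) * y * poly V y - (b + 1) * (1 - y) * poly V y - (1 - y) * y * poly (pderiv V) y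
        = (jeig a b n - jeig a b m) * (poly p y * poly q y)"
    proof -
      have "(a + 1) * y * poly V y - (b + 1) * (1 - y) * poly V y - (1 - y) * y * poly (pderiv V) y
        = poly (jop a b p) y * poly q y - poly p y * poly (jop a b q) y"
        unfolding jop_def V_def pderiv_diff pderiv_mult poly_diff poly_add poly_mult
        by (simp add: algebra_simps)
      then show ?thesis unfolding jp by (simp add: algebra_simps)
    qed
    have "(G has_real_derivative
       (s powr (2 * a + 2) * c powr (2 * b + 2)) * (poly (pderiv V) y * (- (s * c)))
       + (s powr (2 * a + 2) * (- ((b + 1) * c powr (2 * b + 1) * s)) + (a + 1) * s powr (2 * a + 1) * c * c powr (2 * b + 2)) * poly V y) (at x)"
      unfolding G_def s_def c_def y_def
      using DERIV_mult'[OF DERIV_mult'[OF dS dC] dV] by (simp add: s_def c_def y_def)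
    also have "(s powr (2 * a + 2) * c powr (2 * b + 2)) * (poly (pderiv V) y * (- (s * c)))
       + (s powr (2 * a + 2) * (- ((b + 1) * c powr (2 * b + 1) * s)) + (a + 1) * s powr (2 * a + 1) * c * c powr (2 * b + 2)) * poly V y
       = s powr (2 * a + 1) * c powr (2 * b + 1) * ((a + 1) * c\<^sup>2 * poly V y - (b + 1) * s\<^sup>2 * poly V y - s\<^sup>2 * c\<^sup>2 * poly (pderiv V) y)"
      unfolding e by algebra
    also have "\<dots> = (jeig a b n - jeig a b m) * (odd_jacobi a b n x * odd_jacobi a b m x)"
    proof -
      have "jacobi_Psi a b x * jacobi_Psi a b x = s powr (2 * a + 1) * c powr (2 * b + 1)"
      proof -
        have "s powr (a + 1 / 2) * s powr (a + 1 / 2) = s powr (2 * a + 1)"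
          "c powr (b + 1 / 2) * c powr (b + 1 / 2) = c powr (2 * b + 1)"
          by (simp_all flip: powr_add)
        then show ?thesis using sc unfolding jacobi_Psi_def s_def[symmetric] c_def[symmetric]
          by (simp add: mult_ac)
      qed
      moreover have "jacobi_P a b n (cos x) = poly p y" "jacobi_P a b m (cos x) = poly q y"
        by (simp_all add: jacobi_P_cos p_def q_def y_def c_def)
      ultimately have "odd_jacobi a b n x * odd_jacobi a b m x
         = (s powr (2 * a + 1) * c powr (2 * b + 1)) * (poly p y * poly q y)"
        unfolding odd_jacobi_def by (metis mult.assoc mult.left_commute)
      then show ?thesis unfolding s2 y_def[symmetric] W by (simp only: mult_ac)
    qed
    finally show "(G has_real_derivative (jeig a b n - jeig a b m) * (odd_jacobi a b n x * odd_jacobi a b m x)) (at x)" .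
  qed
  moreover have "G pi = 0" "G 0 = 0" using assms by (simp_all add: G_def)
  ultimately have 0: "((\<lambda>\<theta>. (jeig a b n - jeig a b m) * (odd_jacobi a b n \<theta> * odd_jacobi a b m \<theta>)) has_integral 0) {0<..<pi}"
    by simp
  have "integrable (lebesgue_on {0<..<pi}) (\<lambda>\<theta>. odd_jacobi a b n \<theta> * odd_jacobi a b m \<theta>)"
    using assms by (intro odd_jacobi_integrable) auto
  from has_integral_unique[OF has_integral_mult_right[OF has_integral_integral_lebesgue_on[OF this]] 0]
  have "(jeig a b n - jeig a b m) * (LINT \<theta>|lebesgue_on {0<..<pi}. odd_jacobi a b n \<theta> * odd_jacobi a b m \<theta>) = 0"
    by simp
  moreover have "jeig a b n \<noteq> jeig a b m"
    using jeig_strict_mono[OF assms(1,2), of n m] jeig_strict_mono[OF assms(1,2), of m n] assms(3)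
    by (cases "n < m") auto
  ultimately show ?thesis by simp
qed

text \<open>At theta = 0 the polynomial factor is a positive binomial coefficient, so the function
  has no zero on some interval (0, e), a set of positive measure. Thus \<open>jacobi_c\<close> is a
  genuine normalisation and not the default 1 / 0 = 0.\<close>

lemma odd_jacobi_norm_pos:
  assumes "0 < a" "0 < b"
  shows "0 < (LINT \<theta>|lebesgue_on {0<..<pi}. (odd_jacobi a b n \<theta>)\<^sup>2)"
proof -
  let ?M = "lebesgue_on {0<..<pi}"
  have i: "integrable ?M (\<lambda>\<theta>. (odd_jacobi a b n \<theta>)\<^sup>2)"
    using odd_jacobi_integrable[of a b n n] assms by (simp add: power2_eq_square)
  have nn: "0 \<le> (LINT \<theta>|?M. (odd_jacobi a b n \<theta>)\<^sup>2)"
    by (rule Bochner_Integration.integral_nonneg) simp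
  have "(LINT \<theta>|?M. (odd_jacobi a b n \<theta>)\<^sup>2) \<noteq> 0"
  proof
    assume "(LINT \<theta>|?M. (odd_jacobi a b n \<theta>)\<^sup>2) = 0"
    then have "AE \<theta> in ?M. (odd_jacobi a b n \<theta>)\<^sup>2 = 0"
      using integral_nonneg_eq_0_iff_AE[OF i] by simp
    then have AE: "AE \<theta> in lebesgue. \<theta> \<in> {0<..<pi} \<longrightarrow> odd_jacobi a b n \<theta> = 0"
      by (subst (asm) AE_restrict_space_iff) auto
    have "0 < jacobi_P a b n (cos 0)"
      using gbinomial_pos[of n "real n + a"] assms poly_jacobi_poly_1[of a b n] jacobi_P_cos[of a b n 0] by simp
    moreover have "isCont (\<lambda>\<theta>. jacobi_P a b n (cos \<theta>)) 0"
      using continuous_on_jacobi_P[of UNIV cos a b n] by (simp add: continuous_on_eq_continuous_at continuous_on_cos)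
    ultimately have "\<forall>\<^sub>F \<theta> in at 0. 0 < jacobi_P a b n (cos \<theta>)"
      unfolding isCont_def by (rule order_tendstoD(1)[rotated])
    then obtain d where d: "0 < d" "\<And>\<theta>. \<theta> \<noteq> 0 \<Longrightarrow> dist \<theta> 0 < d \<Longrightarrow> 0 < jacobi_P a b n (cos \<theta>)"
      by (auto simp: eventually_at)
    define e where "e = min d pi"
    have e: "0 < e" using d by (simp add: e_def)
    have "odd_jacobi a b n \<theta> \<noteq> 0" if "\<theta> \<in> {0<..<e}" for \<theta>
      using d(2)[of \<theta>] jacobi_Psi_pos[of \<theta> a b] that by (auto simp: odd_jacobi_def e_def dist_real_def)
    with AE have "AE \<theta> in lebesgue. \<theta> \<notin> {0<..<e}"
      by (auto elim!: eventually_mono simp: e_def)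
    then have "{0<..<e} \<in> null_sets lebesgue" by (subst AE_iff_null_sets) auto
    then show False using e by (simp add: null_sets_def)
  qed
  then show ?thesis using nn by linarith
qed

lemma jacobi_c_pos:
  assumes "0 < a" "0 < b"
  shows "0 < jacobi_c a b m" "(jacobi_c a b m)\<^sup>2 * (LINT \<theta>|lebesgue_on {0<..<pi}. (odd_jacobi a b m \<theta>)\<^sup>2) = 1"
  using odd_jacobi_norm_pos[OF assms, of m]
  by (simp_all add: jacobi_c_def odd_jacobi_def power_divide)

lemma jacobi_Phi_odd_index:
  "jacobi_Phi \<alpha> \<beta> (2 * m + 1) \<theta> =
     of_real (jacobi_c (\<alpha> + 1) (\<beta> + 1) m / sqrt 2 * (sgn \<theta> * odd_jacobi (\<alpha> + 1) (\<beta> + 1) m \<theta>))"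
  by (simp add: jacobi_Phi_def jacobi_phi_def odd_jacobi_def)

lemma jacobi_Phi_measurable: "jacobi_Phi \<alpha> \<beta> n \<in> borel_measurable (lebesgue_on S)"
proof (rule measurable_lebesgue_on)
  show "jacobi_Phi \<alpha> \<beta> n \<in> borel_measurable borel"
    unfolding jacobi_Phi_def jacobi_phi_def by (cases "even n") (simp_all, measurable)
qed

text \<open>The raised parameters are positive, and so are the exponents of the weight, even where
  \<alpha> or \<beta> lies below -1/2.\<close>

lemma jacobi_Phi_odd_index_bounded:
  assumes "-1 < \<alpha>" "-1 < \<beta>"
  obtains B where "\<And>\<theta>. -pi < \<theta> \<Longrightarrow> \<theta> < pi \<Longrightarrow> norm (jacobi_Phi \<alpha> \<beta> (2 * m + 1) \<theta>) \<le> B"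
proof -
  obtain B where B: "0 \<le> B" "\<And>\<theta>. -pi < \<theta> \<Longrightarrow> \<theta> < pi \<Longrightarrow> \<bar>odd_jacobi (\<alpha> + 1) (\<beta> + 1) m \<theta>\<bar> \<le> B"
    by (rule odd_jacobi_bounded[of "\<alpha> + 1" "\<beta> + 1" m]) (use assms in auto)
  define c where "c = jacobi_c (\<alpha> + 1) (\<beta> + 1) m / sqrt 2"
  have "norm (jacobi_Phi \<alpha> \<beta> (2 * m + 1) \<theta>) \<le> \<bar>c\<bar> * (1 * B)" if "-pi < \<theta>" "\<theta> < pi" for \<theta>
    unfolding jacobi_Phi_odd_index c_def[symmetric] norm_of_real abs_mult
    using B(2)[OF that] by (intro mult_mono) (auto simp: abs_sgn_eq)
  then show ?thesis by (rule that)
qed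

text \<open>These functions may be unbounded when a parameter is below -1/2, but integrability is
  enough for pairing the partial sums, term by term, with a bounded eigenfunction.\<close>

lemma jacobi_Phi_even_index_integrable:
  assumes "-1 < \<alpha>" "-1 < \<beta>"
  shows "integrable leb_pi (jacobi_Phi \<alpha> \<beta> (2 * m))"
proof -
  obtain B where B: "\<And>\<theta>. \<bar>jacobi_P \<alpha> \<beta> m (cos \<theta>)\<bar> \<le> B" using jacobi_P_cos_bounded by blast
  define c where "c = \<bar>jacobi_c \<alpha> \<beta> m / sqrt 2\<bar>"
  show ?thesis
  proof (rule integrable_lebesgue_on_bound[OF _ jacobi_Phi_measurable])
    show "integrable leb_pi (\<lambda>\<theta>. c * B * jacobi_Psi \<alpha> \<beta> \<theta> powr 1)"
      using assms by (intro integrable_mult_right integrable_jacobi_Psi_powr) auto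
    fix x :: real assume "x \<in> {-pi<..<pi}"
    have "norm (jacobi_Phi \<alpha> \<beta> (2 * m) x) = c * (jacobi_Psi \<alpha> \<beta> x * \<bar>jacobi_P \<alpha> \<beta> m (cos x)\<bar>)"
      using jacobi_Psi_nonneg[of \<alpha> \<beta> x]
      by (simp add: jacobi_Phi_def jacobi_phi_def c_def abs_mult norm_divide norm_mult)
    also have "\<dots> \<le> c * (jacobi_Psi \<alpha> \<beta> x * B)"
      using B[of x] jacobi_Psi_nonneg[of \<alpha> \<beta> x] by (intro mult_left_mono) (auto simp: c_def)
    finally show "norm (jacobi_Phi \<alpha> \<beta> (2 * m) x) \<le> c * B * jacobi_Psi \<alpha> \<beta> x powr 1"
      using jacobi_Psi_nonneg[of \<alpha> \<beta> x] by (simp add: mult_ac)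
  qed
qed

lemma jacobi_Phi_integrable:
  assumes "-1 < \<alpha>" "-1 < \<beta>"
  shows "integrable leb_pi (jacobi_Phi \<alpha> \<beta> n)"
proof (cases "even n")
  case True
  then show ?thesis using jacobi_Phi_even_index_integrable[OF assms] by (auto elim: evenE)
next
  case False
  then obtain m where n: "n = 2 * m + 1" by (auto elim: oddE)
  obtain B where "\<And>\<theta>. -pi < \<theta> \<Longrightarrow> \<theta> < pi \<Longrightarrow> norm (jacobi_Phi \<alpha> \<beta> (2 * m + 1) \<theta>) \<le> B"
    using jacobi_Phi_odd_index_bounded[OF assms] by blast
  then show ?thesis unfolding n by (intro integrable_leb_pi_bounded jacobi_Phi_measurable)
qed

lemma cnj_jacobi_Phi [simp]: "cnj (jacobi_Phi \<alpha> \<beta> n \<theta>) = jacobi_Phi \<alpha> \<beta> n \<theta>"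
  by (simp add: jacobi_Phi_def)

lemma odd_jacobi_even [simp]: "odd_jacobi a b m (- \<theta>) = odd_jacobi a b m \<theta>"
  by (simp add: odd_jacobi_def)

text \<open>For even n the integrand is odd. For odd n the integral is twice the one over (0, pi),
  and this 2 cancels the product of the two factors 1 / sqrt 2.\<close>

lemma inner_pi_jacobi_Phi:
  assumes "-1 < \<alpha>" "-1 < \<beta>"
  shows "inner_pi (jacobi_Phi \<alpha> \<beta> n) (jacobi_Phi \<alpha> \<beta> (2 * m + 1)) = (if n = 2 * m + 1 then 1 else 0)"
proof (cases "even n")
  case True
  have "inner_pi (jacobi_Phi \<alpha> \<beta> n) (jacobi_Phi \<alpha> \<beta> (2 * m + 1)) = 0"
    unfolding inner_pi_def
  proof (rule leb_pi_odd)
    show "jacobi_Phi \<alpha> \<beta> n (- x) * cnj (jacobi_Phi \<alpha> \<beta> (2 * m + 1) (- x)) =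
      - (jacobi_Phi \<alpha> \<beta> n x * cnj (jacobi_Phi \<alpha> \<beta> (2 * m + 1) x))" for x
      using True unfolding jacobi_Phi_odd_index
      by (simp add: jacobi_Phi_def jacobi_phi_def sgn_minus)
  qed
  then show ?thesis using True by auto
next
  case False
  then obtain k where n: "n = 2 * k + 1" by (auto elim: oddE)
  define a b where "a = \<alpha> + 1" and "b = \<beta> + 1"
  have ab: "0 < a" "0 < b" using assms by (simp_all add: a_def b_def)
  let ?M = "lebesgue_on {0<..<pi}"
  define c where "c = jacobi_c a b k / sqrt 2 * (jacobi_c a b m / sqrt 2)"
  have c: "c = jacobi_c a b k * jacobi_c a b m / 2" by (simp add: c_def)
  let ?f = "\<lambda>\<theta>. complex_of_real (c * ((sgn \<theta>)\<^sup>2 * (odd_jacobi a b k \<theta> * odd_jacobi a b m \<theta>)))"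
  have h: "integrable ?M (\<lambda>\<theta>. complex_of_real (c * (odd_jacobi a b k \<theta> * odd_jacobi a b m \<theta>)))"
    using ab by (intro integrable_of_real integrable_mult_right odd_jacobi_integrable) auto
  have eq: "?f \<theta> = complex_of_real (c * (odd_jacobi a b k \<theta> * odd_jacobi a b m \<theta>))" if "\<theta> \<in> space ?M" for \<theta>
    using that by simp
  have fi: "integrable ?M ?f"
    by (rule iffD2[OF Bochner_Integration.integrable_cong[OF refl eq] h])
  have "inner_pi (jacobi_Phi \<alpha> \<beta> n) (jacobi_Phi \<alpha> \<beta> (2 * m + 1)) = (LINT \<theta>|leb_pi. ?f \<theta>)"
    unfolding inner_pi_def n jacobi_Phi_odd_index a_def[symmetric] b_def[symmetric] complex_cnj_complex_of_real
    by (simp only: c_def of_real_mult power2_eq_square mult_ac)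
  also have "\<dots> = 2 *\<^sub>R (LINT \<theta>|?M. ?f \<theta>)"
    by (rule leb_pi_even(2)[OF _ fi]) (simp add: sgn_minus)
  also have "(LINT \<theta>|?M. ?f \<theta>) = (LINT \<theta>|?M. complex_of_real (c * (odd_jacobi a b k \<theta> * odd_jacobi a b m \<theta>)))"
    by (rule Bochner_Integration.integral_cong[OF refl eq])
  also have "\<dots> = complex_of_real (c * (LINT \<theta>|?M. odd_jacobi a b k \<theta> * odd_jacobi a b m \<theta>))"
    by (simp only: integral_complex_of_real integral_mult_right_zero)
  also have "2 *\<^sub>R \<dots> = (if n = 2 * m + 1 then 1 else 0)"
  proof (cases "k = m")
    case True
    have "(jacobi_c a b m)\<^sup>2 * (LINT \<theta>|?M. odd_jacobi a b m \<theta> * odd_jacobi a b m \<theta>) = 1"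
      using jacobi_c_pos(2)[OF ab, of m] by (simp add: power2_eq_square)
    then have "2 * (c * (LINT \<theta>|?M. odd_jacobi a b k \<theta> * odd_jacobi a b m \<theta>)) = 1"
      unfolding c True by (simp add: power2_eq_square)
    then have "complex_of_real (2 * (c * (LINT \<theta>|?M. odd_jacobi a b k \<theta> * odd_jacobi a b m \<theta>))) = 1" by simp
    then show ?thesis using True n by (simp add: scaleR_conv_of_real)
  next
    case False
    then show ?thesis using odd_jacobi_orthogonal[OF ab False] n by simp
  qed
  finally show ?thesis .
qed

text \<open>The pairing of the N-th partial sum is constant once N exceeds the index, and it
  converges because the eigenfunction is bounded.\<close>

lemma inner_pi_spectral_op:
  assumes ab: "-1 < \<alpha>" "-1 < \<beta>" and T: "spectral_op \<alpha> \<beta> \<mu> f g"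
  shows "inner_pi g (jacobi_Phi \<alpha> \<beta> (2 * m + 1)) =
         of_real (\<mu> (2 * m + 1)) * inner_pi f (jacobi_Phi \<alpha> \<beta> (2 * m + 1))"
proof -
  define k where "k = 2 * m + 1"
  obtain B where B: "\<And>\<theta>. -pi < \<theta> \<Longrightarrow> \<theta> < pi \<Longrightarrow> norm (jacobi_Phi \<alpha> \<beta> k \<theta>) \<le> B"
    using jacobi_Phi_odd_index_bounded[OF ab] unfolding k_def by blast
  define t where "t n = of_real (\<mu> n) * inner_pi f (jacobi_Phi \<alpha> \<beta> n)" for n
  define S where "S N \<theta> = (\<Sum>n<N. t n * jacobi_Phi \<alpha> \<beta> n \<theta>)" for N \<theta>
  have gi: "integrable leb_pi g" using T by (intro Lp_integrable[of 2]) (auto simp: spectral_op_def)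
  have "Lp_tendsto 2 S g" using T unfolding spectral_op_def S_def t_def by simp
  then have lim: "(\<lambda>N. inner_pi (S N) (jacobi_Phi \<alpha> \<beta> k)) \<longlonglongrightarrow> inner_pi g (jacobi_Phi \<alpha> \<beta> k)"
    by (intro inner_pi_tendsto[of 2 _ _ _ B] gi jacobi_Phi_measurable B) auto
  have "inner_pi (S N) (jacobi_Phi \<alpha> \<beta> k) = t k" if "k < N" for N
  proof -
    have i: "integrable leb_pi (\<lambda>\<theta>. jacobi_Phi \<alpha> \<beta> n \<theta> * cnj (jacobi_Phi \<alpha> \<beta> k \<theta>))" for n
      using integrable_mult_bounded[OF jacobi_Phi_integrable[OF ab] jacobi_Phi_measurable B] by blast
    have "inner_pi (S N) (jacobi_Phi \<alpha> \<beta> k) = (LINT \<theta>|leb_pi. (\<Sum>n<N. t n * (jacobi_Phi \<alpha> \<beta> n \<theta> * cnj (jacobi_Phi \<alpha> \<beta> k \<theta>))))"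
      unfolding inner_pi_def S_def sum_distrib_right by (simp only: mult.assoc)
    also have "\<dots> = (\<Sum>n<N. (LINT \<theta>|leb_pi. t n * (jacobi_Phi \<alpha> \<beta> n \<theta> * cnj (jacobi_Phi \<alpha> \<beta> k \<theta>))))"
      using i by (intro Bochner_Integration.integral_sum integrable_mult_right)
    also have "\<dots> = (\<Sum>n<N. t n * inner_pi (jacobi_Phi \<alpha> \<beta> n) (jacobi_Phi \<alpha> \<beta> k))"
      unfolding inner_pi_def by (simp only: integral_mult_right_zero)
    also have "\<dots> = (\<Sum>n<N. if n = k then t k else 0)"
      unfolding k_def inner_pi_jacobi_Phi[OF ab] by (rule sum.cong) auto
    also have "\<dots> = t k" using that by simp
    finally show ?thesis .
  qed
  then have "\<forall>\<^sub>F N in sequentially. inner_pi (S N) (jacobi_Phi \<alpha> \<beta> k) = t k"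
    unfolding eventually_sequentially by (intro exI[of _ "Suc k"]) auto
  then have "(\<lambda>N. inner_pi (S N) (jacobi_Phi \<alpha> \<beta> k)) \<longlonglongrightarrow> t k"
    by (rule tendsto_eventually)
  from LIMSEQ_unique[OF lim this] show ?thesis by (simp add: t_def k_def)
qed

text \<open>Both sides of the relation for the approximating pairs are pairings with one bounded
  function, so the relation passes to the limit in L^p.\<close>

lemma inner_pi_Lp_extension:
  assumes ab: "-1 < \<alpha>" "-1 < \<beta>" and p: "1 \<le> p" and T: "Lp_extension p (spectral_op \<alpha> \<beta> \<mu>) f g"
  shows "inner_pi g (jacobi_Phi \<alpha> \<beta> (2 * m + 1)) =
         of_real (\<mu> (2 * m + 1)) * inner_pi f (jacobi_Phi \<alpha> \<beta> (2 * m + 1))"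
proof -
  define \<phi> where "\<phi> = jacobi_Phi \<alpha> \<beta> (2 * m + 1)"
  obtain B where B: "\<And>\<theta>. -pi < \<theta> \<Longrightarrow> \<theta> < pi \<Longrightarrow> norm (\<phi> \<theta>) \<le> B"
    using jacobi_Phi_odd_index_bounded[OF ab] unfolding \<phi>_def by blast
  obtain F G where FG: "\<And>j. spectral_op \<alpha> \<beta> \<mu> (F j) (G j)" "Lp_tendsto p F f" "Lp_tendsto p G g"
    and fg: "f \<in> Lp p" "g \<in> Lp p"
    using T unfolding Lp_extension_def by blast
  have m: "\<phi> \<in> borel_measurable leb_pi" unfolding \<phi>_def by (rule jacobi_Phi_measurable)
  have "(\<lambda>j. of_real (\<mu> (2 * m + 1)) * inner_pi (F j) \<phi>) \<longlonglongrightarrow> of_real (\<mu> (2 * m + 1)) * inner_pi f \<phi>"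
    by (intro tendsto_mult tendsto_const inner_pi_tendsto[OF p FG(2) Lp_integrable[OF p fg(1)] m B])
  moreover have "inner_pi (G j) \<phi> = of_real (\<mu> (2 * m + 1)) * inner_pi (F j) \<phi>" for j
    unfolding \<phi>_def by (rule inner_pi_spectral_op[OF ab FG(1)])
  ultimately have "(\<lambda>j. inner_pi (G j) \<phi>) \<longlonglongrightarrow> of_real (\<mu> (2 * m + 1)) * inner_pi f \<phi>" by simp
  moreover have "(\<lambda>j. inner_pi (G j) \<phi>) \<longlonglongrightarrow> inner_pi g \<phi>"
    by (rule inner_pi_tendsto[OF p FG(3) Lp_integrable[OF p fg(2)] m B])
  ultimately show ?thesis unfolding \<phi>_def by (rule LIMSEQ_unique[rotated])
qed

text \<open>Treats both cases of the potential space at once: for \<alpha> + \<beta> = -1 the lowest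
  eigenvalue is 0, and the identity is added to the operator.\<close>

definition pot_shift :: "real \<Rightarrow> real \<Rightarrow> real" where
  "pot_shift \<alpha> \<beta> = (if \<alpha> + \<beta> \<noteq> -1 then 0 else 1)"

lemma potential_space_eq:
  "potential_space \<alpha> \<beta> p s =
     {g. \<exists>f \<in> Lp p. Lp_extension p (spectral_op \<alpha> \<beta> (\<lambda>n. (pot_shift \<alpha> \<beta> + sym_eigenvalue \<alpha> \<beta> n) powr (- (s / 2)))) f g}"
  unfolding potential_space_def pot_shift_def L_neg_power_def Id_L_neg_power_def by simp

text \<open>The index (2m + 2) div 2 = m + 1 matches the raised parameters. Completing the square
  leaves a constant independent of m, which becomes part of \<kappa>.\<close>

lemma sym_eigenvalue_odd_index:
  "sym_eigenvalue \<alpha> \<beta> (2 * m + 1) = jeig (\<alpha> + 1) (\<beta> + 1) m + ((\<alpha> + \<beta> + 3) / 2)\<^sup>2"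
  by (simp add: sym_eigenvalue_def jacobi_lambda_def jeig_def power2_eq_square field_simps)

lemma pot_shift_nonneg: "0 \<le> pot_shift \<alpha> \<beta>"
  by (simp add: pot_shift_def)

lemma sym_eigenvalue_odd_index_pos:
  assumes "-1 < \<alpha>" "-1 < \<beta>"
  shows "0 < pot_shift \<alpha> \<beta> + sym_eigenvalue \<alpha> \<beta> (2 * m + 1)"
proof -
  have "0 \<le> jeig (\<alpha> + 1) (\<beta> + 1) m" unfolding jeig_def using assms by (intro mult_nonneg_nonneg) auto
  moreover have "0 < ((\<alpha> + \<beta> + 3) / 2)\<^sup>2" using assms by (simp add: zero_less_power2)
  ultimately show ?thesis unfolding sym_eigenvalue_odd_index using pot_shift_nonneg[of \<alpha> \<beta>] by linarith
qed

text \<open>The meaning of E: with q = p / (p - 1), both Psi^p and Psi^q are integrable. If m =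
  min(\<alpha> + 1/2, \<beta> + 1/2) is negative, then E is the interval from 1/(1+m) to -1/m; the
  upper bound on p says m p > -1, and the lower one says m q > -1.\<close>

lemma exponents_E_bounds:
  assumes "\<alpha> > -1" "\<beta> > -1" "p \<in> exponents_E \<alpha> \<beta>"
  shows "1 < p"
    and "-1 < (\<alpha> + 1/2) * p" "-1 < (\<beta> + 1/2) * p"
    and "-1 < (\<alpha> + 1/2) * (p / (p - 1))" "-1 < (\<beta> + 1/2) * (p / (p - 1))"
proof -
  have "1 < p \<and> (\<forall>t \<in> {\<alpha> + 1/2, \<beta> + 1/2}. -1 < t * p \<and> -1 < t * (p / (p - 1)))"
  proof (cases "\<alpha> \<ge> -1/2 \<and> \<beta> \<ge> -1/2")
    case True
    then have p: "1 < p" using assms(3) by (simp add: exponents_E_def crit_exponent_def conj_exponent_def one_ereal_def)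
    have "-1 < t * p \<and> -1 < t * (p / (p - 1))" if "0 \<le> t" for t
    proof -
      have "0 \<le> t * p" "0 \<le> t * (p / (p - 1))" using that p by simp_all
      then show ?thesis by linarith
    qed
    then show ?thesis using p True by auto
  next
    case False
    define m where "m = min (\<alpha> + 1/2) (\<beta> + 1/2)"
    have m: "-1/2 < m" "m < 0" using False assms(1,2) by (auto simp: m_def)
    have "crit_exponent \<alpha> \<beta> = ereal (- 1 / m)"
      using False by (auto simp: crit_exponent_def m_def)
    then have "p < - 1 / m" "(- 1 / m) / (- 1 / m - 1) < p"
      using assms(3) by (simp_all add: exponents_E_def conj_exponent_def)
    moreover have "(- 1 / m) / (- 1 / m - 1) = 1 / (1 + m)" using m by (simp add: field_simps)
    ultimately have p1: "-1 < m * p" and p2: "1 < (1 + m) * p"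
      using m by (simp_all add: field_simps)
    have p: "1 < p"
    proof (rule ccontr)
      assume "\<not> 1 < p"
      then have "(1 + m) * p \<le> (1 + m) * 1" using m by (intro mult_left_mono) auto
      from less_le_trans[OF p2 this] show False using m by simp
    qed
    have "-1 < t * p \<and> -1 < t * (p / (p - 1))" if "m \<le> t" for t
    proof -
      have "m * p \<le> t * p" using that p by (intro mult_right_mono) auto
      moreover have "m * (p / (p - 1)) \<le> t * (p / (p - 1))" using that p by (intro mult_right_mono) auto
      moreover have "-1 < m * (p / (p - 1))" using p p2 by (simp add: field_simps)
      ultimately show ?thesis using p1 by linarith
    qed
    then show ?thesis using p by (auto simp: m_def)
  qed
  then show "1 < p" "-1 < (\<alpha> + 1/2) * p" "-1 < (\<beta> + 1/2) * p"
    "-1 < (\<alpha> + 1/2) * (p / (p - 1))" "-1 < (\<beta> + 1/2) * (p / (p - 1))" by auto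
qed

section \<open>Derivatives of the ground state\<close>

text \<open>The logarithmic derivative of Psi is at the same time the zero-order coefficient of the
  symmetrized derivative.\<close>

definition Psi_logderiv :: "real \<Rightarrow> real \<Rightarrow> real \<Rightarrow> real" where
  "Psi_logderiv \<alpha> \<beta> \<theta> = (2 * \<alpha> + 1) / 4 * cot (\<theta> / 2) - (2 * \<beta> + 1) / 4 * tan (\<theta> / 2)"

lemma punctured_bounds:
  assumes "\<theta> \<in> punctured"
  shows "-pi < \<theta>" "\<theta> < pi" "\<theta> \<noteq> 0" "sin (\<theta> / 2) \<noteq> 0" "0 < cos (\<theta> / 2)"
proof -
  show b: "-pi < \<theta>" "\<theta> < pi" "\<theta> \<noteq> 0" using assms pi_gt_zero by (auto simp: punctured_def)
  show "0 < cos (\<theta> / 2)" using b by (intro cos_half_pos)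
  show "sin (\<theta> / 2) \<noteq> 0" using b sin_half_pos[of \<theta>] sin_half_neg[of \<theta>] by (cases "0 < \<theta>") auto
qed

lemma DERIV_sgn_mult:
  assumes "\<theta> \<noteq> 0" "(g has_real_derivative g') (at \<theta>)"
  shows "((\<lambda>x. sgn x * g x) has_real_derivative sgn \<theta> * g') (at \<theta>)"
proof -
  have "\<forall>\<^sub>F x in nhds \<theta>. sgn x = sgn \<theta>"
  proof (cases "0 < \<theta>")
    case True
    then show ?thesis by (intro eventually_nhds[THEN iffD2] exI[of _ "{0<..}"]) auto
  next
    case False
    then show ?thesis using assms(1) by (intro eventually_nhds[THEN iffD2] exI[of _ "{..<0}"]) auto
  qed
  then have "\<forall>\<^sub>F x in nhds \<theta>. sgn x * g x = sgn \<theta> * g x" by eventually_elim simp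
  then show ?thesis
    using DERIV_cmult[OF assms(2), of "sgn \<theta>"] by (subst DERIV_cong_ev[OF refl _ refl]) auto
qed

lemma DERIV_jacobi_Psi:
  assumes "\<theta> \<in> punctured"
  shows "(jacobi_Psi \<alpha> \<beta> has_real_derivative jacobi_Psi \<alpha> \<beta> \<theta> * Psi_logderiv \<alpha> \<beta> \<theta>) (at \<theta>)"
proof -
  note b = punctured_bounds[OF assms]
  \<comment> \<open>On the punctured interval |sin(x/2)| coincides with this differentiable
    function, which is positive there, so its real powers can be differentiated.\<close>
  define S where "S x = sgn x * sin (x / 2)" for x :: real
  have S: "0 < S \<theta>"
    using b sin_half_pos[of \<theta>] sin_half_neg[of \<theta>] by (cases "0 < \<theta>") (auto simp: S_def)
  have S_abs: "\<bar>sin (x / 2)\<bar> = S x" if "x \<in> punctured" for x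
    using punctured_bounds[OF that] sin_half_pos[of x] sin_half_neg[of x] by (cases "0 < x") (auto simp: S_def)
  have dS: "(S has_real_derivative sgn \<theta> * (cos (\<theta> / 2) / 2)) (at \<theta>)"
    unfolding S_def using b(3) by (rule DERIV_sgn_mult) (auto intro!: derivative_eq_intros)
  have dSr: "((\<lambda>x. S x powr r) has_real_derivative S \<theta> powr r * (r / 2 * cot (\<theta> / 2))) (at \<theta>)" for r
  proof -
    have "sgn \<theta> * (cos (\<theta> / 2) / 2) / S \<theta> = cot (\<theta> / 2) / 2"
      using b by (simp add: S_def cot_def sgn_if)
    then have e: "r * S \<theta> powr (r - 1) * (sgn \<theta> * (cos (\<theta> / 2) / 2)) = S \<theta> powr r * (r / 2 * cot (\<theta> / 2))"
      using S by (simp add: powr_diff field_simps)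
    show ?thesis by (rule DERIV_cong[OF DERIV_fun_powr[OF dS S, of r, unfolded of_nat_1] e])
  qed
  have dCr: "((\<lambda>x. cos (x / 2) powr r) has_real_derivative cos (\<theta> / 2) powr r * (- (r / 2 * tan (\<theta> / 2)))) (at \<theta>)" for r
  proof -
    have dC: "((\<lambda>x. cos (x / 2)) has_real_derivative - (sin (\<theta> / 2) / 2)) (at \<theta>)"
      by (auto intro!: derivative_eq_intros)
    have e: "r * cos (\<theta> / 2) powr (r - 1) * (- (sin (\<theta> / 2) / 2)) = cos (\<theta> / 2) powr r * (- (r / 2 * tan (\<theta> / 2)))"
      using b by (simp add: powr_diff tan_def mult_ac)
    show ?thesis by (rule DERIV_cong[OF DERIV_fun_powr[OF dC b(5), of r, unfolded of_nat_1] e])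
  qed
  have "((\<lambda>x. S x powr (\<alpha> + 1 / 2) * cos (x / 2) powr (\<beta> + 1 / 2)) has_real_derivative
      jacobi_Psi \<alpha> \<beta> \<theta> * Psi_logderiv \<alpha> \<beta> \<theta>) (at \<theta>)"
    by (rule DERIV_cong[OF DERIV_mult'[OF dSr dCr]])
      (simp add: jacobi_Psi_def S_abs[OF assms] Psi_logderiv_def algebra_simps add_divide_distrib)
  moreover have "\<forall>\<^sub>F x in nhds \<theta>. jacobi_Psi \<alpha> \<beta> x = S x powr (\<alpha> + 1 / 2) * cos (x / 2) powr (\<beta> + 1 / 2)"
    using assms open_punctured
    by (intro eventually_nhds[THEN iffD2] exI[of _ punctured]) (auto simp: jacobi_Psi_def S_abs)
  ultimately show ?thesis by (subst DERIV_cong_ev[OF refl _ refl]) auto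
qed

lemma Psi_logderiv_odd [simp]: "Psi_logderiv \<alpha> \<beta> (- \<theta>) = - Psi_logderiv \<alpha> \<beta> \<theta>"
  by (simp add: Psi_logderiv_def cot_def tan_def)

lemma continuous_on_Psi_logderiv: "continuous_on punctured (Psi_logderiv \<alpha> \<beta>)"
  unfolding Psi_logderiv_def
  by (intro continuous_intros) (use punctured_bounds in force)+

lemma continuous_on_jacobi_Psi: "continuous_on punctured (jacobi_Psi \<alpha> \<beta>)"
  using DERIV_jacobi_Psi by (intro continuous_at_imp_continuous_on) (blast intro: DERIV_isCont)

lemma continuous_on_sgn_punctured: "continuous_on punctured (sgn :: real \<Rightarrow> real)"
proof -
  have "isCont (sgn :: real \<Rightarrow> real) x" if "x \<in> punctured" for x
    using DERIV_isCont[OF DERIV_sgn_mult[of x "\<lambda>_. 1" 0]] punctured_bounds(3)[OF that] by simp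
  then show ?thesis by (intro continuous_at_imp_continuous_on) auto
qed

lemma weak_deriv_of_real:
  assumes "\<And>x. x \<in> punctured \<Longrightarrow> (u has_real_derivative u' x) (at x)" "continuous_on punctured u'"
  shows "weak_deriv (\<lambda>x. complex_of_real (u x)) (\<lambda>x. complex_of_real (u' x))"
  using assms
  by (intro weak_deriv_classical continuous_intros)
     (auto simp: has_real_derivative_iff_has_vector_derivative intro: has_vector_derivative_of_real)

section \<open>The first counterexample\<close>

text \<open>On odd functions the reflection flips the sign of the zero-order term, so the
  symmetrized derivative acts as f' + (log Psi)' f, which annihilates 1 / Psi on each half;
  \<open>sgn\<close> supplies the oddness.\<close>

definition inv_ground :: "real \<Rightarrow> real \<Rightarrow> real \<Rightarrow> complex" where
  "inv_ground \<alpha> \<beta> \<theta> = of_real (sgn \<theta> * inverse (jacobi_Psi \<alpha> \<beta> \<theta>))"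

lemma inv_ground_measurable: "inv_ground \<alpha> \<beta> \<in> borel_measurable (lebesgue_on S)"
  by (rule measurable_lebesgue_on) (simp add: inv_ground_def[abs_def])

text \<open>The hypotheses say (\<alpha> + 1/2) p < 1 and (\<beta> + 1/2) p < 1, which make Psi^(-p)
  integrable at 0 and at the ends.\<close>

lemma inv_ground_Lp:
  assumes "0 < p" "\<alpha> < 1 / p - 1 / 2" "\<beta> < 1 / p - 1 / 2"
  shows "inv_ground \<alpha> \<beta> \<in> Lp p"
  unfolding Lp_def
proof (intro CollectI conjI inv_ground_measurable)
  show "integrable leb_pi (\<lambda>\<theta>. norm (inv_ground \<alpha> \<beta> \<theta>) powr p)"
  proof (rule integrable_lebesgue_on_bound)
    have "-1 < (\<alpha> + 1 / 2) * (- p)" "-1 < (\<beta> + 1 / 2) * (- p)"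
      using assms by (simp_all add: field_simps)
    then show "integrable leb_pi (\<lambda>\<theta>. jacobi_Psi \<alpha> \<beta> \<theta> powr (- p))"
      by (rule integrable_jacobi_Psi_powr)
    show "(\<lambda>\<theta>. norm (inv_ground \<alpha> \<beta> \<theta>) powr p) \<in> borel_measurable leb_pi"
      by (rule measurable_lebesgue_on) (simp add: inv_ground_def[abs_def])
    show "norm (norm (inv_ground \<alpha> \<beta> \<theta>) powr p) \<le> jacobi_Psi \<alpha> \<beta> \<theta> powr (- p)" for \<theta>
      using jacobi_Psi_nonneg[of \<alpha> \<beta> \<theta>] assms(1)
      by (cases "\<theta> = 0")
        (auto simp: inv_ground_def norm_mult norm_inverse powr_minus abs_mult abs_sgn_eq inverse_powr)
  qed
qed

lemma sym_deriv_inv_ground: "sym_deriv \<alpha> \<beta> (inv_ground \<alpha> \<beta>) (\<lambda>_. 0)"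
proof -
  have "((\<lambda>x. sgn x * inverse (jacobi_Psi \<alpha> \<beta> x)) has_real_derivative
      Psi_logderiv \<alpha> \<beta> x * - (sgn x * inverse (jacobi_Psi \<alpha> \<beta> x))) (at x)" if "x \<in> punctured" for x
  proof -
    note b = punctured_bounds[OF that]
    have P: "jacobi_Psi \<alpha> \<beta> x \<noteq> 0" using jacobi_Psi_pos[OF b(1-3), of \<alpha> \<beta>] by simp
    show ?thesis
      by (rule DERIV_cong[OF DERIV_sgn_mult[OF b(3) DERIV_inverse_fun[OF DERIV_jacobi_Psi[OF that] P]]])
         (use P in \<open>simp add: field_simps power2_eq_square\<close>)
  qed
  moreover have "continuous_on punctured (\<lambda>x. Psi_logderiv \<alpha> \<beta> x * - (sgn x * inverse (jacobi_Psi \<alpha> \<beta> x)))"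
    using punctured_bounds jacobi_Psi_pos
    by (intro continuous_intros continuous_on_Psi_logderiv continuous_on_jacobi_Psi continuous_on_sgn_punctured)
       (metis less_irrefl)
  ultimately have "weak_deriv (\<lambda>x. complex_of_real (sgn x * inverse (jacobi_Psi \<alpha> \<beta> x)))
     (\<lambda>x. complex_of_real (Psi_logderiv \<alpha> \<beta> x * - (sgn x * inverse (jacobi_Psi \<alpha> \<beta> x))))"
    by (rule weak_deriv_of_real)
  moreover have "(\<lambda>x. complex_of_real (Psi_logderiv \<alpha> \<beta> x * - (sgn x * inverse (jacobi_Psi \<alpha> \<beta> x))))
    = (\<lambda>x. 0 + complex_of_real (Psi_logderiv \<alpha> \<beta> x) * inv_ground \<alpha> \<beta> (- x))"
    by (simp add: inv_ground_def sgn_minus fun_eq_iff)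
  ultimately show ?thesis
    unfolding sym_deriv_def Psi_logderiv_def[symmetric] by (simp add: inv_ground_def[abs_def])
qed

lemma sobolev_1_eq: "sobolev_W \<alpha> \<beta> p 1 = sobolev_frakW \<alpha> \<beta> p 1"
  by (simp add: sobolev_W_def sobolev_frakW_def)

lemma inv_ground_sobolev:
  assumes "0 < p" "\<alpha> < 1 / p - 1 / 2" "\<beta> < 1 / p - 1 / 2"
  shows "inv_ground \<alpha> \<beta> \<in> sobolev_W \<alpha> \<beta> p 1"
proof -
  have "(\<lambda>_. 0) \<in> Lp p" using assms(1) by (simp add: Lp_def)
  then show ?thesis
    using inv_ground_Lp[OF assms] sym_deriv_inv_ground[of \<alpha> \<beta>] unfolding sobolev_W_def
    by (intro CollectI conjI exI[of _ "\<lambda>k. if k = 0 then inv_ground \<alpha> \<beta> else (\<lambda>_. 0)"]) auto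
qed

section \<open>Coefficients of the counterexample, and the kernel concentrating at an end of
  [0, 1]\<close>

lemma poly_antiderivative: "\<exists>R. pderiv R = (q :: real poly)"
proof -
  have "pderiv (\<Sum>i\<le>degree q. monom (coeff q i / real (Suc i)) (Suc i)) = (\<Sum>i\<le>degree q. monom (coeff q i) i)"
    using higher_pderiv_sum[of 1 "\<lambda>i. monom (coeff q i / real (Suc i)) (Suc i)" "{..degree q}"]
    by (simp add: pderiv_monom del: of_nat_Suc)
  then show ?thesis using poly_as_sum_of_monoms[of q] by metis
qed

text \<open>Substitution y = cos^2(theta/2), carried out with an antiderivative R of q: the
  integrand is the derivative of -R(cos^2(theta/2)).\<close>

lemma LINT_sin_cos_poly:
  "(LINT \<theta>|lebesgue_on {0<..<pi}. sin (\<theta> / 2) * cos (\<theta> / 2) * poly q ((cos (\<theta> / 2))\<^sup>2)) = int01 q"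
  "integrable (lebesgue_on {0<..<pi}) (\<lambda>\<theta>. sin (\<theta> / 2) * cos (\<theta> / 2) * poly q ((cos (\<theta> / 2))\<^sup>2))"
proof -
  obtain R where R: "pderiv R = q" using poly_antiderivative by blast
  let ?f = "\<lambda>\<theta>. sin (\<theta> / 2) * cos (\<theta> / 2) * poly q ((cos (\<theta> / 2))\<^sup>2)"
  have "(?f has_integral (- poly R ((cos (pi / 2))\<^sup>2) - (- poly R ((cos (0 / 2))\<^sup>2)))) {0<..<pi}"
  proof (rule has_integral_Ioo_of_antiderivative)
    show "continuous_on {0..pi} (\<lambda>\<theta>. - poly R ((cos (\<theta> / 2))\<^sup>2))" by (intro continuous_intros) auto
    show "((\<lambda>\<theta>. - poly R ((cos (\<theta> / 2))\<^sup>2)) has_real_derivative ?f x) (at x)" for x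
    proof -
      have "((\<lambda>\<theta>. (cos (\<theta> / 2))\<^sup>2) has_real_derivative - (sin (x / 2) * cos (x / 2))) (at x)"
        by (auto intro!: derivative_eq_intros)
      from DERIV_minus[OF DERIV_chain2[OF poly_DERIV[of R] this]]
      show ?thesis by (simp add: R mult_ac)
    qed
  qed
  then have hi: "(?f has_integral int01 q) {0<..<pi}"
    using int01_pderiv[of R] by (simp add: R)
  have "?f absolutely_integrable_on {0..pi}"
    by (intro absolutely_integrable_continuous_real continuous_intros) auto
  then have "?f absolutely_integrable_on {0<..<pi}"
    by (rule set_integrable_subset) auto
  then show i: "integrable (lebesgue_on {0<..<pi}) ?f" by (rule absolutely_integrable_imp_integrable) simp
  show "(LINT \<theta>|lebesgue_on {0<..<pi}. ?f \<theta>) = int01 q"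
    using has_integral_unique[OF has_integral_integral_lebesgue_on[OF i] hi] by simp
qed

definition odd_coef :: "real \<Rightarrow> real \<Rightarrow> nat \<Rightarrow> (real \<Rightarrow> complex) \<Rightarrow> complex" where
  "odd_coef a b m h = (LINT \<theta>|leb_pi. h \<theta> * of_real (sgn \<theta> * odd_jacobi a b m \<theta>))"

lemma inner_pi_odd_coef:
  "inner_pi h (jacobi_Phi \<alpha> \<beta> (2 * m + 1)) =
     of_real (jacobi_c (\<alpha> + 1) (\<beta> + 1) m / sqrt 2) * odd_coef (\<alpha> + 1) (\<beta> + 1) m h"
proof -
  define c where "c = complex_of_real (jacobi_c (\<alpha> + 1) (\<beta> + 1) m / sqrt 2)"
  have "inner_pi h (jacobi_Phi \<alpha> \<beta> (2 * m + 1)) =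
    (LINT \<theta>|leb_pi. c * (h \<theta> * of_real (sgn \<theta> * odd_jacobi (\<alpha> + 1) (\<beta> + 1) m \<theta>)))"
    unfolding inner_pi_def jacobi_Phi_odd_index complex_cnj_complex_of_real
    by (simp only: c_def of_real_mult mult_ac)
  then show ?thesis by (simp only: integral_mult_right_zero odd_coef_def c_def)
qed

text \<open>On (0, pi) the quotient of the two weights is sin cos, so the substitution gives a plain
  integral over [0, 1]; the two halves of the interval contribute equally, whence the 2.\<close>

lemma odd_coef_inv_ground:
  "odd_coef (\<alpha> + 1) (\<beta> + 1) m (inv_ground \<alpha> \<beta>) = of_real (2 * int01 (jacobi_poly (\<alpha> + 1) (\<beta> + 1) m))"
proof -
  let ?M = "lebesgue_on {0<..<pi}" and ?q = "jacobi_poly (\<alpha> + 1) (\<beta> + 1) m"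
  let ?f = "\<lambda>\<theta>. complex_of_real ((sgn \<theta>)\<^sup>2 * (inverse (jacobi_Psi \<alpha> \<beta> \<theta>) * odd_jacobi (\<alpha> + 1) (\<beta> + 1) m \<theta>))"
  let ?g = "\<lambda>\<theta>. complex_of_real (sin (\<theta> / 2) * cos (\<theta> / 2) * poly ?q ((cos (\<theta> / 2))\<^sup>2))"
  have eq: "?f \<theta> = ?g \<theta>" if "\<theta> \<in> space ?M" for \<theta>
  proof -
    have t: "0 < \<theta>" "\<theta> < pi" "-pi < \<theta>" using that by auto
    have "jacobi_Psi \<alpha> \<beta> \<theta> \<noteq> 0" using jacobi_Psi_pos[of \<theta> \<alpha> \<beta>] t by simp
    then show ?thesis
      using t sin_half_pos[OF t(1,2)]
      by (simp add: odd_jacobi_def jacobi_Psi_shift[OF t(3,2)] jacobi_P_cos)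
  qed
  have ig: "integrable ?M ?g" using LINT_sin_cos_poly(2)[of ?q] by (rule integrable_of_real)
  have i: "integrable ?M ?f" by (rule iffD2[OF Bochner_Integration.integrable_cong[OF refl eq] ig])
  have "odd_coef (\<alpha> + 1) (\<beta> + 1) m (inv_ground \<alpha> \<beta>) = (LINT \<theta>|leb_pi. ?f \<theta>)"
    unfolding odd_coef_def inv_ground_def by (simp only: of_real_mult[symmetric] power2_eq_square mult_ac)
  also have "\<dots> = 2 *\<^sub>R (LINT \<theta>|?M. ?f \<theta>)"
    by (rule leb_pi_even(2)[OF _ i]) (simp add: sgn_minus)
  also have "(LINT \<theta>|?M. ?f \<theta>) = (LINT \<theta>|?M. ?g \<theta>)"
    by (rule Bochner_Integration.integral_cong[OF refl eq])
  also have "\<dots> = of_real (int01 ?q)"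
    by (simp only: integral_complex_of_real LINT_sin_cos_poly(1))
  finally show ?thesis by (simp add: scaleR_conv_of_real)
qed

text \<open>N t^N is at most the sum of t^i over i < N, and 1 - t times that sum is 1 - t^N. The
  exponent 2 N is there because the kernel is estimated through its square.\<close>

lemma power_times_one_minus_le:
  fixes t :: real
  assumes "0 \<le> t" "t \<le> 1"
  shows "real N * (1 - t) * t ^ (2 * N) \<le> 1"
proof -
  have "real N * t ^ N = (\<Sum>i<N. t ^ N)" by simp
  also have "\<dots> \<le> (\<Sum>i<N. t ^ i)" using assms by (intro sum_mono power_decreasing) auto
  finally have "(1 - t) * (real N * t ^ N) \<le> (1 - t) * (\<Sum>i<N. t ^ i)"
    using assms by (intro mult_left_mono) auto
  also have "\<dots> = 1 - t ^ N" by (simp add: one_diff_power_eq)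
  also have "\<dots> \<le> 1" using assms by simp
  finally have "(1 - t) * (real N * t ^ N) \<le> 1" .
  moreover have "t ^ (2 * N) \<le> t ^ N" using assms by (intro power_decreasing) auto
  then have "(1 - t) * (real N * t ^ (2 * N)) \<le> (1 - t) * (real N * t ^ N)"
    using assms by (intro mult_left_mono) auto
  ultimately show ?thesis by (simp add: mult_ac)
qed

text \<open>Young's inequality without constants, by comparing y with x^(p-1), the point where both
  powers on the right agree.\<close>

lemma Young_weak:
  fixes x y p :: real
  assumes "1 < p" "0 \<le> x" "0 \<le> y"
  shows "x * y \<le> x powr p + y powr (p / (p - 1))"
proof (cases "x = 0 \<or> y = 0")
  case True
  then show ?thesis by auto
next
  case False
  then have xy: "0 < x" "0 < y" using assms by auto
  show ?thesis
  proof (cases "y \<le> x powr (p - 1)")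
    case True
    then have "x * y \<le> x * x powr (p - 1)" using xy by (intro mult_left_mono) auto
    also have "\<dots> = x powr p" using xy powr_add[of x 1 "p - 1"] by simp
    finally show ?thesis using powr_ge_zero[of y "p / (p - 1)"] by linarith
  next
    case False
    then have "(x powr (p - 1)) powr (1 / (p - 1)) \<le> y powr (1 / (p - 1))"
      using assms by (intro powr_mono2) auto
    then have "x \<le> y powr (1 / (p - 1))" using assms xy by (simp add: powr_powr)
    then have "x * y \<le> y powr (1 / (p - 1)) * y" using xy by (intro mult_right_mono) auto
    also have "\<dots> = y powr (1 / (p - 1) + 1)" using xy powr_add[of y "1 / (p - 1)" 1] by simp
    also have "1 / (p - 1) + 1 = p / (p - 1)" using assms by (simp add: field_simps)
    finally show ?thesis using powr_ge_zero[of x p] by linarith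
  qed
qed

text \<open>Here p in E is decisive: Psi is integrable to the conjugate power, so |g| Psi is
  integrable and can serve as the fixed weight under the concentrating kernel.\<close>

lemma integrable_Lp_mult_Psi:
  assumes "\<alpha> > -1" "\<beta> > -1" "p \<in> exponents_E \<alpha> \<beta>" "g \<in> Lp p"
  shows "integrable leb_pi (\<lambda>\<theta>. norm (g \<theta>) * jacobi_Psi \<alpha> \<beta> \<theta>)"
proof (rule integrable_lebesgue_on_bound)
  note p = exponents_E_bounds[OF assms(1-3)]
  show "integrable leb_pi (\<lambda>\<theta>. norm (g \<theta>) powr p + jacobi_Psi \<alpha> \<beta> \<theta> powr (p / (p - 1)))"
    using assms(4) integrable_jacobi_Psi_powr[OF p(4,5)] by (auto simp: Lp_def)
  have "g \<in> borel_measurable leb_pi" using assms(4) by (simp add: Lp_def)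
  moreover have "jacobi_Psi \<alpha> \<beta> \<in> borel_measurable leb_pi" by (rule measurable_lebesgue_on) measurable
  ultimately show "(\<lambda>\<theta>. norm (g \<theta>) * jacobi_Psi \<alpha> \<beta> \<theta>) \<in> borel_measurable leb_pi" by measurable
  show "norm (norm (g \<theta>) * jacobi_Psi \<alpha> \<beta> \<theta>) \<le> norm (g \<theta>) powr p + jacobi_Psi \<alpha> \<beta> \<theta> powr (p / (p - 1))" for \<theta>
    using Young_weak[OF p(1), of "norm (g \<theta>)" "jacobi_Psi \<alpha> \<beta> \<theta>"] jacobi_Psi_nonneg[of \<alpha> \<beta> \<theta>] by simp
qed

text \<open>Let u be cos^2 or sin^2, depending on h. Since (sin cos)^2 \<le> 1 - u, the square of
  the kernel is at most N (1-u) u^(2N) \<le> 1, so |w| dominates. Pointwise the kernel tends to 0: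
  either the sine is 0, or u < 1 and u^N outweighs sqrt N.\<close>

lemma LINT_concentrated_tendsto_0:
  fixes w :: "real \<Rightarrow> real"
  assumes w: "integrable leb_pi w" and h: "h \<in> {\<lambda>y. y, \<lambda>y. 1 - y}"
  shows "(\<lambda>N. LINT \<theta>|leb_pi. w \<theta> * (sqrt (real N) * (\<bar>sin (\<theta> / 2)\<bar> * cos (\<theta> / 2) * h ((cos (\<theta> / 2))\<^sup>2) ^ N))) \<longlonglongrightarrow> 0"
    and "integrable leb_pi (\<lambda>\<theta>. w \<theta> * (sqrt (real N) * (\<bar>sin (\<theta> / 2)\<bar> * cos (\<theta> / 2) * h ((cos (\<theta> / 2))\<^sup>2) ^ N)))"
proof -
  define k where "k N \<theta> = sqrt (real N) * (\<bar>sin (\<theta> / 2)\<bar> * cos (\<theta> / 2) * h ((cos (\<theta> / 2))\<^sup>2) ^ N)" for N \<theta>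
  have hm: "continuous_on UNIV h" using h by (auto intro: continuous_intros)
  have km: "k N \<in> borel_measurable leb_pi" for N
    unfolding k_def
    by (intro measurable_lebesgue_on borel_measurable_continuous_onI continuous_intros
        continuous_on_compose2[OF hm]) auto
  have "k N \<theta> \<le> 1 \<and> 0 \<le> k N \<theta> \<and> (\<lambda>N. k N \<theta>) \<longlonglongrightarrow> 0" if t: "\<theta> \<in> {-pi<..<pi}" for N \<theta>
  proof -
    define s c u where "s = \<bar>sin (\<theta> / 2)\<bar>" and "c = cos (\<theta> / 2)" and "u = h (c\<^sup>2)"
    have sc: "s\<^sup>2 + c\<^sup>2 = 1" "0 < c" "0 \<le> s" using cos_half_pos[of \<theta>] t by (auto simp: s_def c_def)
    have s1: "s \<le> 1" "c \<le> 1" by (auto simp: s_def c_def)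
    have u: "0 \<le> u" "u \<le> 1" and uu: "(s * c)\<^sup>2 \<le> 1 - u"
    proof -
      have "c\<^sup>2 \<le> 1" "s\<^sup>2 \<le> 1" using sc by (metis add_increasing2 le_add_same_cancel2 order_refl zero_le_power2 add_increasing)+
      then show "0 \<le> u" "u \<le> 1" using h unfolding u_def by auto
      have "u = c\<^sup>2 \<or> u = s\<^sup>2" using h sc(1) unfolding u_def by auto
      then show "(s * c)\<^sup>2 \<le> 1 - u"
      proof
        assume "u = c\<^sup>2"
        then have "1 - u = s\<^sup>2" using sc(1) by simp
        then show ?thesis using mult_left_le[OF \<open>c\<^sup>2 \<le> 1\<close>, of "s\<^sup>2"] by (simp add: power_mult_distrib)
      next
        assume "u = s\<^sup>2"
        then have "1 - u = c\<^sup>2" using sc(1) by simp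
        then show ?thesis using mult_right_mono[OF \<open>s\<^sup>2 \<le> 1\<close>, of "c\<^sup>2"] by (simp add: power_mult_distrib)
      qed
    qed
    have kN: "k N \<theta> = sqrt (real N) * (s * c * u ^ N)" for N by (simp add: k_def s_def c_def u_def)
    have k0: "0 \<le> k N \<theta>" for N unfolding kN using sc u by simp
    have "(k N \<theta>)\<^sup>2 = real N * (s * c)\<^sup>2 * u ^ (2 * N)"
      unfolding kN by (simp add: power_mult_distrib power_mult power_even_eq mult_ac)
    also have "\<dots> \<le> real N * (1 - u) * u ^ (2 * N)"
      using uu u by (intro mult_right_mono mult_left_mono) auto
    also have "\<dots> \<le> 1" using u by (rule power_times_one_minus_le)
    finally have "(k N \<theta>)\<^sup>2 \<le> 1\<^sup>2" by simp
    then have k1: "k N \<theta> \<le> 1" by (rule power2_le_imp_le) simp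
    have "(\<lambda>N. k N \<theta>) \<longlonglongrightarrow> 0"
    proof (cases "s = 0")
      case True then show ?thesis by (simp add: kN)
    next
      case False
      then have "0 < (s * c)\<^sup>2" using sc by simp
      then have u1: "u < 1" using uu by linarith
      have "(\<lambda>N. real N * u ^ N) \<longlonglongrightarrow> 0" using u u1 by (intro powser_times_n_limit_0) auto
      moreover have "norm (k N \<theta>) \<le> real N * u ^ N" for N
      proof -
        have "s * c \<le> 1" using sc s1 by (intro mult_le_one) auto
        then have scu: "s * c * u ^ N \<le> 1 * u ^ N" using u by (intro mult_right_mono) auto
        have sN: "sqrt (real N) \<le> real N"
          by (cases N) (auto intro!: real_le_lsqrt simp: power2_eq_square)
        have "k N \<theta> \<le> real N * (1 * u ^ N)"
          unfolding kN by (rule mult_mono[OF sN scu]) (use sc u in auto)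
        then show ?thesis using k0[of N] by simp
      qed
      ultimately show ?thesis by (intro Lim_null_comparison[of "\<lambda>N. k N \<theta>"] always_eventually allI)
    qed
    then show ?thesis using k0 k1 by blast
  qed
  note k = this
  have wm: "w \<in> borel_measurable leb_pi" using w by (rule borel_measurable_integrable)
  show i: "integrable leb_pi (\<lambda>\<theta>. w \<theta> * (sqrt (real N) * (\<bar>sin (\<theta> / 2)\<bar> * cos (\<theta> / 2) * h ((cos (\<theta> / 2))\<^sup>2) ^ N)))" for N
    unfolding k_def[symmetric]
  proof (rule integrable_lebesgue_on_bound[OF integrable_norm[OF w]])
    show "(\<lambda>\<theta>. w \<theta> * k N \<theta>) \<in> borel_measurable leb_pi" using wm km by measurable
    show "norm (w \<theta> * k N \<theta>) \<le> norm (w \<theta>)" if "\<theta> \<in> {-pi<..<pi}" for \<theta>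
      using k[OF that, of N] by (simp add: abs_mult mult_left_le)
  qed
  have "(\<lambda>N. LINT \<theta>|leb_pi. w \<theta> * k N \<theta>) \<longlonglongrightarrow> (LINT \<theta>|leb_pi. 0)"
  proof (rule integral_dominated_convergence)
    show "integrable leb_pi (\<lambda>\<theta>. norm (w \<theta>))" using w by (rule integrable_norm)
    show "(\<lambda>\<theta>. w \<theta> * k N \<theta>) \<in> borel_measurable leb_pi" for N using wm km by measurable
    show "AE \<theta> in leb_pi. norm (w \<theta> * k N \<theta>) \<le> norm (w \<theta>)" for N
      using k by (intro AE_I2) (auto simp: abs_mult mult_left_le)
    show "AE \<theta> in leb_pi. (\<lambda>N. w \<theta> * k N \<theta>) \<longlonglongrightarrow> 0"
      using k by (intro AE_I2 tendsto_mult_right_zero) auto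
  qed simp
  then show "(\<lambda>N. LINT \<theta>|leb_pi. w \<theta> * (sqrt (real N) * (\<bar>sin (\<theta> / 2)\<bar> * cos (\<theta> / 2) * h ((cos (\<theta> / 2))\<^sup>2) ^ N))) \<longlonglongrightarrow> 0"
    unfolding k_def by simp
qed

theorem inv_ground_not_potential:
  assumes "\<alpha> > -1" "\<beta> > -1" "p \<in> exponents_E \<alpha> \<beta>"
  shows "inv_ground \<alpha> \<beta> \<notin> potential_space \<alpha> \<beta> p 1"
proof
  assume "inv_ground \<alpha> \<beta> \<in> potential_space \<alpha> \<beta> p 1"
  define \<Lambda> where "\<Lambda> n = pot_shift \<alpha> \<beta> + sym_eigenvalue \<alpha> \<beta> n" for n
  obtain g where g: "g \<in> Lp p" and
    T: "Lp_extension p (spectral_op \<alpha> \<beta> (\<lambda>n. \<Lambda> n powr (- (1 / 2)))) g (inv_ground \<alpha> \<beta>)"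
    using \<open>inv_ground \<alpha> \<beta> \<in> potential_space \<alpha> \<beta> p 1\<close> unfolding potential_space_eq \<Lambda>_def by auto
  have p: "1 < p" using exponents_E_bounds[OF assms] by simp
  define a b where "a = \<alpha> + 1" and "b = \<beta> + 1"
  have ab: "0 < a" "0 < b" using assms by (simp_all add: a_def b_def)
  define s where "s m = sqrt (\<Lambda> (2 * m + 1))" for m
  have Lpos: "0 < \<Lambda> (2 * m + 1)" for m unfolding \<Lambda>_def by (rule sym_eigenvalue_odd_index_pos[OF assms(1,2)])
  have s0: "0 < s m" for m using Lpos by (simp add: s_def)
  define \<kappa> where "\<kappa> = pot_shift \<alpha> \<beta> + ((\<alpha> + \<beta> + 3) / 2)\<^sup>2"
  have \<kappa>0: "0 \<le> \<kappa>" using pot_shift_nonneg[of \<alpha> \<beta>] by (simp add: \<kappa>_def)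
  have L_eq: "\<Lambda> (2 * m + 1) = jeig a b m + \<kappa>" for m
    unfolding \<Lambda>_def sym_eigenvalue_odd_index a_def b_def \<kappa>_def by simp
  have s2: "(s m)\<^sup>2 = jeig a b m + \<kappa>" for m
    unfolding s_def real_sqrt_pow2[OF less_imp_le[OF Lpos]] by (rule L_eq)
  define l where "l m = int01 (jacobi_poly a b m)" for m
  \<comment> \<open>The multiplier is 1 / s m and the normalising constant is nonzero, so the
    coefficients of g are those of the counterexample multiplied by s m.\<close>
  have coef: "odd_coef a b m g = of_real (2 * s m * l m)" for m
  proof -
    have "inner_pi (inv_ground \<alpha> \<beta>) (jacobi_Phi \<alpha> \<beta> (2 * m + 1)) =
       of_real (\<Lambda> (2 * m + 1) powr (- (1 / 2))) * inner_pi g (jacobi_Phi \<alpha> \<beta> (2 * m + 1))"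
      using p by (intro inner_pi_Lp_extension[OF assms(1,2) _ T]) simp
    moreover have "\<Lambda> (2 * m + 1) powr (- (1 / 2)) = inverse (s m)"
      using Lpos[of m] by (simp add: s_def powr_minus powr_half_sqrt)
    moreover have "jacobi_c a b m / sqrt 2 \<noteq> 0" using jacobi_c_pos(1)[OF ab, of m] by simp
    ultimately have "odd_coef a b m (inv_ground \<alpha> \<beta>) = of_real (inverse (s m)) * odd_coef a b m g"
      unfolding inner_pi_odd_coef a_def[symmetric] b_def[symmetric] by simp
    then have "odd_coef a b m g = of_real (s m) * odd_coef a b m (inv_ground \<alpha> \<beta>)"
      using s0[of m] by simp
    also have "odd_coef a b m (inv_ground \<alpha> \<beta>) = of_real (2 * l m)"
      unfolding a_def b_def odd_coef_inv_ground by (simp add: l_def a_def b_def)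
    finally show ?thesis by (simp add: mult_ac)
  qed
  have gi: "integrable leb_pi g" using p g by (intro Lp_integrable[of p]) auto
  have gm: "integrable leb_pi (\<lambda>\<theta>. g \<theta> * of_real (sgn \<theta> * odd_jacobi a b m \<theta>))" for m
  proof -
    obtain B where B: "0 \<le> B" "\<And>\<theta>. -pi < \<theta> \<Longrightarrow> \<theta> < pi \<Longrightarrow> \<bar>odd_jacobi a b m \<theta>\<bar> \<le> B"
      by (rule odd_jacobi_bounded[of a b m]) (use ab in auto)
    have "integrable leb_pi (\<lambda>\<theta>. g \<theta> * cnj (of_real (sgn \<theta> * odd_jacobi a b m \<theta>)))"
    proof (rule integrable_mult_bounded[OF gi, of _ "1 * B"])
      show "(\<lambda>\<theta>. complex_of_real (sgn \<theta> * odd_jacobi a b m \<theta>)) \<in> borel_measurable leb_pi"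
        by (rule measurable_lebesgue_on) measurable
      show "norm (complex_of_real (sgn \<theta> * odd_jacobi a b m \<theta>)) \<le> 1 * B" if "-pi < \<theta>" "\<theta> < pi" for \<theta>
        unfolding norm_of_real abs_mult using B(2)[OF that] by (intro mult_mono) (auto simp: abs_sgn_eq)
    qed
    then show ?thesis by simp
  qed
  obtain h c N0 where h: "h \<in> {\<lambda>y. y, \<lambda>y. 1 - y :: real}" and c: "0 < c" and
    N0: "\<And>N. N0 \<le> N \<Longrightarrow> \<exists>r. (\<forall>y. h y ^ N = (\<Sum>m\<le>N. r m * jacobi_P a b m (2 * y - 1))) \<and>
           c / sqrt (real N) \<le> (\<Sum>m\<le>N. r m * s m * l m)"
    using first_moment_lower_bound[OF ab \<kappa>0 less_imp_le[OF s0] s2] unfolding l_def by blast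
  define w where "w \<theta> = norm (g \<theta>) * jacobi_Psi \<alpha> \<beta> \<theta>" for \<theta>
  have wi: "integrable leb_pi w" unfolding w_def by (rule integrable_Lp_mult_Psi[OF assms g])
  define K where "K N \<theta> = \<bar>sin (\<theta> / 2)\<bar> * cos (\<theta> / 2) * h ((cos (\<theta> / 2))\<^sup>2) ^ N" for N \<theta>
  have low: "2 * c \<le> (LINT \<theta>|leb_pi. w \<theta> * (sqrt (real N) * K N \<theta>))" if N: "N0 \<le> N" "0 < N" for N
  proof -
    obtain r where r: "\<And>y. h y ^ N = (\<Sum>m\<le>N. r m * jacobi_P a b m (2 * y - 1))"
      and le: "c / sqrt (real N) \<le> (\<Sum>m\<le>N. r m * s m * l m)"
      using N0[OF N(1)] by blast
    \<comment> \<open>The integral of Q is a finite combination of coefficients of g and equals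
      twice the first moment, which is bounded from below.\<close>
    define Q where "Q \<theta> = g \<theta> * of_real (sgn \<theta> * jacobi_Psi a b \<theta> * h ((cos (\<theta> / 2))\<^sup>2) ^ N)" for \<theta>
    have Q: "Q \<theta> = (\<Sum>m\<le>N. of_real (r m) * (g \<theta> * of_real (sgn \<theta> * odd_jacobi a b m \<theta>)))" for \<theta>
    proof -
      have "2 * (cos (\<theta> / 2))\<^sup>2 - 1 = cos \<theta>" using cos_double_cos[of "\<theta> / 2"] by simp
      then have "h ((cos (\<theta> / 2))\<^sup>2) ^ N = (\<Sum>m\<le>N. r m * jacobi_P a b m (cos \<theta>))" by (simp add: r)
      then have "sgn \<theta> * jacobi_Psi a b \<theta> * h ((cos (\<theta> / 2))\<^sup>2) ^ N = (\<Sum>m\<le>N. r m * (sgn \<theta> * odd_jacobi a b m \<theta>))"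
        by (simp add: sum_distrib_left odd_jacobi_def mult_ac)
      then show ?thesis unfolding Q_def by (simp add: sum_distrib_left mult_ac)
    qed
    have Qi: "integrable leb_pi Q"
      unfolding Q[abs_def] using gm by (intro Bochner_Integration.integrable_sum integrable_mult_right)
    have "(LINT \<theta>|leb_pi. Q \<theta>) = (\<Sum>m\<le>N. of_real (r m) * odd_coef a b m g)"
      unfolding Q using gm by (simp add: Bochner_Integration.integral_sum odd_coef_def)
    also have "\<dots> = of_real (2 * (\<Sum>m\<le>N. r m * s m * l m))"
      unfolding coef by (simp add: sum_distrib_left mult_ac)
    finally have Q_eq: "(LINT \<theta>|leb_pi. Q \<theta>) = of_real (2 * (\<Sum>m\<le>N. r m * s m * l m))" .
    have "2 * (\<Sum>m\<le>N. r m * s m * l m) \<le> norm (LINT \<theta>|leb_pi. Q \<theta>)"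
      unfolding Q_eq norm_of_real by (rule abs_ge_self)
    also have "\<dots> \<le> (LINT \<theta>|leb_pi. norm (Q \<theta>))" by (rule integral_norm_bound)
    \<comment> \<open>The raised weight is split: its factor |sin| cos goes into the kernel K, and
      the remaining Psi makes up w together with |g|.\<close>
    also have "\<dots> \<le> (LINT \<theta>|leb_pi. w \<theta> * K N \<theta>)"
    proof (rule integral_mono[OF integrable_norm[OF Qi]])
      have "integrable leb_pi (\<lambda>\<theta>. (1 / sqrt (real N)) * (w \<theta> * (sqrt (real N) * K N \<theta>)))"
        unfolding K_def by (intro integrable_mult_right LINT_concentrated_tendsto_0(2)[OF wi h])
      then show "integrable leb_pi (\<lambda>\<theta>. w \<theta> * K N \<theta>)" using N(2) by simp
      fix \<theta> assume "\<theta> \<in> space leb_pi"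
      then have t: "-pi < \<theta>" "\<theta> < pi" by auto
      have hn: "0 \<le> h ((cos (\<theta> / 2))\<^sup>2)"
        using h by (auto simp: abs_square_le_1)
      have "norm (Q \<theta>) = norm (g \<theta>) * (\<bar>sgn \<theta>\<bar> * jacobi_Psi a b \<theta> * h ((cos (\<theta> / 2))\<^sup>2) ^ N)"
        unfolding Q_def norm_mult norm_of_real abs_mult using hn jacobi_Psi_nonneg[of a b \<theta>] by simp
      also have "\<dots> \<le> norm (g \<theta>) * (1 * jacobi_Psi a b \<theta> * h ((cos (\<theta> / 2))\<^sup>2) ^ N)"
        using hn jacobi_Psi_nonneg[of a b \<theta>] by (intro mult_left_mono mult_right_mono) (auto simp: abs_sgn_eq)
      also have "\<dots> = w \<theta> * K N \<theta>"
        unfolding a_def b_def jacobi_Psi_shift[OF t] w_def K_def by simp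
      finally show "norm (Q \<theta>) \<le> w \<theta> * K N \<theta>" .
    qed
    finally have "2 * (\<Sum>m\<le>N. r m * s m * l m) \<le> (LINT \<theta>|leb_pi. w \<theta> * K N \<theta>)" .
    then have "2 * (c / sqrt (real N)) \<le> (LINT \<theta>|leb_pi. w \<theta> * K N \<theta>)" using le by linarith
    then have "sqrt (real N) * (2 * (c / sqrt (real N))) \<le> sqrt (real N) * (LINT \<theta>|leb_pi. w \<theta> * K N \<theta>)"
      by (intro mult_left_mono) auto
    also have "sqrt (real N) * (2 * (c / sqrt (real N))) = 2 * c" using N(2) by simp
    also have "sqrt (real N) * (LINT \<theta>|leb_pi. w \<theta> * K N \<theta>) = (LINT \<theta>|leb_pi. w \<theta> * (sqrt (real N) * K N \<theta>))"
      unfolding integral_mult_right_zero[symmetric] by (simp only: mult_ac)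
    finally show ?thesis .
  qed
  have "(\<lambda>N. LINT \<theta>|leb_pi. w \<theta> * (sqrt (real N) * K N \<theta>)) \<longlonglongrightarrow> 0"
    unfolding K_def by (rule LINT_concentrated_tendsto_0(1)[OF wi h])
  then have "2 * c \<le> 0"
    by (rule LIMSEQ_le_const) (use low in \<open>auto intro!: exI[of _ "Suc N0"]\<close>)
  then show False using c by simp
qed

section \<open>The second counterexample\<close>

lemma jacobi_Phi_1:
  "jacobi_Phi \<alpha> \<beta> 1 \<theta> = of_real (jacobi_c (\<alpha> + 1) (\<beta> + 1) 0 / sqrt 2 * (sgn \<theta> * jacobi_Psi (\<alpha> + 1) (\<beta> + 1) \<theta>))"
  using jacobi_Phi_odd_index[of \<alpha> \<beta> 0 \<theta>] by (simp add: odd_jacobi_def jacobi_P_def)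

lemma jacobi_Phi_odd_index_Lp:
  assumes "-1 < \<alpha>" "-1 < \<beta>" "0 < q"
  shows "(\<lambda>\<theta>. c * jacobi_Phi \<alpha> \<beta> (2 * m + 1) \<theta>) \<in> Lp q"
proof -
  obtain B where B: "\<And>\<theta>. -pi < \<theta> \<Longrightarrow> \<theta> < pi \<Longrightarrow> norm (jacobi_Phi \<alpha> \<beta> (2 * m + 1) \<theta>) \<le> B"
    using jacobi_Phi_odd_index_bounded[OF assms(1,2)] by blast
  have m: "(\<lambda>\<theta>. c * jacobi_Phi \<alpha> \<beta> (2 * m + 1) \<theta>) \<in> borel_measurable leb_pi"
    using jacobi_Phi_measurable by measurable
  have "integrable leb_pi (\<lambda>\<theta>. norm (c * jacobi_Phi \<alpha> \<beta> (2 * m + 1) \<theta>) powr q)"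
  proof (rule integrable_leb_pi_bounded)
    show "(\<lambda>\<theta>. norm (c * jacobi_Phi \<alpha> \<beta> (2 * m + 1) \<theta>) powr q) \<in> borel_measurable leb_pi"
      using m by measurable
    show "norm (norm (c * jacobi_Phi \<alpha> \<beta> (2 * m + 1) \<theta>) powr q) \<le> (norm c * B) powr q" if "-pi < \<theta>" "\<theta> < pi" for \<theta>
      using B[OF that] assms(3) by (auto simp: norm_mult intro!: powr_mono2 mult_left_mono)
  qed
  then show ?thesis using m by (simp add: Lp_def)
qed

lemma Lp_norm_zero [simp]: "Lp_norm q (\<lambda>_. 0) = 0"
  by (simp add: Lp_norm_def)

lemma Lp_zero: "(\<lambda>_. 0) \<in> Lp q"
  by (simp add: Lp_def)

lemma Lp_tendsto_const: "Lp_tendsto q (\<lambda>_. f) f"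
  by (simp add: Lp_tendsto_def Lp_zero)

text \<open>An eigenfunction is the image of a multiple of itself. It is bounded, so this multiple
  lies in L^2 and in L^p, and constant sequences witness the extension by continuity.\<close>

lemma jacobi_Phi_1_potential:
  assumes ab: "-1 < \<alpha>" "-1 < \<beta>" and "0 < p"
  shows "jacobi_Phi \<alpha> \<beta> 1 \<in> potential_space \<alpha> \<beta> p 2"
proof -
  let ?\<phi> = "jacobi_Phi \<alpha> \<beta>"
  define \<mu> where "\<mu> n = (pot_shift \<alpha> \<beta> + sym_eigenvalue \<alpha> \<beta> n) powr (- (2 / 2))" for n
  have \<mu>: "0 < \<mu> 1" using sym_eigenvalue_odd_index_pos[OF ab, of 0] by (simp add: \<mu>_def)
  define f where "f \<theta> = of_real (inverse (\<mu> 1)) * ?\<phi> 1 \<theta>" for \<theta>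
  have inn: "inner_pi f (?\<phi> n) = (if n = 1 then of_real (inverse (\<mu> 1)) else 0)" for n
  proof -
    have "inner_pi f (?\<phi> n) = of_real (inverse (\<mu> 1)) * inner_pi (?\<phi> n) (?\<phi> 1)"
      unfolding inner_pi_def f_def cnj_jacobi_Phi by (simp only: mult.assoc integral_mult_right_zero mult.commute[of "?\<phi> n _"])
    then show ?thesis using inner_pi_jacobi_Phi[OF ab, of n 0] by simp
  qed
  define S where "S = (\<lambda>N \<theta>. \<Sum>n<N. of_real (\<mu> n) * inner_pi f (?\<phi> n) * ?\<phi> n \<theta>)"
  have S: "S N = (if 1 < N then ?\<phi> 1 else (\<lambda>_. 0))" for N
  proof
    fix \<theta>
    have "S N \<theta> = (\<Sum>n<N. if n = 1 then ?\<phi> 1 \<theta> else 0)"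
      unfolding S_def inn using \<mu> by (intro sum.cong) auto
    then show "S N \<theta> = (if 1 < N then ?\<phi> 1 else (\<lambda>_. 0)) \<theta>" by (simp add: sum.delta)
  qed
  have \<phi>Lp: "(\<lambda>\<theta>. c * ?\<phi> 1 \<theta>) \<in> Lp q" if "0 < q" for c q
    using jacobi_Phi_odd_index_Lp[OF ab that, of c 0] by simp
  have fLp: "f \<in> Lp q" if "0 < q" for q using \<phi>Lp[OF that] by (simp add: f_def[abs_def])
  have \<phi>Lp1: "?\<phi> 1 \<in> Lp q" if "0 < q" for q using \<phi>Lp[OF that, of 1] by simp
  have "Lp_tendsto 2 S (?\<phi> 1)"
    unfolding Lp_tendsto_def
  proof (intro conjI allI)
    show "(\<lambda>\<theta>. S N \<theta> - ?\<phi> 1 \<theta>) \<in> Lp 2" for N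
      using \<phi>Lp[of 2 "-1"] Lp_zero[of 2] by (cases "1 < N") (simp_all add: S)
    have "\<forall>\<^sub>F N in sequentially. Lp_norm 2 (\<lambda>\<theta>. S N \<theta> - ?\<phi> 1 \<theta>) = 0"
      unfolding eventually_sequentially by (intro exI[of _ 2]) (simp add: S)
    then show "(\<lambda>N. Lp_norm 2 (\<lambda>\<theta>. S N \<theta> - ?\<phi> 1 \<theta>)) \<longlonglongrightarrow> 0" by (rule tendsto_eventually)
  qed
  then have "spectral_op \<alpha> \<beta> \<mu> f (?\<phi> 1)"
    using fLp[of 2] \<phi>Lp1[of 2] unfolding spectral_op_def S_def by simp
  then have "Lp_extension p (spectral_op \<alpha> \<beta> \<mu>) f (?\<phi> 1)"
    unfolding Lp_extension_def using fLp \<phi>Lp1 Lp_tendsto_const assms(3)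
    by (intro conjI exI[of _ "\<lambda>_. f"] exI[of _ "\<lambda>_. ?\<phi> 1"]) auto
  then show ?thesis
    unfolding potential_space_eq \<mu>_def[abs_def] using fLp[OF assms(3)] by blast
qed

text \<open>The symmetrized derivative of \<open>jacobi_Phi \<alpha> \<beta> 1\<close> is this function times the odd ground
  state; in the second symmetrized derivative all terms cancel except the one with \<open>cot_tan_deriv\<close>.\<close>

definition cot_tan :: "real \<Rightarrow> real \<Rightarrow> real \<Rightarrow> real" where
  "cot_tan a b \<theta> = a * cot (\<theta> / 2) - b * tan (\<theta> / 2)"

definition cot_tan_deriv :: "real \<Rightarrow> real \<Rightarrow> real \<Rightarrow> real" where
  "cot_tan_deriv a b \<theta> = - (a / (2 * (sin (\<theta> / 2))\<^sup>2) + b / (2 * (cos (\<theta> / 2))\<^sup>2))"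

lemma cot_tan_eq: "Psi_logderiv \<alpha> \<beta> \<theta> + Psi_logderiv (\<alpha> + 1) (\<beta> + 1) \<theta> = cot_tan (\<alpha> + 1) (\<beta> + 1) \<theta>"
  by (simp add: Psi_logderiv_def cot_tan_def field_simps)

lemma cot_tan_odd [simp]: "cot_tan a b (- \<theta>) = - cot_tan a b \<theta>"
  by (simp add: cot_tan_def cot_def tan_def)

lemma DERIV_cot_tan:
  assumes "\<theta> \<in> punctured"
  shows "(cot_tan a b has_real_derivative cot_tan_deriv a b \<theta>) (at \<theta>)"
proof -
  note t = punctured_bounds[OF assms]
  have "((\<lambda>x. cot (x / 2)) has_real_derivative - inverse ((sin (\<theta> / 2))\<^sup>2) * (1 / 2)) (at \<theta>)"
    by (rule DERIV_chain2[OF DERIV_cot]) (use t in \<open>auto intro!: derivative_eq_intros\<close>)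
  moreover have "((\<lambda>x. tan (x / 2)) has_real_derivative inverse ((cos (\<theta> / 2))\<^sup>2) * (1 / 2)) (at \<theta>)"
    by (rule DERIV_chain2[OF DERIV_tan]) (use t in \<open>auto intro!: derivative_eq_intros\<close>)
  ultimately have "((\<lambda>x. a * cot (x / 2) - b * tan (x / 2)) has_real_derivative
      a * (- inverse ((sin (\<theta> / 2))\<^sup>2) * (1 / 2)) - b * (inverse ((cos (\<theta> / 2))\<^sup>2) * (1 / 2))) (at \<theta>)"
    by (intro DERIV_diff DERIV_cmult)
  then show ?thesis unfolding cot_tan_def[abs_def]
    by (rule DERIV_cong) (use t in \<open>simp add: cot_tan_deriv_def field_simps\<close>)
qed

lemma continuous_on_cot_tan: "continuous_on punctured (cot_tan a b)"
  using DERIV_cot_tan by (intro continuous_at_imp_continuous_on) (blast intro: DERIV_isCont)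

lemma continuous_on_cot_tan_deriv: "continuous_on punctured (cot_tan_deriv a b)"
  unfolding cot_tan_deriv_def by (intro continuous_intros) (use punctured_bounds in force)+

lemma AE_leb_pi_of_punctured:
  assumes "AE x in lebesgue. x \<in> punctured \<longrightarrow> P x"
  shows "AE x in leb_pi. P x"
proof -
  have "AE x in lebesgue. x \<in> {-pi<..<pi} \<longrightarrow> P x"
    using assms AE_lebesgue_neq[of 0] by eventually_elim (auto simp: punctured_def)
  then show ?thesis by (subst AE_restrict_space_iff) auto
qed

text \<open>The symmetrized derivative also evaluates its argument at -theta, so an identity valid
  almost everywhere has to be carried through the reflection.\<close>

lemma AE_lebesgue_reflect:
  assumes "AE x in lebesgue. P (x :: real)"
  shows "AE x in lebesgue. P (- x)"
proof -
  obtain N where N: "N \<in> null_sets lebesgue" "{x. \<not> P x} \<subseteq> N"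
    using assms unfolding eventually_ae_filter by auto
  have "negligible N" using N(1) negligible_iff_null_sets by blast
  then have "negligible (uminus ` N)"
    by (intro negligible_differentiable_image_negligible differentiable_on_minus differentiable_on_ident) auto
  then have "uminus ` N \<in> null_sets lebesgue" using negligible_iff_null_sets by blast
  then have "AE x in lebesgue. x \<notin> uminus ` N" by (rule AE_not_in)
  then show ?thesis
  proof eventually_elim
    case (elim x)
    then show ?case using N(2) by (metis (mono_tags, lifting) image_eqI mem_Collect_eq minus_minus subsetD)
  qed
qed

text \<open>Let L0 and L1 be the logarithmic derivatives of Psi for the original and the raised
  parameters, and u the eigenfunction, so u' = L1 u. As u is odd, its symmetrized derivative is (L0
  + L1) u = M u with M = \<open>cot_tan\<close>. As M u is even, the next one is (M u)' - L1 M u =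
  M' u.\<close>

lemma second_sym_deriv_jacobi_Phi_1:
  assumes h1: "sym_deriv \<alpha> \<beta> (jacobi_Phi \<alpha> \<beta> 1) h1" and h2: "sym_deriv (\<alpha> + 1) (\<beta> + 1) h1 h2"
  shows "AE \<theta> in leb_pi. h2 \<theta> = of_real (jacobi_c (\<alpha> + 1) (\<beta> + 1) 0 / sqrt 2 *
    (sgn \<theta> * (jacobi_Psi (\<alpha> + 1) (\<beta> + 1) \<theta> * cot_tan_deriv (\<alpha> + 1) (\<beta> + 1) \<theta>)))"
proof -
  define a b where "a = \<alpha> + 1" and "b = \<beta> + 1"
  define c where "c = jacobi_c a b 0 / sqrt 2"
  let ?P = "jacobi_Psi a b" and ?L = "Psi_logderiv a b" and ?M = "cot_tan a b" and ?M' = "cot_tan_deriv a b"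
  define u where "u \<theta> = c * (sgn \<theta> * ?P \<theta>)" for \<theta>
  have u: "jacobi_Phi \<alpha> \<beta> 1 = (\<lambda>\<theta>. complex_of_real (u \<theta>))"
    using jacobi_Phi_1[of \<alpha> \<beta>] by (simp add: fun_eq_iff u_def c_def a_def b_def)
  have "weak_deriv (\<lambda>\<theta>. complex_of_real (u \<theta>)) (\<lambda>\<theta>. complex_of_real (c * (sgn \<theta> * (?P \<theta> * ?L \<theta>))))"
  proof (rule weak_deriv_of_real)
    show "(u has_real_derivative c * (sgn x * (?P x * ?L x))) (at x)" if "x \<in> punctured" for x
      unfolding u_def using punctured_bounds(3)[OF that] DERIV_jacobi_Psi[OF that]
      by (intro DERIV_cmult DERIV_sgn_mult)
    show "continuous_on punctured (\<lambda>\<theta>. c * (sgn \<theta> * (?P \<theta> * ?L \<theta>)))"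
      by (intro continuous_intros continuous_on_sgn_punctured continuous_on_jacobi_Psi continuous_on_Psi_logderiv)
  qed
  moreover have "weak_deriv (\<lambda>\<theta>. complex_of_real (u \<theta>))
     (\<lambda>\<theta>. h1 \<theta> + of_real (Psi_logderiv \<alpha> \<beta> \<theta>) * of_real (u (- \<theta>)))"
    using h1 unfolding sym_deriv_def Psi_logderiv_def[symmetric] u .
  ultimately have "AE \<theta> in lebesgue. \<theta> \<in> punctured \<longrightarrow>
      complex_of_real (c * (sgn \<theta> * (?P \<theta> * ?L \<theta>))) = h1 \<theta> + of_real (Psi_logderiv \<alpha> \<beta> \<theta>) * of_real (u (- \<theta>))"
    by (rule weak_deriv_unique_AE) simp
  moreover define v where "v \<theta> = c * (sgn \<theta> * (?P \<theta> * ?M \<theta>))" for \<theta>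
  have v_eq: "v \<theta> = c * (sgn \<theta> * (?P \<theta> * ?L \<theta>)) - Psi_logderiv \<alpha> \<beta> \<theta> * u (- \<theta>)" for \<theta>
    unfolding v_def cot_tan_eq[of \<alpha> \<beta> \<theta>, folded a_def b_def, symmetric] u_def
    by (simp add: sgn_minus algebra_simps)
  ultimately have AE1: "AE \<theta> in lebesgue. \<theta> \<in> punctured \<longrightarrow> h1 \<theta> = complex_of_real (v \<theta>)"
    by (auto elim!: eventually_mono simp: v_eq)
  have W1: "weak_deriv (\<lambda>\<theta>. complex_of_real (v \<theta>))
    (\<lambda>\<theta>. complex_of_real (c * (sgn \<theta> * (?P \<theta> * ?M' \<theta> + ?P \<theta> * ?L \<theta> * ?M \<theta>))))"
  proof (rule weak_deriv_of_real)
    show "(v has_real_derivative c * (sgn x * (?P x * ?M' x + ?P x * ?L x * ?M x))) (at x)" if "x \<in> punctured" for x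
      unfolding v_def using punctured_bounds(3)[OF that] DERIV_jacobi_Psi[OF that] DERIV_cot_tan[OF that]
      by (intro DERIV_cmult DERIV_sgn_mult DERIV_mult')
    show "continuous_on punctured (\<lambda>\<theta>. c * (sgn \<theta> * (?P \<theta> * ?M' \<theta> + ?P \<theta> * ?L \<theta> * ?M \<theta>)))"
      by (intro continuous_intros continuous_on_sgn_punctured continuous_on_jacobi_Psi continuous_on_Psi_logderiv
          continuous_on_cot_tan continuous_on_cot_tan_deriv)
  qed
  have W2: "weak_deriv h1 (\<lambda>\<theta>. h2 \<theta> + of_real (?L \<theta>) * h1 (- \<theta>))"
    using h2 unfolding sym_deriv_def Psi_logderiv_def[symmetric] a_def b_def .
  have AE2: "AE \<theta> in lebesgue. \<theta> \<in> punctured \<longrightarrow>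
      h2 \<theta> + of_real (?L \<theta>) * h1 (- \<theta>) = complex_of_real (c * (sgn \<theta> * (?P \<theta> * ?M' \<theta> + ?P \<theta> * ?L \<theta> * ?M \<theta>)))"
    by (rule weak_deriv_unique_AE[OF W2 W1 AE1])
  have "AE \<theta> in lebesgue. \<theta> \<in> punctured \<longrightarrow> h2 \<theta> = complex_of_real (c * (sgn \<theta> * (?P \<theta> * ?M' \<theta>)))"
    using AE2 AE_lebesgue_reflect[OF AE1]
  proof eventually_elim
    case (elim \<theta>)
    show ?case
    proof
      assume t: "\<theta> \<in> punctured"
      then have "h1 (- \<theta>) = complex_of_real (v (- \<theta>))" using elim(2) by (auto simp: punctured_def)
      also have "v (- \<theta>) = c * (sgn \<theta> * (?P \<theta> * ?M \<theta>))"
        by (simp add: v_def sgn_minus)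
      finally have "h2 \<theta> = complex_of_real (c * (sgn \<theta> * (?P \<theta> * ?M' \<theta> + ?P \<theta> * ?L \<theta> * ?M \<theta>))) - of_real (?L \<theta>) * complex_of_real (c * (sgn \<theta> * (?P \<theta> * ?M \<theta>)))"
        using elim(1) t by (simp add: eq_diff_eq)
      then show "h2 \<theta> = complex_of_real (c * (sgn \<theta> * (?P \<theta> * ?M' \<theta>)))"
        by (simp add: algebra_simps)
    qed
  qed
  then show ?thesis unfolding a_def b_def c_def by (rule AE_leb_pi_of_punctured)
qed

text \<open>Bounds an integral from below by a minorant on a compact subinterval; moving one end
  towards a singularity then exhibits divergence.\<close>

lemma FTC_le_LINT_leb_pi:
  assumes f: "integrable leb_pi f" "\<And>x. 0 \<le> f x" and uv: "-pi < u" "u \<le> v" "v < pi"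
    and G: "\<And>x. u \<le> x \<Longrightarrow> x \<le> v \<Longrightarrow> (G has_real_derivative g x) (at x)" "continuous_on {u..v} g"
    and le: "\<And>x. u \<le> x \<Longrightarrow> x \<le> v \<Longrightarrow> g x \<le> (f x :: real)"
  shows "G v - G u \<le> (LINT x|leb_pi. f x)"
proof -
  have "(LINT x|lborel. indicator {u..v} x *\<^sub>R g x) = G v - G u"
    using G uv by (intro integral_FTC_Icc)
      (auto simp flip: has_real_derivative_iff_has_vector_derivative intro: has_field_derivative_at_within)
  moreover have gi: "integrable lborel (\<lambda>x. indicator {u..v} x *\<^sub>R g x)"
    using G(2) by (intro borel_integrable_compact) auto
  ultimately have "G v - G u = (LINT x|lebesgue. indicator {u..v} x *\<^sub>R g x)"
    by (subst integral_completion) auto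
  also have "\<dots> \<le> (LINT x|lebesgue. indicator {-pi<..<pi} x *\<^sub>R f x)"
  proof (rule integral_mono)
    show "integrable lebesgue (\<lambda>x. indicator {u..v} x *\<^sub>R g x)"
      using gi by (subst integrable_completion) auto
    show "integrable lebesgue (\<lambda>x. indicator {-pi<..<pi} x *\<^sub>R f x)"
      using f(1) by (simp add: LINT_lebesgue_on(2))
    show "indicator {u..v} x *\<^sub>R g x \<le> indicator {-pi<..<pi} x *\<^sub>R f x" for x
      using le[of x] f(2)[of x] uv by (auto simp: indicator_def)
  qed
  finally show ?thesis by (simp add: LINT_lebesgue_on(1))
qed

text \<open>Here x is the factor that tends to 0 and y its companion: r p \<le> -1 gives x^(r p)
  \<ge> 1/x, and y \<ge> 1/2 controls the other power. The numerator y \<le> 1 is inserted because y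
  / x is then a cotangent or tangent, with a logarithmic antiderivative.\<close>

lemma powr_singular_lower_bound:
  fixes x y A u p r t :: real
  assumes "0 < x" "x \<le> 1" "1 / 2 \<le> y" "y \<le> 1" "0 < A" "0 < p" "0 \<le> t" "r * p \<le> -1"
    and u: "A * (x powr r * y powr t) \<le> u"
  shows "A powr p * (1 / 2) powr (t * p) * (y / x) \<le> u powr p"
proof -
  have "A powr p * (1 / 2) powr (t * p) * (y / x) \<le> A powr p * (1 / 2) powr (t * p) * (1 / x)"
    using assms by (intro mult_left_mono divide_right_mono) auto
  also have "\<dots> \<le> A powr p * (y powr (t * p) * x powr (r * p))"
  proof -
    have "(1 / 2) powr (t * p) \<le> y powr (t * p)" using assms by (intro powr_mono2) auto
    moreover have "1 / x \<le> x powr (r * p)"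
      using powr_mono'[of "r * p" "-1" x] assms by (simp add: powr_minus_divide)
    ultimately have "(1 / 2) powr (t * p) * (1 / x) \<le> y powr (t * p) * x powr (r * p)"
      using assms by (intro mult_mono) auto
    then show ?thesis unfolding mult.assoc by (rule mult_left_mono) simp
  qed
  also have "\<dots> = (A * (x powr r * y powr t)) powr p"
    using assms by (simp add: powr_mult powr_powr mult_ac)
  also have "\<dots> \<le> u powr p" using u assms by (intro powr_mono2) auto
  finally show ?thesis .
qed

text \<open>The base is a sum of two nonnegative terms, of order sin^(a-3/2) near 0 and cos^(b-3/2)
  near pi. The critical condition makes the p-th power of one of them at least a multiple of the
  reciprocal distance to its singular end, so the integral diverges at least
  logarithmically.\<close>

lemma not_integrable_second_deriv:
  assumes ab: "0 < a" "0 < b" and c: "0 < c" and p: "0 < p"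
    and crit: "a \<le> 3 / 2 - 1 / p \<or> b \<le> 3 / 2 - 1 / p"
  shows "\<not> integrable leb_pi (\<lambda>\<theta>. (c * (jacobi_Psi a b \<theta> * - cot_tan_deriv a b \<theta>)) powr p)"
proof
  let ?f = "\<lambda>\<theta>. (c * (jacobi_Psi a b \<theta> * - cot_tan_deriv a b \<theta>)) powr p"
  assume i: "integrable leb_pi ?f"
  define I where "I = (LINT \<theta>|leb_pi. ?f \<theta>)"
  have pi4: "sin (pi / 4) = sqrt 2 / 2" "cos (pi / 4) = sqrt 2 / 2" by (simp_all add: sin_45 cos_45)
  \<comment> \<open>The logarithm of sine and cosine at pi/4: the contribution of pi/2, the fixed
    end of the interval of integration.\<close>
  define L where "L = ln (sqrt 2 / 2)"
  have val: "c * (jacobi_Psi a b \<theta> * - cot_tan_deriv a b \<theta>)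
      = c * (a / 2) * (s powr (a - 3/2) * d powr (b + 1/2)) + c * (b / 2) * (d powr (b - 3/2) * s powr (a + 1/2))"
    if "0 < \<theta>" "\<theta> < pi" "s = sin (\<theta> / 2)" "d = cos (\<theta> / 2)" for \<theta> s d
  proof -
    have sd: "0 < s" "0 < d" using that sin_half_pos[of \<theta>] cos_half_pos[of \<theta>] by auto
    have pw: "z powr (r + 1/2) = z powr (r - 3/2) * z\<^sup>2" if "0 < z" for z r :: real
    proof -
      have "z powr (r - 3/2) * z\<^sup>2 = z powr ((r - 3/2) + 2)" using that by (simp only: powr_add powr_numeral)
      also have "(r - 3/2) + 2 = r + 1/2" by simp
      finally show ?thesis by simp
    qed
    note e = pw[OF sd(1), of a] pw[OF sd(2), of b]
    have "jacobi_Psi a b \<theta> = s powr (a + 1/2) * d powr (b + 1/2)" using sd that by (simp add: jacobi_Psi_def)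
    then show ?thesis
      unfolding cot_tan_deriv_def that(3)[symmetric] that(4)[symmetric] e
      using sd by (simp add: field_simps)
  qed
  have ar: "0 \<le> a + 1/2" "0 \<le> b + 1/2" using ab by auto
  have "\<exists>\<kappa>>0. \<forall>X\<ge>0. \<kappa> * (2 * X + 2 * L) \<le> I"
    using crit
  proof
    assume "a \<le> 3 / 2 - 1 / p"
    then have e: "(a - 3/2) * p \<le> -1" using p by (simp add: field_simps)
    define A where "A = c * (a / 2)"
    define \<kappa> where "\<kappa> = A powr p * (1 / 2) powr ((b + 1/2) * p)"
    have A: "0 < A" using ab c by (simp add: A_def)
    have \<kappa>: "0 < \<kappa>" using A by (simp add: \<kappa>_def)
    have "\<kappa> * (2 * X + 2 * L) \<le> I" if X: "0 \<le> X" for X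
    proof -
      \<comment> \<open>With the moving end at exp(-X), the logarithmic divergence becomes linear
        growth in X.\<close>
      define u where "u = exp (- X)"
      have u: "0 < u" "u \<le> 1" using X by (simp_all add: u_def)
      have u2: "u \<le> pi / 2" using u pi_gt3 by simp
      have "\<kappa> * (2 * ln (sin ((pi / 2) / 2))) - \<kappa> * (2 * ln (sin (u / 2))) \<le> I"
        unfolding I_def
      proof (rule FTC_le_LINT_leb_pi[OF i _ _ u2])
        fix x assume x: "u \<le> x" "x \<le> pi / 2"
        then have x0: "0 < x" "x < pi" using u by auto
        have s: "0 < sin (x / 2)" using x0 by (intro sin_half_pos)
        show "((\<lambda>x. \<kappa> * (2 * ln (sin (x / 2)))) has_real_derivative \<kappa> * (cos (x / 2) / sin (x / 2))) (at x)"
          using s by (auto intro!: derivative_eq_intros)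
        have "cos (pi / 3) \<le> cos (x / 2)" using x x0 by (intro cos_monotone_0_pi_le) auto
        then have d: "1 / 2 \<le> cos (x / 2)" by (simp add: cos_60)
        have "0 \<le> c * (b / 2) * (cos (x / 2) powr (b - 3/2) * sin (x / 2) powr (a + 1/2))"
          using ab c by (intro mult_nonneg_nonneg) auto
        then have low: "A * (sin (x / 2) powr (a - 3/2) * cos (x / 2) powr (b + 1/2))
            \<le> c * (jacobi_Psi a b x * - cot_tan_deriv a b x)"
          unfolding val[OF x0 refl refl] A_def by simp
        show "\<kappa> * (cos (x / 2) / sin (x / 2)) \<le> ?f x"
          unfolding \<kappa>_def by (rule powr_singular_lower_bound[OF s _ d _ A p ar(2) e low]) auto
      next
        have "sin (x / 2) \<noteq> 0" if "x \<in> {u..pi / 2}" for x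
          using sin_half_pos[of x] that u by auto
        then show "continuous_on {u..pi / 2} (\<lambda>x. \<kappa> * (cos (x / 2) / sin (x / 2)))"
          by (intro continuous_intros) auto
        show "- pi < u" using u pi_gt_zero by linarith
      qed auto
      moreover have "ln (sin (u / 2)) \<le> - X"
      proof -
        have "sin (u / 2) \<le> u" using sin_x_le_x[of "u / 2"] u by simp
        then have "ln (sin (u / 2)) \<le> ln u" using sin_half_pos[of u] u u2 pi_gt_zero by (subst ln_le_cancel_iff) auto
        then show ?thesis by (simp add: u_def)
      qed
      then have "\<kappa> * (2 * ln (sin (u / 2))) \<le> \<kappa> * (2 * (- X))" using \<kappa> by (intro mult_left_mono) auto
      ultimately show ?thesis by (simp add: pi4 L_def algebra_simps)
    qed
    then show ?thesis using \<kappa> by blast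
  next
    assume "b \<le> 3 / 2 - 1 / p"
    then have e: "(b - 3/2) * p \<le> -1" using p by (simp add: field_simps)
    define A where "A = c * (b / 2)"
    define \<kappa> where "\<kappa> = A powr p * (1 / 2) powr ((a + 1/2) * p)"
    have A: "0 < A" using ab c by (simp add: A_def)
    have \<kappa>: "0 < \<kappa>" using A by (simp add: \<kappa>_def)
    have "\<kappa> * (2 * X + 2 * L) \<le> I" if X: "0 \<le> X" for X
    proof -
      define u where "u = exp (- X)"
      have u: "0 < u" "u \<le> 1" using X by (simp_all add: u_def)
      have u2: "pi / 2 \<le> pi - u" using u pi_gt3 by simp
      have "\<kappa> * (- 2 * ln (cos ((pi - u) / 2))) - \<kappa> * (- 2 * ln (cos ((pi / 2) / 2))) \<le> I"
        unfolding I_def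
      proof (rule FTC_le_LINT_leb_pi[OF i _ _ u2])
        fix x assume x: "pi / 2 \<le> x" "x \<le> pi - u"
        then have x0: "0 < x" "x < pi" using u pi_gt_zero by (auto intro: less_le_trans[of 0 "pi / 2"])
        have s: "0 < cos (x / 2)" using x0 by (intro cos_half_pos) auto
        show "((\<lambda>x. \<kappa> * (- 2 * ln (cos (x / 2)))) has_real_derivative \<kappa> * (sin (x / 2) / cos (x / 2))) (at x)"
          using s by (auto intro!: derivative_eq_intros)
        have "sin (pi / 6) \<le> sin (x / 2)" using x x0 by (intro sin_monotone_2pi_le) auto
        then have d: "1 / 2 \<le> sin (x / 2)" by (simp add: sin_30)
        have "0 \<le> c * (a / 2) * (sin (x / 2) powr (a - 3/2) * cos (x / 2) powr (b + 1/2))"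
          using ab c by (intro mult_nonneg_nonneg) auto
        then have low: "A * (cos (x / 2) powr (b - 3/2) * sin (x / 2) powr (a + 1/2))
            \<le> c * (jacobi_Psi a b x * - cot_tan_deriv a b x)"
          unfolding val[OF x0 refl refl] A_def by simp
        show "\<kappa> * (sin (x / 2) / cos (x / 2)) \<le> ?f x"
          unfolding \<kappa>_def by (rule powr_singular_lower_bound[OF s _ d _ A p ar(1) e low]) auto
      next
        have "cos (x / 2) \<noteq> 0" if "x \<in> {pi / 2..pi - u}" for x
          using cos_half_pos[of x] that u pi_gt_zero by auto
        then show "continuous_on {pi / 2..pi - u} (\<lambda>x. \<kappa> * (sin (x / 2) / cos (x / 2)))"
          by (intro continuous_intros) auto
      qed (use u pi_gt_zero in auto)
      moreover have "cos ((pi - u) / 2) = sin (u / 2)" by (simp add: sin_cos_eq diff_divide_distrib)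
      moreover have "ln (sin (u / 2)) \<le> - X"
      proof -
        have "sin (u / 2) \<le> u" using sin_x_le_x[of "u / 2"] u by simp
        then have "ln (sin (u / 2)) \<le> ln u" using sin_half_pos[of u] u u2 pi_gt_zero by (subst ln_le_cancel_iff) auto
        then show ?thesis by (simp add: u_def)
      qed
      then have "\<kappa> * (2 * ln (sin (u / 2))) \<le> \<kappa> * (2 * (- X))" using \<kappa> by (intro mult_left_mono) auto
      ultimately show ?thesis by (simp add: pi4 L_def algebra_simps)
    qed
    then show ?thesis using \<kappa> by blast
  qed
  then obtain \<kappa> where \<kappa>: "0 < \<kappa>" "\<And>X. 0 \<le> X \<Longrightarrow> \<kappa> * (2 * X + 2 * L) \<le> I" by blast
  \<comment> \<open>Chosen so that 2 X + 2 L \<ge> |I| / \<kappa> + 1, which forces I \<ge> |I| +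
    \<kappa>.\<close>
  define X where "X = \<bar>I\<bar> / \<kappa> + \<bar>L\<bar> + 1"
  have X: "0 \<le> X" using \<kappa>(1) by (simp add: X_def)
  have "\<kappa> * (\<bar>I\<bar> / \<kappa> + 1) \<le> \<kappa> * (2 * X + 2 * L)"
  proof (rule mult_left_mono)
    have "0 \<le> \<bar>I\<bar> / \<kappa>" "- \<bar>L\<bar> \<le> L" using \<kappa>(1) by simp_all
    then show "\<bar>I\<bar> / \<kappa> + 1 \<le> 2 * X + 2 * L" unfolding X_def distrib_left by linarith
  qed (use \<kappa> in simp)
  then have "\<bar>I\<bar> + \<kappa> \<le> I" using \<kappa>(2)[OF X] \<kappa>(1) by (simp add: distrib_left)
  then show False using \<kappa>(1) by linarith
qed

text \<open>Membership would supply some second derivative in L^p. Uniqueness of weak derivatives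
  identifies it almost everywhere with the explicit function, whose p-th power is not
  integrable.\<close>

theorem jacobi_Phi_1_not_sobolev:
  assumes ab: "-1 < \<alpha>" "-1 < \<beta>" and p: "0 < p"
    and crit: "\<alpha> \<le> - 1 / p + 1 / 2 \<or> \<beta> \<le> - 1 / p + 1 / 2"
  shows "jacobi_Phi \<alpha> \<beta> 1 \<notin> sobolev_frakW \<alpha> \<beta> p 2"
proof
  assume "jacobi_Phi \<alpha> \<beta> 1 \<in> sobolev_frakW \<alpha> \<beta> p 2"
  then obtain h where h0: "h 0 = jacobi_Phi \<alpha> \<beta> 1"
    and h: "\<And>k. k < 2 \<Longrightarrow> sym_deriv (\<alpha> + real k) (\<beta> + real k) (h k) (h (Suc k)) \<and> h (Suc k) \<in> Lp p"
    unfolding sobolev_frakW_def by blast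
  define a b where "a = \<alpha> + 1" and "b = \<beta> + 1"
  have ab': "0 < a" "0 < b" using ab by (simp_all add: a_def b_def)
  define c where "c = jacobi_c a b 0 / sqrt 2"
  have c: "0 < c" using jacobi_c_pos(1)[OF ab'] by (simp add: c_def)
  let ?e = "\<lambda>\<theta>. (c * (jacobi_Psi a b \<theta> * - cot_tan_deriv a b \<theta>)) powr p"
  have "AE \<theta> in leb_pi. h 2 \<theta> = of_real (c * (sgn \<theta> * (jacobi_Psi a b \<theta> * cot_tan_deriv a b \<theta>)))"
    unfolding a_def b_def c_def
    using h[of 0] h[of 1] by (intro second_sym_deriv_jacobi_Phi_1[of _ _ "h 1"]) (simp_all add: h0 numeral_2_eq_2)
  moreover have "AE \<theta> in leb_pi. \<theta> \<noteq> 0" by (rule AE_leb_pi) auto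
  ultimately have AE: "AE \<theta> in leb_pi. norm (h 2 \<theta>) powr p = ?e \<theta>"
  proof eventually_elim
    case (elim \<theta>)
    have "0 \<le> a / (2 * (sin (\<theta> / 2))\<^sup>2)" "0 \<le> b / (2 * (cos (\<theta> / 2))\<^sup>2)" using ab' by simp_all
    then have "cot_tan_deriv a b \<theta> \<le> 0" unfolding cot_tan_deriv_def by linarith
    then have "norm (h 2 \<theta>) = c * (jacobi_Psi a b \<theta> * - cot_tan_deriv a b \<theta>)"
      unfolding elim(1) norm_of_real abs_mult using elim(2) c jacobi_Psi_nonneg[of a b \<theta>] by (simp add: abs_sgn_eq)
    then show ?case by simp
  qed
  have "integrable leb_pi (\<lambda>\<theta>. norm (h 2 \<theta>) powr p)"
    using h[of 1] by (simp add: Lp_def numeral_2_eq_2)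
  moreover have "?e \<in> borel_measurable leb_pi"
    by (rule measurable_lebesgue_on) (unfold cot_tan_deriv_def, measurable)
  ultimately have "integrable leb_pi ?e"
    using AE integrable_cong_AE[OF borel_measurable_integrable] by blast
  moreover have "a \<le> 3 / 2 - 1 / p \<or> b \<le> 3 / 2 - 1 / p" using crit by (auto simp: a_def b_def)
  ultimately show False using not_integrable_second_deriv[OF ab' c p] by blast
qed

theorem proposition3p4:
  fixes \<alpha> \<beta> p :: real
  assumes "\<alpha> > -1" and "\<beta> > -1" and "p \<in> exponents_E \<alpha> \<beta>"
  shows "(\<alpha> < 1 / p - 1 / 2 \<and> \<beta> < 1 / p - 1 / 2 \<longrightarrow>
            sobolev_W \<alpha> \<beta> p 1 = sobolev_frakW \<alpha> \<beta> p 1 \<and>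
            (\<exists>f \<in> sobolev_W \<alpha> \<beta> p 1. f \<notin> potential_space \<alpha> \<beta> p 1)) \<and>
         (\<alpha> \<le> - 1 / p + 1 / 2 \<or> \<beta> \<le> - 1 / p + 1 / 2 \<longrightarrow>
            (\<exists>g \<in> potential_space \<alpha> \<beta> p 2. g \<notin> sobolev_frakW \<alpha> \<beta> p 2))"
proof -
  have p: "0 < p" using exponents_E_bounds(1)[OF assms] by simp
  show ?thesis
    using sobolev_1_eq inv_ground_sobolev[OF p] inv_ground_not_potential[OF assms]
      jacobi_Phi_1_potential[OF assms(1,2) p] jacobi_Phi_1_not_sobolev[OF assms(1,2) p]
    by blast
qed

end
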